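(* Let $X$ be an $\mathcal{MK}_\omega$-space. Then: (i) $A(X)$, $F(X)$ and $L(X)$ have a $\mathfrak{G}$-base satisfying the condition $(\mathbf{D})$ and are $\mathcal{P}_0$-spaces. (ii)(a) If $X$ is not discrete, then $\chi(A(X))=\chi(F(X))=\chi(L(X))=\mathfrak{d}$. (ii)(b) If $X$ is discrete, then $\chi(A(X))=\chi(F(X))=1$, and $\chi(L(X))=\aleph_0$ if $X$ is finite while $\chi(L(X))=\mathfrak{d}$ if $X$ is infinite.
   Context: An $\mathcal{MK}_\omega$-space is a space $X$ which is the union of an increasing sequence of compact metrizable subsets $K_n$ such that a set $F\subseteq X$ is closed iff $F\cap K_n$ is closed for each $n$. For a Tychonoff space $X$: $F(X)$ (resp. $A(X)$) is the Markov free (resp. free abelian) topological group over $X$, i.e. the topological group (resp. abelian topological group) containing $X$ as a generating set such that every continuous map from $X$ into a topological group (resp. abelian topological group) extends uniquely to a continuous homomorphism; $L(X)$ is the free locally convex space over $X$, i.e. the lcs containing $X$ such that every continuous map from $X$ to a lcs extends uniquely to a continuous linear operator. $\chi$ denotes character (least cardinality of a base of neighborhoods at a point, supremum over points). $\mathfrak{d}$ is the cofinality of $\mathbb{N}^\mathbb{N}$ with the coordinatewise order. A $\mathfrak{G}$-base of a topological group $G$ is a base $\{U_\alpha:\alpha\in\mathbb{N}^\mathbb{N}\}$ at the unit with $U_\beta\subseteq U_\alpha$ whenever $\alpha\le\beta$; with $I_k(\alpha)=\{\beta:\beta_i=\alpha_i,\ i\le k\}$ and $D_k(\alpha)=\bigcap_{\beta\in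 I_k(\alpha)}U_\beta$, it satisfies condition $(\mathbf{D})$ if $U_\alpha=\bigcup_kD_k(\alpha)$ for all $\alpha$. A family $\mathcal{N}$ is a $cp$-network at $x$ if for every neighborhood $O_x$ of $x$ there is $N\in\mathcal{N}$ with $x\in N\subseteq O_x$, and for every $A\subseteq X$ with $x\in\overline{A}\setminus A$ and every neighborhood $O_x$ there is $N\in\mathcal{N}$ with $x\in N\subseteq O_x$ and $N\cap A$ infinite; a $\mathcal{P}_0$-space is a regular space with a countable family that is a $cp$-network at every point. *)

theory Defs
  imports "HOL-Analysis.Analysis"
begin

unbundle cardinal_syntax

definition MK_omega_space :: "'a topology \<Rightarrow> bool" where
  "MK_omega_space X \<longleftrightarrow>
     (\<exists>K :: nat \<Rightarrow> 'a set.
        (\<forall>n. K n \<subseteq> K (Suc n)) \<and>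
        (\<forall>n. compactin X (K n) \<and> metrizable_space (subtopology X (K n))) \<and>
        (\<Union>n. K n) = topspace X \<and>
        (\<forall>F. F \<subseteq> topspace X \<longrightarrow>
              (closedin X F \<longleftrightarrow> (\<forall>n. closedin (subtopology X (K n)) (F \<inter> K n)))))"

definition sup_topology :: "'g set \<Rightarrow> ('g topology \<Rightarrow> bool) \<Rightarrow> 'g topology" where
  "sup_topology C P = topology_generated_by (insert C (\<Union>{{U. openin T U} | T. P T}))"

definition group_topology ::
  "'g set \<Rightarrow> ('g \<Rightarrow> 'g \<Rightarrow> 'g) \<Rightarrow> ('g \<Rightarrow> 'g) \<Rightarrow> 'g topology \<Rightarrow> bool" where
  "group_topology C gm gi T \<longleftrightarrow>
     topspace T = C \<and>
     continuous_map (prod_topology T T) T (\<lambda>(x, y). gm x y) \<and>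
     continuous_map T T gi"

text \<open>A letter (True, x) stands for x, (False, x) for x inverse.\<close>

fun freduce :: "(bool \<times> 'a) list \<Rightarrow> (bool \<times> 'a) list" where
  "freduce [] = []"
| "freduce (a # w) =
     (case freduce w of
        [] \<Rightarrow> [a]
      | b # w' \<Rightarrow> (if fst b = (\<not> fst a) \<and> snd b = snd a then w' else a # b # w'))"

definition fg_carrier :: "'a topology \<Rightarrow> (bool \<times> 'a) list set" where
  "fg_carrier X = {w. freduce w = w \<and> snd ` set w \<subseteq> topspace X}"

definition fg_mult :: "(bool \<times> 'a) list \<Rightarrow> (bool \<times> 'a) list \<Rightarrow> (bool \<times> 'a) list" where
  "fg_mult v w = freduce (v @ w)"

definition fg_inv :: "(bool \<times> 'a) list \<Rightarrow> (bool \<times> 'a) list" where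
  "fg_inv w = rev (map (\<lambda>(b, x). (\<not> b, x)) w)"

definition fg_ins :: "'a \<Rightarrow> (bool \<times> 'a) list" where
  "fg_ins x = [(True, x)]"

definition free_top_group :: "'a topology \<Rightarrow> (bool \<times> 'a) list topology" where
  "free_top_group X = sup_topology (fg_carrier X)
     (\<lambda>T. group_topology (fg_carrier X) fg_mult fg_inv T \<and> continuous_map X T fg_ins)"

definition fa_carrier :: "'a topology \<Rightarrow> ('a \<Rightarrow> int) set" where
  "fa_carrier X = {f. finite {x. f x \<noteq> 0} \<and> {x. f x \<noteq> 0} \<subseteq> topspace X}"

definition fa_ins :: "'a \<Rightarrow> 'a \<Rightarrow> int" where
  "fa_ins x = (\<lambda>y. if y = x then 1 else 0)"

definition free_abelian_top_group :: "'a topology \<Rightarrow> ('a \<Rightarrow> int) topology" where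
  "free_abelian_top_group X = sup_topology (fa_carrier X)
     (\<lambda>T. group_topology (fa_carrier X) (\<lambda>f g y. f y + g y) (\<lambda>f y. - f y) T \<and> continuous_map X T fa_ins)"

definition fl_carrier :: "'a topology \<Rightarrow> ('a \<Rightarrow> real) set" where
  "fl_carrier X = {f. finite {x. f x \<noteq> 0} \<and> {x. f x \<noteq> 0} \<subseteq> topspace X}"

definition fl_ins :: "'a \<Rightarrow> 'a \<Rightarrow> real" where
  "fl_ins x = (\<lambda>y. if y = x then 1 else 0)"

definition convex_fun_set :: "('a \<Rightarrow> real) set \<Rightarrow> bool" where
  "convex_fun_set V \<longleftrightarrow>
     (\<forall>u\<in>V. \<forall>v\<in>V. \<forall>t::real. 0 \<le> t \<and> t \<le> 1 \<longrightarrow> (\<lambda>y. t * u y + (1 - t) * v y) \<in> V)"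

definition lc_topology :: "('a \<Rightarrow> real) set \<Rightarrow> ('a \<Rightarrow> real) topology \<Rightarrow> bool" where
  "lc_topology C T \<longleftrightarrow>
     topspace T = C \<and>
     continuous_map (prod_topology T T) T (\<lambda>(f, g). (\<lambda>y. f y + g y)) \<and>
     continuous_map (prod_topology euclideanreal T) T (\<lambda>(r, f). (\<lambda>y. r * f y)) \<and>
     (\<forall>U. openin T U \<and> (\<lambda>_. 0 :: real) \<in> U \<longrightarrow>
          (\<exists>V. openin T V \<and> (\<lambda>_. 0) \<in> V \<and> V \<subseteq> U \<and> convex_fun_set V))"

definition free_lcs :: "'a topology \<Rightarrow> ('a \<Rightarrow> real) topology" where
  "free_lcs X = sup_topology (fl_carrier X)
     (\<lambda>T. lc_topology (fl_carrier X) T \<and> continuous_map X T fl_ins)"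

definition nbhd :: "'g topology \<Rightarrow> 'g \<Rightarrow> 'g set \<Rightarrow> bool" where
  "nbhd T x N \<longleftrightarrow> (\<exists>U. openin T U \<and> x \<in> U \<and> U \<subseteq> N \<and> N \<subseteq> topspace T)"

definition nbhd_base :: "'g topology \<Rightarrow> 'g \<Rightarrow> 'g set set \<Rightarrow> bool" where
  "nbhd_base T x B \<longleftrightarrow> (\<forall>N\<in>B. nbhd T x N) \<and> (\<forall>W. nbhd T x W \<longrightarrow> (\<exists>N\<in>B. N \<subseteq> W))"

definition char_le :: "'g topology \<Rightarrow> 'c set \<Rightarrow> bool" where
  "char_le T A \<longleftrightarrow> (\<forall>x\<in>topspace T. \<exists>B. nbhd_base T x B \<and> card_of B \<le>o card_of A)"

definition character_eq :: "'g topology \<Rightarrow> 'c set \<Rightarrow> bool" where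
  "character_eq T A \<longleftrightarrow> char_le T A \<and> (\<forall>C :: 'g set set set. char_le T C \<longrightarrow> card_of A \<le>o card_of C)"

definition dominating :: "(nat \<Rightarrow> nat) set \<Rightarrow> bool" where
  "dominating D \<longleftrightarrow> (\<forall>f. \<exists>g\<in>D. \<forall>n. f n \<le> g n)"

text \<open>A cofinal family in (N^N, <=) of least cardinality; its cardinality is d.\<close>
definition dfrak :: "(nat \<Rightarrow> nat) set" where
  "dfrak = (SOME D. dominating D \<and> (\<forall>D'. dominating D' \<longrightarrow> card_of D \<le>o card_of D'))"

definition G_base_D :: "'g topology \<Rightarrow> 'g \<Rightarrow> ((nat \<Rightarrow> nat) \<Rightarrow> 'g set) \<Rightarrow> bool" where
  "G_base_D T e U \<longleftrightarrow>
     (\<forall>\<alpha>. nbhd T e (U \<alpha>)) \<and>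
     (\<forall>W. nbhd T e W \<longrightarrow> (\<exists>\<alpha>. U \<alpha> \<subseteq> W)) \<and>
     (\<forall>\<alpha> \<beta>. (\<forall>i. \<alpha> i \<le> \<beta> i) \<longrightarrow> U \<beta> \<subseteq> U \<alpha>) \<and>
     (\<forall>\<alpha>. U \<alpha> = (\<Union>k. \<Inter>{U \<beta> | \<beta>. \<forall>i\<le>k. \<beta> i = \<alpha> i}))"

definition has_G_base_D :: "'g topology \<Rightarrow> 'g \<Rightarrow> bool" where
  "has_G_base_D T e \<longleftrightarrow> (\<exists>U. G_base_D T e U)"

definition cp_network :: "'g topology \<Rightarrow> 'g set set \<Rightarrow> 'g \<Rightarrow> bool" where
  "cp_network T \<N> x \<longleftrightarrow>
     (\<forall>W. nbhd T x W \<longrightarrow> (\<exists>N\<in>\<N>. x \<in> N \<and> N \<subseteq> W)) \<and>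
     (\<forall>A W. A \<subseteq> topspace T \<and> x \<in> T closure_of A \<and> x \<notin> A \<and> nbhd T x W \<longrightarrow>
        (\<exists>N\<in>\<N>. x \<in> N \<and> N \<subseteq> W \<and> infinite (N \<inter> A)))"

definition P0_space :: "'g topology \<Rightarrow> bool" where
  "P0_space T \<longleftrightarrow> regular_space T \<and> t1_space T \<and>
     (\<exists>\<N>. countable \<N> \<and> (\<forall>x\<in>topspace T. cp_network T \<N> x))"

end

theory Submission
  imports Defs "HOL-Algebra.Group"
begin

text \<open>
  Let \<open>X\<close> be the union of the compact metric spaces \<open>K n\<close>.  In each of the three cases the free
  topology is the finest admissible one, so it suffices to exhibit a base \<open>U \<alpha>\<close> at the unit, indexed by
  \<open>\<alpha> :: nat \<Rightarrow> nat\<close>, which generates an admissible topology and refines the neighbourhoods of the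
  unit in every other admissible topology.  For the groups, \<open>U \<alpha>\<close> consists of the products of conjugates of
  \<open>x\<inverse> y\<close>, where the factors carry pairwise distinct indices \<open>n\<close>, the points \<open>x, y \<in> K n\<close> are
  \<open>1 / (\<alpha> n + 1)\<close>-close and the conjugator is a word of length at most \<open>n\<close> over \<open>K n\<close>.  For the locally
  convex space, \<open>U \<alpha>\<close> is the absolutely convex hull of the multiples \<open>(n + 1) (y - x)\<close> of such
  differences and of small multiples of the points of \<open>K n\<close>.  In both cases an element of \<open>U \<alpha>\<close> depends
  on finitely many values of \<open>\<alpha>\<close> only, which is condition (D).

  A base with (D) together with a countable network gives a countable cp-network.  The character is at
  most \<open>|dfrak|\<close> because a dominating family of indices yields a base.  It is at least \<open>|dfrak|\<close> because,
  for a nontrivial sequence \<open>s i\<close> converging to \<open>a\<close>, the powers \<open>(a\<inverse> s i) ^ (2 ^ n)\<close> converge to the unit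
  for each \<open>n\<close>, but the index from which on they lie in a given neighbourhood can grow arbitrarily fast
  with \<open>n\<close>; over an infinite discrete space the small multiples of infinitely many points do the same.
\<close>

section \<open>Group topologies given by a base at the unit\<close>

text \<open>The indices in a product must be distinct because a neighbourhood has to control
  products of arbitrarily many factors: each level contributes at most one factor, so the smallness
  demanded at level \<open>n\<close> can increase with \<open>n\<close> and the whole product stays
  small. Conjugators are there because a base at the unit of a noncommutative group must be stable
  under inner automorphisms. Tying a conjugator at level \<open>n\<close> to length \<open>n\<close>
  over the compact \<open>K n\<close> keeps conjugation uniformly under control in every admissible
  topology, while conjugation by a fixed element only shifts levels. Separation of points is where
  the cases part. Homomorphisms into the reals separate A(X), and linear functionals separate L(X),
  but homomorphisms into an abelian group vanish on commutators, so F(X) needs endomorphisms. For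
  the lower bound a single function on \<open>X\<close> must serve all \<open>n\<close> at once. It
  can only be asked to be at least \<open>1 / 2 ^ n\<close> on an initial part of the sequence
  depending on \<open>n\<close>; the powers \<open>2 ^ n\<close> lift these values to 1.\<close>

lemma sup_topology_eq_greatest:
  assumes "P T0" and "topspace T0 = C"
    and coarser: "\<And>T U. P T \<Longrightarrow> openin T U \<Longrightarrow> openin T0 U"
  shows "sup_topology C P = T0"
proof -
  let ?S = "insert C (\<Union>{{U. openin T U} | T. P T})"
  have "openin (topology_generated_by ?S) U \<longleftrightarrow> openin T0 U" for U
  proof
    assume "openin (topology_generated_by ?S) U"
    then have gen: "generate_topology_on ?S U"
      by (simp add: openin_topology_generated_by_iff)
    show "openin T0 U"
    proof (rule generate_topology_on_coarsest[OF _ _ gen])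
      show "openin T0 V" if "V \<in> ?S" for V
        using that coarser assms(2) by (auto simp: openin_topspace[of T0, simplified])
    qed (rule istopology_openin)
  next
    assume "openin T0 U"
    then show "openin (topology_generated_by ?S) U"
      using assms(1) by (intro topology_generated_by_Basis) auto
  qed
  then show ?thesis
    unfolding sup_topology_def by (simp add: topology_eq)
qed

lemma (in group) inv_mult_cancel_left:
  assumes "x \<in> carrier G" "y \<in> carrier G"
  shows "inv x \<otimes> (x \<otimes> y) = y" "x \<otimes> (inv x \<otimes> y) = y"
  using assms by (simp_all add: m_assoc[symmetric])

locale top_group = group G for G :: "('g, 'm) monoid_scheme" (structure) +
  fixes T :: "'g topology"
  assumes group_topology: "group_topology (carrier G) (mult G) (m_inv G) T"
begin

lemma topspace_eq: "topspace T = carrier G"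
  using group_topology by (simp add: group_topology_def)

lemma open_subset: "openin T W \<Longrightarrow> W \<subseteq> carrier G"
  using openin_subset topspace_eq by blast

lemma mult_nbhds:
  assumes "openin T W" and "x \<otimes> y \<in> W" and "x \<in> carrier G" "y \<in> carrier G"
  obtains A B where "openin T A" "openin T B" "x \<in> A" "y \<in> B" "\<And>a b. a \<in> A \<Longrightarrow> b \<in> B \<Longrightarrow> a \<otimes> b \<in> W"
proof -
  define Z where "Z = {z \<in> topspace (prod_topology T T). (\<lambda>(x, y). x \<otimes> y) z \<in> W}"
  have "openin (prod_topology T T) Z"
    using group_topology assms(1) unfolding group_topology_def Z_def
    by (intro openin_continuous_map_preimage) auto
  moreover have "(x, y) \<in> Z"
    using assms topspace_eq by (auto simp: Z_def)
  ultimately have "\<exists>A B. openin T A \<and> openin T B \<and> x \<in> A \<and> y \<in> B \<and> A \<times> B \<subseteq> Z"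
    unfolding openin_prod_topology_alt by simp
  then obtain A B where AB: "openin T A" "openin T B" "x \<in> A" "y \<in> B" "A \<times> B \<subseteq> Z"
    by blast
  have "a \<otimes> b \<in> W" if "a \<in> A" "b \<in> B" for a b
    using AB(5) that by (auto simp: Z_def)
  then show thesis
    using that AB by blast
qed

lemma inv_preimage_open: "openin T W \<Longrightarrow> openin T {x \<in> carrier G. inv x \<in> W}"
  using group_topology openin_continuous_map_preimage[of T T "m_inv G" W]
  by (simp add: group_topology_def)

lemma left_translate_open:
  assumes "openin T W" and "x \<in> carrier G"
  shows "openin T {y \<in> carrier G. x \<otimes> y \<in> W}"
proof (subst openin_subopen, safe)
  fix y assume y: "y \<in> carrier G" "x \<otimes> y \<in> W"
  obtain A B where "openin T A" "openin T B" "x \<in> A" "y \<in> B"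
    "\<And>a b. a \<in> A \<Longrightarrow> b \<in> B \<Longrightarrow> a \<otimes> b \<in> W"
    by (rule mult_nbhds[OF assms(1) y(2) assms(2) y(1)]) (rule that)
  then show "\<exists>V. openin T V \<and> y \<in> V \<and> V \<subseteq> {y \<in> carrier G. x \<otimes> y \<in> W}"
    using open_subset by blast
qed

lemma square_nbhd:
  assumes "openin T W" and "\<one> \<in> W"
  obtains V where "openin T V" "\<one> \<in> V" "\<And>x y. x \<in> V \<Longrightarrow> y \<in> V \<Longrightarrow> x \<otimes> y \<in> W"
proof -
  obtain A B where "openin T A" "openin T B" "\<one> \<in> A" "\<one> \<in> B"
    "\<And>a b. a \<in> A \<Longrightarrow> b \<in> B \<Longrightarrow> a \<otimes> b \<in> W"
    by (rule mult_nbhds[of W \<one> \<one>]) (simp_all add: assms)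
  then show thesis
    by (intro that[of "A \<inter> B"]) auto
qed

lemma cube_nbhd:
  assumes "openin T W" and "\<one> \<in> W"
  obtains V where "openin T V" "\<one> \<in> V"
    "\<And>x y z. x \<in> V \<Longrightarrow> y \<in> V \<Longrightarrow> z \<in> V \<Longrightarrow> x \<otimes> y \<otimes> z \<in> W"
proof -
  obtain V1 where V1: "openin T V1" "\<one> \<in> V1" "\<And>x y. x \<in> V1 \<Longrightarrow> y \<in> V1 \<Longrightarrow> x \<otimes> y \<in> W"
    by (rule square_nbhd[OF assms]) (rule that)
  obtain V2 where V2: "openin T V2" "\<one> \<in> V2" "\<And>x y. x \<in> V2 \<Longrightarrow> y \<in> V2 \<Longrightarrow> x \<otimes> y \<in> V1"
    by (rule square_nbhd[OF V1(1,2)]) (rule that)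
  show thesis
    by (rule that[of "V1 \<inter> V2"]) (use V1 V2 in auto)
qed

lemma left_quotient_nbhd:
  assumes "openin T W" and "\<one> \<in> W"
  obtains V where "openin T V" "\<one> \<in> V" "\<And>x y. x \<in> V \<Longrightarrow> y \<in> V \<Longrightarrow> inv x \<otimes> y \<in> W"
proof -
  obtain V1 where V1: "openin T V1" "\<one> \<in> V1" "\<And>x y. x \<in> V1 \<Longrightarrow> y \<in> V1 \<Longrightarrow> x \<otimes> y \<in> W"
    by (rule square_nbhd[OF assms]) (rule that)
  show thesis
    by (rule that[of "V1 \<inter> {x \<in> carrier G. inv x \<in> V1}"])
      (use V1 inv_preimage_open in \<open>auto intro!: openin_Int\<close>)
qed

lemma conj_nbhds:
  assumes "openin T W" and "\<one> \<in> W" and "g \<in> carrier G"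
  obtains A V where "openin T A" "g \<in> A" "openin T V" "\<one> \<in> V"
    "\<And>a x. a \<in> A \<Longrightarrow> x \<in> V \<Longrightarrow> a \<otimes> x \<otimes> inv a \<in> W"
proof -
  obtain B1 C1 where 1: "openin T B1" "openin T C1" "g \<in> B1" "inv g \<in> C1"
    "\<And>a b. a \<in> B1 \<Longrightarrow> b \<in> C1 \<Longrightarrow> a \<otimes> b \<in> W"
    by (rule mult_nbhds[of W g "inv g"]) (simp_all add: assms)
  obtain B2 C2 where 2: "openin T B2" "openin T C2" "g \<in> B2" "\<one> \<in> C2"
    "\<And>a b. a \<in> B2 \<Longrightarrow> b \<in> C2 \<Longrightarrow> a \<otimes> b \<in> B1"
    by (rule mult_nbhds[of B1 g \<one>]) (simp_all add: assms 1)
  show thesis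
    by (rule that[of "B2 \<inter> {x \<in> carrier G. inv x \<in> C1}" C2])
      (use 1 2 assms inv_preimage_open in \<open>auto intro!: openin_Int\<close>)
qed

text \<open>A tube argument: continuity of conjugation at \<open>(g, \<one>)\<close> gives a
  neighbourhood \<open>A g\<close> of \<open>g\<close> and a neighbourhood \<open>V g\<close> of the
  unit; finitely many \<open>A g\<close> cover \<open>C\<close>, and the corresponding
  \<open>V g\<close> are intersected.\<close>

lemma compact_conj_nbhd:
  assumes "openin T W" and "\<one> \<in> W" and "compactin T C"
  obtains V where "openin T V" "\<one> \<in> V" "\<And>g x. g \<in> C \<Longrightarrow> x \<in> V \<Longrightarrow> g \<otimes> x \<otimes> inv g \<in> W"
proof -
  have "\<forall>g\<in>C. \<exists>A V. openin T A \<and> g \<in> A \<and> openin T V \<and> \<one> \<in> V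
      \<and> (\<forall>a\<in>A. \<forall>x\<in>V. a \<otimes> x \<otimes> inv a \<in> W)"
  proof
    fix g assume "g \<in> C"
    then have g: "g \<in> carrier G"
      using compactin_subset_topspace[OF assms(3)] topspace_eq by blast
    show "\<exists>A V. openin T A \<and> g \<in> A \<and> openin T V \<and> \<one> \<in> V
      \<and> (\<forall>a\<in>A. \<forall>x\<in>V. a \<otimes> x \<otimes> inv a \<in> W)"
      by (rule conj_nbhds[OF assms(1,2) g]) blast
  qed
  then obtain A V where AV: "\<And>g. g \<in> C \<Longrightarrow> openin T (A g) \<and> g \<in> A g \<and> openin T (V g) \<and> \<one> \<in> V g
      \<and> (\<forall>a\<in>A g. \<forall>x\<in>V g. a \<otimes> x \<otimes> inv a \<in> W)"
    by metis
  obtain \<F> where \<F>: "finite \<F>" "\<F> \<subseteq> A ` C" "C \<subseteq> \<Union>\<F>"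
    using assms(3) AV unfolding compactin_def
    by (smt (verit) UN_I image_iff subsetI)
  obtain D where D: "finite D" "D \<subseteq> C" "\<F> = A ` D"
    using \<F> finite_subset_image by metis
  \<comment> \<open>The factor \<open>topspace T\<close> is for \<open>D = {}\<close>, where the
    intersection over \<open>D\<close> is \<open>UNIV\<close>.\<close>
  show thesis
  proof (rule that[of "topspace T \<inter> (\<Inter>g\<in>D. V g)"])
    show "openin T (topspace T \<inter> (\<Inter>g\<in>D. V g))"
    proof (cases "D = {}")
      case False
      then have "openin T (\<Inter>g\<in>D. V g)"
        using D AV by (intro openin_Inter) auto
      then show ?thesis by blast
    qed simp
    show "\<one> \<in> topspace T \<inter> (\<Inter>g\<in>D. V g)"
      using D AV topspace_eq by auto
    show "g \<otimes> x \<otimes> inv g \<in> W" if "g \<in> C" "x \<in> topspace T \<inter> (\<Inter>g\<in>D. V g)" for g x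
    proof -
      have "g \<in> \<Union>(A ` D)"
        using that(1) D(3) \<F>(3) by blast
      then obtain h where h: "h \<in> D" "g \<in> A h"
        by blast
      then have "x \<in> V h" "h \<in> C"
        using that(2) D(2) by auto
      then show ?thesis
        using AV h(2) by blast
    qed
  qed
qed

end

text \<open>The classical axioms for a neighbourhood base at the unit of a group topology. The sets
  \<open>U i\<close> need not be open, and separation is a hypothesis of the lemmas that rely on
  it.\<close>

locale group_nbhd_base = group G for G :: "('g, 'm) monoid_scheme" (structure) +
  fixes U :: "'i \<Rightarrow> 'g set"
  assumes U_carrier: "U i \<subseteq> carrier G"
    and U_one: "\<one> \<in> U i"
    and U_inter: "\<exists>k. U k \<subseteq> U i \<inter> U j"
    and U_mult: "\<exists>j. \<forall>x\<in>U j. \<forall>y\<in>U j. x \<otimes> y \<in> U i"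
    and U_inv: "\<exists>j. \<forall>x\<in>U j. inv x \<in> U i"
    and U_conj: "g \<in> carrier G \<Longrightarrow> \<exists>j. \<forall>x\<in>U j. g \<otimes> x \<otimes> inv g \<in> U i"
begin

definition base_topology :: "'g topology" where
  "base_topology = topology (\<lambda>S. S \<subseteq> carrier G \<and> (\<forall>x\<in>S. \<exists>i. \<forall>u\<in>U i. x \<otimes> u \<in> S))"

lemma U_closed: "u \<in> U i \<Longrightarrow> u \<in> carrier G"
  using U_carrier by blast

lemma openin_base_topology:
  "openin base_topology S \<longleftrightarrow> S \<subseteq> carrier G \<and> (\<forall>x\<in>S. \<exists>i. \<forall>u\<in>U i. x \<otimes> u \<in> S)"
proof -
  have "istopology (\<lambda>S. S \<subseteq> carrier G \<and> (\<forall>x\<in>S. \<exists>i. \<forall>u\<in>U i. x \<otimes> u \<in> S))"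
    unfolding istopology_def
  proof (intro conjI allI impI, goal_cases)
    case (2 S R)
    show ?case
    proof
      fix x assume "x \<in> S \<inter> R"
      then obtain i j where "\<forall>u\<in>U i. x \<otimes> u \<in> S" "\<forall>u\<in>U j. x \<otimes> u \<in> R"
        using 2 by blast
      moreover obtain k where "U k \<subseteq> U i \<inter> U j"
        using U_inter by blast
      ultimately show "\<exists>i. \<forall>u\<in>U i. x \<otimes> u \<in> S \<inter> R"
        by blast
    qed
  next
    case (4 \<K>) then show ?case by (meson UnionE UnionI)
  qed auto
  then show ?thesis
    unfolding base_topology_def by (subst topology_inverse') auto
qed

lemma topspace_base_topology [simp]: "topspace base_topology = carrier G"
proof -
  have "openin base_topology (carrier G)"
    unfolding openin_base_topology using U_closed U_one by blast
  then show ?thesis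
    by (meson openin_base_topology openin_subset openin_topspace subset_antisym)
qed

text \<open>The set is the interior of \<open>N\<close>. If \<open>y (U i)\<close> lies in
  \<open>N\<close> and products of two elements of \<open>U j\<close> lie in \<open>U i\<close>,
  then \<open>y u (U j)\<close> lies in \<open>N\<close> for each \<open>u\<close> in
  \<open>U j\<close>.\<close>

lemma openin_core: "openin base_topology {y \<in> carrier G. \<exists>i. \<forall>u\<in>U i. y \<otimes> u \<in> N}" (is "openin _ ?V")
  unfolding openin_base_topology
proof (intro conjI ballI)
  fix y assume "y \<in> ?V"
  then obtain i where y: "y \<in> carrier G" "\<forall>u\<in>U i. y \<otimes> u \<in> N"
    by blast
  obtain j where j: "\<forall>x\<in>U j. \<forall>y\<in>U j. x \<otimes> y \<in> U i"
    using U_mult by blast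
  have "y \<otimes> u \<in> ?V" if "u \<in> U j" for u
    using that y j by (auto simp: U_closed m_assoc intro!: exI[of _ j])
  then show "\<exists>i. \<forall>u\<in>U i. y \<otimes> u \<in> ?V" by blast
qed auto

lemma core_subset: "{y \<in> carrier G. \<exists>i. \<forall>u\<in>U i. y \<otimes> u \<in> N} \<subseteq> N"
  using U_one by force

lemma nbhd_base_topology:
  "nbhd base_topology x N \<longleftrightarrow> x \<in> carrier G \<and> N \<subseteq> carrier G \<and> (\<exists>i. \<forall>u\<in>U i. x \<otimes> u \<in> N)"
proof
  assume "nbhd base_topology x N"
  then obtain V where V: "openin base_topology V" "x \<in> V" "V \<subseteq> N" "N \<subseteq> carrier G"
    unfolding nbhd_def by auto
  then obtain i where "\<forall>u\<in>U i. x \<otimes> u \<in> V"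
    unfolding openin_base_topology by blast
  then show "x \<in> carrier G \<and> N \<subseteq> carrier G \<and> (\<exists>i. \<forall>u\<in>U i. x \<otimes> u \<in> N)"
    using V openin_subset[OF V(1)] by auto
next
  assume "x \<in> carrier G \<and> N \<subseteq> carrier G \<and> (\<exists>i. \<forall>u\<in>U i. x \<otimes> u \<in> N)"
  then show "nbhd base_topology x N"
    unfolding nbhd_def topspace_base_topology
    by (intro exI[of _ "{y \<in> carrier G. \<exists>i. \<forall>u\<in>U i. y \<otimes> u \<in> N}"] conjI openin_core core_subset) auto
qed

lemma translate_nbhd:
  assumes "x \<in> carrier G"
  shows "\<exists>V. openin base_topology V \<and> x \<in> V \<and> V \<subseteq> (\<lambda>u. x \<otimes> u) ` U i"
proof -
  have "nbhd base_topology x ((\<lambda>u. x \<otimes> u) ` U i)"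
    unfolding nbhd_base_topology using assms U_closed by blast
  then show ?thesis
    unfolding nbhd_def by blast
qed

lemma U_nbhd: "nbhd base_topology \<one> (U i)"
  unfolding nbhd_base_topology using U_carrier by (auto simp: U_closed intro!: exI[of _ i])

text \<open>By \<open>x u y v = x y (y^-1 u y) v\<close>, the perturbation \<open>u\<close> of the
  left factor must be small after conjugation by \<open>inv y\<close>; this is where
  \<open>U_conj\<close> enters.\<close>

lemma continuous_mult: "continuous_map (prod_topology base_topology base_topology) base_topology (\<lambda>(x, y). x \<otimes> y)"
  unfolding continuous_map
proof (intro conjI allI impI)
  fix S assume S: "openin base_topology S"
  show "openin (prod_topology base_topology base_topology)
     {z \<in> topspace (prod_topology base_topology base_topology). (case z of (x, y) \<Rightarrow> x \<otimes> y) \<in> S}" (is "openin _ ?Z")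
    unfolding openin_prod_topology_alt
  proof (intro allI impI)
    fix x y assume "(x, y) \<in> ?Z"
    then have xy: "x \<in> carrier G" "y \<in> carrier G" "x \<otimes> y \<in> S" by auto
    then obtain i where i: "\<forall>u\<in>U i. (x \<otimes> y) \<otimes> u \<in> S"
      using S openin_base_topology by blast
    obtain j where j: "\<forall>x\<in>U j. \<forall>y\<in>U j. x \<otimes> y \<in> U i"
      using U_mult by blast
    obtain k where k: "\<forall>u\<in>U k. inv y \<otimes> u \<otimes> y \<in> U j"
      using U_conj[of "inv y" j] xy by auto
    obtain A where A: "openin base_topology A" "x \<in> A" "A \<subseteq> (\<lambda>u. x \<otimes> u) ` U k"
      using translate_nbhd xy by blast
    obtain B where B: "openin base_topology B" "y \<in> B" "B \<subseteq> (\<lambda>u. y \<otimes> u) ` U j"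
      using translate_nbhd xy by blast
    have "x \<otimes> u \<otimes> (y \<otimes> v) \<in> S" if "u \<in> U k" "v \<in> U j" for u v
    proof -
      have "(inv y \<otimes> u \<otimes> y) \<otimes> v \<in> U i"
        using j k that by blast
      then have "(x \<otimes> y) \<otimes> ((inv y \<otimes> u \<otimes> y) \<otimes> v) \<in> S"
        using i by blast
      moreover have "(x \<otimes> y) \<otimes> ((inv y \<otimes> u \<otimes> y) \<otimes> v) = x \<otimes> u \<otimes> (y \<otimes> v)"
        using that xy U_closed[of u k] U_closed[of v j] by (simp add: m_assoc inv_mult_cancel_left)
      ultimately show ?thesis by simp
    qed
    then have "a \<otimes> b \<in> S" if "a \<in> A" "b \<in> B" for a b
      using A(3) B(3) that by blast
    then have "A \<times> B \<subseteq> ?Z"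
      using openin_subset[OF A(1)] openin_subset[OF B(1)] by auto
    then show "\<exists>V W. openin base_topology V \<and> openin base_topology W \<and> x \<in> V \<and> y \<in> W \<and> V \<times> W \<subseteq> ?Z"
      using A B by blast
  qed
qed auto

lemma continuous_inv: "continuous_map base_topology base_topology (m_inv G)"
  unfolding continuous_map
proof (intro conjI allI impI)
  fix S assume S: "openin base_topology S"
  show "openin base_topology {x \<in> topspace base_topology. inv x \<in> S}"
    unfolding openin_base_topology
  proof (intro conjI ballI)
    fix x assume "x \<in> {x \<in> topspace base_topology. inv x \<in> S}"
    then have x: "x \<in> carrier G" "inv x \<in> S" by auto
    then obtain i where i: "\<forall>u\<in>U i. inv x \<otimes> u \<in> S"
      using S openin_base_topology by blast
    obtain j where j: "\<forall>u\<in>U j. x \<otimes> u \<otimes> inv x \<in> U i"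
      using U_conj x by blast
    obtain k where k: "\<forall>u\<in>U k. inv u \<in> U j"
      using U_inv by blast
    have "inv (x \<otimes> u) \<in> S" if "u \<in> U k" for u
    proof -
      have "inv x \<otimes> (x \<otimes> inv u \<otimes> inv x) \<in> S"
        using i j k that by blast
      moreover have "inv x \<otimes> (x \<otimes> inv u \<otimes> inv x) = inv (x \<otimes> u)"
        using that x U_closed[of u k] by (simp add: inv_mult_group m_assoc inv_mult_cancel_left)
      ultimately show ?thesis by simp
    qed
    then show "\<exists>i. \<forall>u\<in>U i. x \<otimes> u \<in> {x \<in> topspace base_topology. inv x \<in> S}"
      using x U_closed by (intro exI[of _ k]) auto
  qed auto
qed auto

lemma group_topology_base_topology: "group_topology (carrier G) (mult G) (m_inv G) base_topology"
  using continuous_mult continuous_inv by (simp add: group_topology_def)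

text \<open>Left translations are homeomorphisms of \<open>T\<close>, so the two topologies need to
  be compared at the unit only.\<close>

lemma base_topology_finest:
  assumes "group_topology (carrier G) (mult G) (m_inv G) T"
    and "\<And>W. openin T W \<Longrightarrow> \<one> \<in> W \<Longrightarrow> \<exists>i. U i \<subseteq> W"
    and "openin T S"
  shows "openin base_topology S"
proof -
  interpret T: top_group G T
    by unfold_locales (rule assms)
  show ?thesis
    unfolding openin_base_topology
  proof (intro conjI ballI)
    show "S \<subseteq> carrier G"
      using T.open_subset assms(3) .
    fix x assume "x \<in> S"
    then have x: "x \<in> carrier G"
      using T.open_subset assms(3) by blast
    with \<open>x \<in> S\<close> have "\<one> \<in> {y \<in> carrier G. x \<otimes> y \<in> S}"
      by simp
    then obtain i where "U i \<subseteq> {y \<in> carrier G. x \<otimes> y \<in> S}"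
      using assms(2) T.left_translate_open[OF assms(3) x] by blast
    then show "\<exists>i. \<forall>u\<in>U i. x \<otimes> u \<in> S" by blast
  qed
qed

text \<open>Take \<open>U l\<close> with all quotients \<open>u v^-1\<close> in \<open>U i\<close>,
  where \<open>a (U i)\<close> misses \<open>C\<close>. If \<open>a u = c v\<close> with
  \<open>u\<close>, \<open>v\<close> in \<open>U l\<close>, then \<open>c = a u v^-1\<close> lies in
  \<open>a (U i)\<close>, so no translate of \<open>U l\<close> by a point of \<open>C\<close> meets
  \<open>a (U l)\<close>.\<close>

lemma regular_space_base_topology: "regular_space base_topology"
  unfolding regular_space_def
proof (intro allI impI, elim conjE)
  fix C a assume C: "closedin base_topology C" and a: "a \<in> topspace base_topology - C"
  then have "openin base_topology (carrier G - C)" "a \<in> carrier G - C"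
    by (auto simp: closedin_def)
  then obtain i where i: "\<forall>u\<in>U i. a \<otimes> u \<in> carrier G - C"
    using openin_base_topology by blast
  obtain j where j: "\<forall>x\<in>U j. \<forall>y\<in>U j. x \<otimes> y \<in> U i"
    using U_mult by blast
  obtain k where k: "\<forall>u\<in>U k. inv u \<in> U j"
    using U_inv by blast
  obtain l where l: "U l \<subseteq> U j \<inter> U k"
    using U_inter by blast
  have "\<forall>c\<in>carrier G. \<exists>V. openin base_topology V \<and> c \<in> V \<and> V \<subseteq> (\<lambda>u. c \<otimes> u) ` U l"
    using translate_nbhd by blast
  then obtain V where V: "\<And>c. c \<in> carrier G \<Longrightarrow> openin base_topology (V c) \<and> c \<in> V c \<and> V c \<subseteq> (\<lambda>u. c \<otimes> u) ` U l"
    by metis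
  have Csub: "C \<subseteq> carrier G"
    using closedin_subset[OF C] by simp
  have "disjnt (V a) (\<Union>c\<in>C. V c)"
    unfolding disjnt_iff
  proof (intro allI notI, elim conjE UN_E)
    fix z c assume z: "z \<in> V a" "z \<in> V c" and c: "c \<in> C"
    have "a \<in> carrier G" "c \<in> carrier G"
      using a c Csub by auto
    then have "V a \<subseteq> (\<lambda>u. a \<otimes> u) ` U l" "V c \<subseteq> (\<lambda>u. c \<otimes> u) ` U l"
      using V by blast+
    then obtain u v where uv: "u \<in> U l" "v \<in> U l" "z = a \<otimes> u" "z = c \<otimes> v"
      using z by blast
    have cl: "a \<in> carrier G" "c \<in> carrier G" "u \<in> carrier G" "v \<in> carrier G"
      using a c Csub uv U_closed by auto
    have "c = a \<otimes> (u \<otimes> inv v)"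
      using cl uv by (metis inv_solve_right m_assoc inv_closed m_closed)
    moreover have "u \<otimes> inv v \<in> U i"
      using uv l k j by blast
    ultimately show False
      using i c by auto
  qed
  then show "\<exists>V W. openin base_topology V \<and> openin base_topology W \<and> a \<in> V \<and> C \<subseteq> W \<and> disjnt V W"
    using V a Csub by (intro exI[of _ "V a"] exI[of _ "\<Union>c\<in>C. V c"]) auto
qed

lemma t1_space_base_topology:
  assumes "\<And>g. g \<in> carrier G \<Longrightarrow> g \<noteq> \<one> \<Longrightarrow> \<exists>i. g \<notin> U i"
  shows "t1_space base_topology"
  unfolding t1_space_def
proof (intro ballI impI)
  fix x y assume xy: "x \<in> topspace base_topology" "y \<in> topspace base_topology" "x \<noteq> y"
  then have "inv x \<otimes> y \<in> carrier G" "inv x \<otimes> y \<noteq> \<one>"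
    by (auto simp: inv_solve_left')
  then obtain i where i: "inv x \<otimes> y \<notin> U i"
    using assms by blast
  obtain V where V: "openin base_topology V" "x \<in> V" "V \<subseteq> (\<lambda>u. x \<otimes> u) ` U i"
    using translate_nbhd[of x i] xy by auto
  have "y \<notin> V"
  proof
    assume "y \<in> V"
    then obtain u where "u \<in> U i" "y = x \<otimes> u" using V by auto
    then show False
      using i xy U_closed[of u i] by (auto simp: m_assoc[symmetric])
  qed
  then show "\<exists>V. openin base_topology V \<and> x \<in> V \<and> y \<notin> V"
    using V by blast
qed

lemma nbhd_base_translates:
  assumes "x \<in> carrier G" and cofinal: "\<And>i. \<exists>j\<in>J. U j \<subseteq> U i"
  shows "nbhd_base base_topology x ((\<lambda>j. (\<lambda>u. x \<otimes> u) ` U j) ` J)"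
  unfolding nbhd_base_def
proof (intro conjI allI impI ballI)
  fix N assume "N \<in> (\<lambda>j. (\<lambda>u. x \<otimes> u) ` U j) ` J"
  then show "nbhd base_topology x N"
    unfolding nbhd_base_topology using assms(1) U_closed by auto
next
  fix W assume "nbhd base_topology x W"
  then obtain i where i: "\<forall>u\<in>U i. x \<otimes> u \<in> W"
    unfolding nbhd_base_topology by blast
  obtain j where "j \<in> J" "U j \<subseteq> U i"
    using cofinal by blast
  then show "\<exists>N\<in>(\<lambda>j. (\<lambda>u. x \<otimes> u) ` U j) ` J. N \<subseteq> W"
    using i by blast
qed

end

section \<open>The cardinal d and lower bounds for characters\<close>

lemma dfrak_spec:
  shows dominating_dfrak: "dominating dfrak"
    and card_of_dfrak_le: "dominating D \<Longrightarrow> |dfrak| \<le>o |D|"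
proof -
  have "\<exists>D. dominating D \<and> (\<forall>D'. dominating D' \<longrightarrow> |D| \<le>o |D'| )"
  proof -
    \<comment> \<open>The choice in \<open>dfrak\<close> is legitimate because cardinals are
      well-ordered; \<open>UNIV\<close> shows that there is a dominating family at all.\<close>
    let ?R = "card_of ` {D. dominating D}"
    have "?R \<noteq> {}" "\<forall>r\<in>?R. Card_order r"
      unfolding dominating_def by (auto intro!: exI[of _ UNIV] card_of_Card_order)
    then have "\<exists>r\<in>?R. \<forall>r'\<in>?R. r \<le>o r'"
      by (rule exists_minim_Card_order)
    then show ?thesis by simp
  qed
  then have "dominating dfrak \<and> (\<forall>D'. dominating D' \<longrightarrow> |dfrak| \<le>o |D'| )"
    unfolding dfrak_def by (rule someI_ex)
  then show "dominating dfrak" "dominating D \<Longrightarrow> |dfrak| \<le>o |D|" by auto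
qed

text \<open>The index \<open>i\<close> where the sequence \<open>u n\<close> enters \<open>W\<close>, as a function of \<open>n\<close>, is a map
  from neighbourhoods to \<open>nat \<Rightarrow> nat\<close> that sends every base at \<open>e\<close> to a dominating family.\<close>

lemma dfrak_le_character:
  assumes "e \<in> topspace T" and "char_le T C"
    and tends: "\<And>W n. nbhd T e W \<Longrightarrow> \<exists>i. u n i \<in> W"
    and escape: "\<And>g :: nat \<Rightarrow> nat. \<exists>W. nbhd T e W \<and> (\<forall>n i. u n i \<in> W \<longrightarrow> g n \<le> i)"
  shows "|dfrak| \<le>o |C|"
proof -
  obtain B where B: "nbhd_base T e B" "|B| \<le>o |C|"
    using assms(1,2) unfolding char_le_def by blast
  define \<phi> where "\<phi> W = (\<lambda>n. LEAST i. u n i \<in> W)" for W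
  have "dominating (\<phi> ` B)"
    unfolding dominating_def
  proof
    fix g :: "nat \<Rightarrow> nat"
    obtain W where W: "nbhd T e W" "\<And>n i. u n i \<in> W \<Longrightarrow> g n \<le> i"
      using escape by blast
    then obtain N where N: "N \<in> B" "N \<subseteq> W" "nbhd T e N"
      using B(1) unfolding nbhd_base_def by blast
    have "g n \<le> \<phi> N n" for n
      unfolding \<phi>_def using LeastI_ex[OF tends[OF N(3), of n]] N(2) W(2) by blast
    then show "\<exists>h\<in>\<phi> ` B. \<forall>n. g n \<le> h n"
      using N(1) by blast
  qed
  then have "|dfrak| \<le>o |\<phi> ` B|"
    by (rule card_of_dfrak_le)
  also have "|\<phi> ` B| \<le>o |B|"
    by (rule card_of_image)
  finally show ?thesis
    using B(2) ordLeq_transitive by blast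
qed

section \<open>Bases indexed by sequences with condition (D)\<close>

locale group_G_base = group_nbhd_base G U
  for G :: "('g, 'm) monoid_scheme" (structure) and U :: "(nat \<Rightarrow> nat) \<Rightarrow> 'g set" +
  assumes U_antimono: "(\<And>i. \<alpha> i \<le> \<beta> i) \<Longrightarrow> U \<beta> \<subseteq> U \<alpha>"
    and U_finite_dependence: "x \<in> U \<alpha> \<Longrightarrow> \<exists>k. \<forall>\<beta>. (\<forall>i\<le>k. \<beta> i = \<alpha> i) \<longrightarrow> x \<in> U \<beta>"
begin

definition D :: "nat \<Rightarrow> (nat \<Rightarrow> nat) \<Rightarrow> 'g set" where
  "D k \<alpha> = \<Inter>{U \<beta> | \<beta>. \<forall>i\<le>k. \<beta> i = \<alpha> i}"

lemma U_eq_Union_D: "U \<alpha> = (\<Union>k. D k \<alpha>)"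
proof
  show "U \<alpha> \<subseteq> (\<Union>k. D k \<alpha>)"
  proof
    fix x assume "x \<in> U \<alpha>"
    then obtain k where "\<forall>\<beta>. (\<forall>i\<le>k. \<beta> i = \<alpha> i) \<longrightarrow> x \<in> U \<beta>"
      using U_finite_dependence by blast
    then have "x \<in> D k \<alpha>" unfolding D_def by blast
    then show "x \<in> (\<Union>k. D k \<alpha>)" by blast
  qed
  show "(\<Union>k. D k \<alpha>) \<subseteq> U \<alpha>"
    unfolding D_def by blast
qed

lemma G_base_D_base_topology: "G_base_D base_topology \<one> U"
  unfolding G_base_D_def
proof (intro conjI allI impI)
  show "nbhd base_topology \<one> (U \<alpha>)" for \<alpha>
    by (rule U_nbhd)
  show "\<exists>\<alpha>. U \<alpha> \<subseteq> W" if "nbhd base_topology \<one> W" for W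
  proof -
    obtain i where "\<forall>u\<in>U i. \<one> \<otimes> u \<in> W"
      using \<open>nbhd base_topology \<one> W\<close> unfolding nbhd_base_topology by blast
    then show ?thesis
      using U_closed by (intro exI[of _ i]) auto
  qed
  show "U \<beta> \<subseteq> U \<alpha>" if "\<forall>i. \<alpha> i \<le> \<beta> i" for \<alpha> \<beta>
    using U_antimono that by blast
  show "U \<alpha> = (\<Union>k. \<Inter>{U \<beta> | \<beta>. \<forall>i\<le>k. \<beta> i = \<alpha> i})" for \<alpha>
    using U_eq_Union_D unfolding D_def .
qed

lemma char_le_dfrak: "char_le base_topology dfrak"
  unfolding char_le_def
proof
  fix x assume "x \<in> topspace base_topology"
  then have x: "x \<in> carrier G" by simp
  have "\<exists>\<beta>\<in>dfrak. U \<beta> \<subseteq> U \<alpha>" for \<alpha>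
    using dominating_dfrak U_antimono unfolding dominating_def by metis
  then show "\<exists>B. nbhd_base base_topology x B \<and> |B| \<le>o |dfrak|"
    using nbhd_base_translates[OF x] card_of_image by meson
qed

text \<open>\<open>D k \<alpha>\<close> sees only the values of \<open>\<alpha>\<close> up to
  \<open>k\<close>, so it is coded by \<open>k\<close> and a list of length \<open>Suc k\<close>;
  the value 0 at later places is arbitrary.\<close>

lemma countable_D: "countable (range (\<lambda>(k, \<alpha>). D k \<alpha>))"
proof -
  define F where "F = (\<lambda>(k, xs). D k (\<lambda>i. if i \<le> k then xs ! i else 0))"
  have "D k \<alpha> = F (k, map \<alpha> [0..<Suc k])" for k \<alpha>
    unfolding D_def F_def by (simp cong: conj_cong del: upt_Suc)
  then have "range (\<lambda>(k, \<alpha>). D k \<alpha>) \<subseteq> range F"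
    by (simp add: image_subset_iff)
  moreover have "countable (range F)"
    by (intro countable_image) auto
  ultimately show ?thesis
    by (rule countable_subset)
qed

text \<open>If \<open>D k \<alpha> \<inter> A\<close> were finite for all \<open>k\<close>, pick \<open>\<beta> k\<close> agreeing with \<open>\<alpha>\<close> up to \<open>k\<close> such that
  \<open>U (\<beta> k)\<close> misses the part of \<open>A\<close> that lies in \<open>D (Suc k) \<alpha>\<close> but not in \<open>D k \<alpha>\<close>.  The pointwise
  supremum of the \<open>\<beta> k\<close> exists, and its neighbourhood misses \<open>A\<close>.\<close>

lemma D_infinite_inter:
  assumes sep: "\<And>g. g \<in> carrier G \<Longrightarrow> g \<noteq> \<one> \<Longrightarrow> \<exists>i. g \<notin> U i"
    and "A \<subseteq> carrier G" and "\<one> \<notin> A" and meets: "\<And>\<beta>. U \<beta> \<inter> A \<noteq> {}"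
  shows "\<exists>k. infinite (D k \<alpha> \<inter> A)"
proof (rule ccontr)
  assume "\<nexists>k. infinite (D k \<alpha> \<inter> A)"
  then have fin: "finite (D k \<alpha> \<inter> A)" for k by blast
  \<comment> \<open>Larger indices give smaller sets, so points that can be avoided one at a time
    can be avoided finitely many at a time, within any class \<open>P\<close> of indices closed
    under pointwise maximum. It is used without restriction and for the indices that agree with
    \<open>\<alpha>\<close> up to \<open>k\<close>.\<close>
  have avoid: "\<exists>\<beta>. P \<beta> \<and> U \<beta> \<inter> F = {}"
    if "finite F" "\<And>x. x \<in> F \<Longrightarrow> \<exists>\<beta>. P \<beta> \<and> x \<notin> U \<beta>" "P \<delta>"
      "\<And>\<beta> \<gamma>. P \<beta> \<Longrightarrow> P \<gamma> \<Longrightarrow> P (\<lambda>i. max (\<beta> i) (\<gamma> i))" for F P \<delta>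
    using that(1,2)
  proof (induction F rule: finite_induct)
    case empty then show ?case using that(3) by auto
  next
    case (insert x F)
    obtain \<beta> where \<beta>: "P \<beta>" "U \<beta> \<inter> F = {}"
      using insert.IH insert.prems by blast
    obtain \<gamma> where \<gamma>: "P \<gamma>" "x \<notin> U \<gamma>"
      using insert.prems by blast
    have "U (\<lambda>i. max (\<beta> i) (\<gamma> i)) \<subseteq> U \<beta>" "U (\<lambda>i. max (\<beta> i) (\<gamma> i)) \<subseteq> U \<gamma>"
      by (rule U_antimono; simp)+
    then show ?case
      using \<beta> \<gamma> that(4) by (intro exI[of _ "\<lambda>i. max (\<beta> i) (\<gamma> i)"]) blast
  qed
  have "\<exists>\<delta>. True \<and> U \<delta> \<inter> (D 0 \<alpha> \<inter> A) = {}"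
  proof (rule avoid)
    show "\<exists>\<beta>. True \<and> x \<notin> U \<beta>" if "x \<in> D 0 \<alpha> \<inter> A" for x
      using sep[of x] assms(2,3) that by auto
  qed (use fin in auto)
  then obtain \<delta> where \<delta>: "U \<delta> \<inter> (D 0 \<alpha> \<inter> A) = {}"
    by blast
  have "\<exists>\<beta>. (\<forall>i\<le>k. \<beta> i = \<alpha> i) \<and> U \<beta> \<inter> (D (Suc k) \<alpha> \<inter> A - D k \<alpha>) = {}" for k
  proof (rule avoid[where \<delta> = \<alpha>])
    show "\<exists>\<beta>. (\<forall>i\<le>k. \<beta> i = \<alpha> i) \<and> x \<notin> U \<beta>" if "x \<in> D (Suc k) \<alpha> \<inter> A - D k \<alpha>" for x
      using that by (auto simp: D_def)
  qed (use fin in auto)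
  then obtain \<beta> where \<beta>: "\<And>k i. i \<le> k \<Longrightarrow> \<beta> k i = \<alpha> i"
    "\<And>k. U (\<beta> k) \<inter> (D (Suc k) \<alpha> \<inter> A - D k \<alpha>) = {}"
    by metis
  \<comment> \<open>A maximum over \<open>k \<le> i\<close> bounds all \<open>\<beta> k i\<close>,
    since for \<open>k > i\<close> the value is \<open>\<alpha> i\<close>, which is also
    \<open>\<beta> i i\<close>.\<close>
  define \<gamma> where "\<gamma> i = Max (insert (\<delta> i) ((\<lambda>k. \<beta> k i) ` {..i}))" for i
  have \<gamma>\<beta>: "\<beta> k i \<le> \<gamma> i" for k i
  proof (cases "k \<le> i")
    case True then show ?thesis unfolding \<gamma>_def by (intro Max_ge) auto
  next
    case False
    then have "\<beta> k i = \<beta> i i" using \<beta>(1)[of i k] \<beta>(1)[of i i] by simp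
    also have "\<beta> i i \<le> \<gamma> i" unfolding \<gamma>_def by (intro Max_ge) auto
    finally show ?thesis .
  qed
  have \<gamma>\<delta>: "\<delta> i \<le> \<gamma> i" for i
    unfolding \<gamma>_def by (intro Max_ge) auto
  have "\<alpha> i \<le> \<gamma> i" for i
    using \<gamma>\<beta>[of i i] \<beta>(1)[of i i] by simp
  then have sub: "U \<gamma> \<subseteq> U \<alpha>" by (rule U_antimono)
  obtain a where a: "a \<in> U \<gamma>" "a \<in> A"
    using meets by blast
  then obtain k where k: "a \<in> D k \<alpha>"
    using sub U_eq_Union_D by blast
  \<comment> \<open>\<open>\<delta>\<close> keeps \<open>a\<close> out of
    \<open>D 0 \<alpha>\<close>, and \<open>\<beta> k\<close> keeps it from entering at step
    \<open>Suc k\<close>.\<close>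
  have "a \<notin> D k \<alpha>" for k
  proof (induction k)
    case 0
    show ?case using \<delta> a U_antimono[of \<delta> \<gamma>, OF \<gamma>\<delta>] by blast
  next
    case (Suc k)
    then show ?case using \<beta>(2)[of k] a U_antimono[of "\<beta> k" \<gamma>, OF \<gamma>\<beta>] by blast
  qed
  then show False using k by blast
qed

text \<open>The cp-network consists of the products of a network member \<open>N\<close> with some
  \<open>D k \<alpha>\<close>. A set accumulating at \<open>x\<close> is translated to the unit,
  where \<open>D_infinite_inter\<close> finds infinitely many of its points in one
  \<open>D k \<alpha>\<close>; as \<open>x \<in> N\<close>, translating back keeps them in the
  product.\<close>

lemma P0_space_base_topology:
  assumes sep: "\<And>g. g \<in> carrier G \<Longrightarrow> g \<noteq> \<one> \<Longrightarrow> \<exists>i. g \<notin> U i"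
    and "countable \<N>"
    and network: "\<And>W x. openin base_topology W \<Longrightarrow> x \<in> W \<Longrightarrow> \<exists>N\<in>\<N>. x \<in> N \<and> N \<subseteq> W"
  shows "P0_space base_topology"
proof -
  define \<M> where "\<M> = (\<lambda>(N, E). {x \<otimes> y | x y. x \<in> N \<and> y \<in> E}) ` (\<N> \<times> range (\<lambda>(k, \<alpha>). D k \<alpha>))"
  have "countable \<M>"
    unfolding \<M>_def by (rule countable_image) (rule countable_SIGMA[OF assms(2) countable_D])
  moreover have "cp_network base_topology \<M> x" if "x \<in> topspace base_topology" for x
  proof -
    have x: "x \<in> carrier G" using that by simp
    have one_D: "\<one> \<in> D k \<alpha>" for k \<alpha>
      unfolding D_def using U_one by blast
    have D_sub: "D k \<alpha> \<subseteq> U \<alpha>" for k \<alpha>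
      using U_eq_Union_D by blast
    have \<M>I: "{x \<otimes> y | x y. x \<in> N \<and> y \<in> D k \<alpha>} \<in> \<M>" if "N \<in> \<N>" for N k \<alpha>
      unfolding \<M>_def using that by (intro image_eqI[of _ _ "(N, D k \<alpha>)"]) auto
    \<comment> \<open>\<open>N\<close> is taken inside \<open>x (U j)\<close>, and every
      \<open>D k j\<close> lies in \<open>U j\<close>. The inclusion therefore holds for all
      \<open>k\<close>, which may be chosen afterwards, depending on \<open>A\<close>.\<close>
    have key: "\<exists>N\<in>\<N>. \<exists>\<alpha>. x \<in> N \<and> (\<forall>k. {x \<otimes> y | x y. x \<in> N \<and> y \<in> D k \<alpha>} \<subseteq> W)"
      if "nbhd base_topology x W" for W
    proof -
      obtain i where i: "\<forall>u\<in>U i. x \<otimes> u \<in> W"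
        using \<open>nbhd base_topology x W\<close> unfolding nbhd_base_topology by blast
      obtain j where j: "\<forall>x\<in>U j. \<forall>y\<in>U j. x \<otimes> y \<in> U i"
        using U_mult by blast
      obtain V where V: "openin base_topology V" "x \<in> V" "V \<subseteq> (\<lambda>u. x \<otimes> u) ` U j"
        using translate_nbhd[OF x] by blast
      then obtain N where N: "N \<in> \<N>" "x \<in> N" "N \<subseteq> V"
        using network by blast
      have "{x \<otimes> y | x y. x \<in> N \<and> y \<in> D k j} \<subseteq> W" for k
      proof safe
        fix a b assume "a \<in> N" "b \<in> D k j"
        then obtain u where u: "u \<in> U j" "a = x \<otimes> u" "b \<in> U j"
          using N V D_sub by blast
        then have "x \<otimes> (u \<otimes> b) \<in> W"
          using i j by blast
        then show "a \<otimes> b \<in> W"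
          using u x U_closed[of u j] U_closed[of b j] by (simp add: m_assoc)
      qed
      then show ?thesis using N by blast
    qed
    have mem: "x \<in> {x \<otimes> y | x y. x \<in> N \<and> y \<in> D k \<alpha>}" if "x \<in> N" for N k \<alpha>
    proof -
      have "x = x \<otimes> \<one>" using x by simp
      then show ?thesis using that one_D[of k \<alpha>] by blast
    qed
    show ?thesis
      unfolding cp_network_def
    proof (intro conjI allI impI, goal_cases)
      case (1 W)
      obtain N \<alpha> where N: "N \<in> \<N>" "x \<in> N" "\<And>k. {x \<otimes> y | x y. x \<in> N \<and> y \<in> D k \<alpha>} \<subseteq> W"
        using key[OF 1] by blast
      show ?case
        using mem[OF N(2)] N(3)[of 0] by (intro bexI[OF _ \<M>I[OF N(1), of 0 \<alpha>]] conjI)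
    next
      case (2 A W)
      then have A: "A \<subseteq> carrier G" "x \<in> base_topology closure_of A" "x \<notin> A" by auto
      obtain N \<alpha> where N: "N \<in> \<N>" "x \<in> N" "\<And>k. {x \<otimes> y | x y. x \<in> N \<and> y \<in> D k \<alpha>} \<subseteq> W"
        using key 2 by blast
      define A' where "A' = {y \<in> carrier G. x \<otimes> y \<in> A}"
      have "\<exists>k. infinite (D k \<alpha> \<inter> A')"
      proof (rule D_infinite_inter[OF sep])
        show "U \<beta> \<inter> A' \<noteq> {}" for \<beta>
        proof -
          obtain V where V: "openin base_topology V" "x \<in> V" "V \<subseteq> (\<lambda>u. x \<otimes> u) ` U \<beta>"
            using translate_nbhd[OF x] by blast
          then obtain a where "a \<in> A" "a \<in> V"
            using A(2) unfolding in_closure_of by blast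
          then show ?thesis
            unfolding A'_def using V U_closed by blast
        qed
      qed (use A x in \<open>auto simp: A'_def\<close>)
      then obtain k where k: "infinite (D k \<alpha> \<inter> A')" by blast
      have "inj_on (\<lambda>y. x \<otimes> y) (D k \<alpha> \<inter> A')"
        unfolding A'_def using x by (auto intro!: inj_onI)
      then have "infinite ((\<lambda>y. x \<otimes> y) ` (D k \<alpha> \<inter> A'))"
        using k finite_imageD by blast
      moreover have "(\<lambda>y. x \<otimes> y) ` (D k \<alpha> \<inter> A') \<subseteq> {x \<otimes> y | x y. x \<in> N \<and> y \<in> D k \<alpha>} \<inter> A"
        unfolding A'_def using N by blast
      ultimately have "infinite ({x \<otimes> y | x y. x \<in> N \<and> y \<in> D k \<alpha>} \<inter> A)"
        using finite_subset by blast
      then show ?case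
        using mem[OF N(2)] N(3)[of k] by (intro bexI[OF _ \<M>I[OF N(1), of k \<alpha>]] conjI)
    qed
  qed
  ultimately show ?thesis
    unfolding P0_space_def using regular_space_base_topology t1_space_base_topology[OF sep] by blast
qed

end

section \<open>Neighbourhoods made of products with distinct indices\<close>

context group
begin

definition lprod :: "'a list \<Rightarrow> 'a" where
  "lprod xs = foldr (mult G) xs \<one>"

lemma lprod_simps [simp]: "lprod [] = \<one>" "lprod (x # xs) = x \<otimes> lprod xs"
  by (simp_all add: lprod_def)

lemma lprod_closed [simp]: "set xs \<subseteq> carrier G \<Longrightarrow> lprod xs \<in> carrier G"
  by (induction xs) auto

lemma lprod_append:
  "set xs \<subseteq> carrier G \<Longrightarrow> set ys \<subseteq> carrier G \<Longrightarrow> lprod (xs @ ys) = lprod xs \<otimes> lprod ys"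
  by (induction xs) (auto simp: m_assoc)

lemma inv_lprod: "set xs \<subseteq> carrier G \<Longrightarrow> inv (lprod xs) = lprod (rev (map (m_inv G) xs))"
proof (induction xs)
  case (Cons x xs)
  have "lprod (rev (map (m_inv G) xs) @ [inv x]) = lprod (rev (map (m_inv G) xs)) \<otimes> lprod [inv x]"
    by (rule lprod_append) (use Cons.prems in auto)
  then show ?case using Cons by (simp add: inv_mult_group)
qed simp

lemma conj_lprod:
  assumes "g \<in> carrier G"
  shows "set xs \<subseteq> carrier G \<Longrightarrow> g \<otimes> lprod xs \<otimes> inv g = lprod (map (\<lambda>x. g \<otimes> x \<otimes> inv g) xs)"
proof (induction xs)
  case (Cons x xs)
  have "g \<otimes> (x \<otimes> lprod xs) \<otimes> inv g = (g \<otimes> x \<otimes> inv g) \<otimes> (g \<otimes> lprod xs \<otimes> inv g)"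
    using Cons.prems assms by (simp add: m_assoc inv_mult_cancel_left)
  then show ?case using Cons by simp
qed (use assms in simp)

end

locale group_product_base = group G for G :: "('g, 'm) monoid_scheme" (structure) +
  fixes P :: "nat \<Rightarrow> nat \<Rightarrow> 'g set"
  assumes P_carrier: "P n k \<subseteq> carrier G"
    and P_inv: "x \<in> P n k \<Longrightarrow> inv x \<in> P n k"
    and P_mono: "n \<le> m \<Longrightarrow> P n k \<subseteq> P m k"
    and P_antimono: "k \<le> l \<Longrightarrow> P n l \<subseteq> P n k"
    and P_conj: "g \<in> carrier G \<Longrightarrow> \<exists>m. \<forall>n k. \<forall>x\<in>P n k. g \<otimes> x \<otimes> inv g \<in> P (n + m) k"
begin

text \<open>The labels may occur in any order, which is what makes it possible to reverse factor
  lists and to concatenate them after relabelling.\<close>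

definition prod_nbhd :: "(nat \<Rightarrow> nat) \<Rightarrow> 'g set" where
  "prod_nbhd \<alpha> = {lprod (map snd zs) | zs.
     distinct (map fst zs) \<and> (\<forall>z\<in>set zs. snd z \<in> P (fst z) (\<alpha> (fst z)))}"

lemma prod_nbhdI:
  "distinct (map fst zs) \<Longrightarrow> (\<And>z. z \<in> set zs \<Longrightarrow> snd z \<in> P (fst z) (\<alpha> (fst z))) \<Longrightarrow>
    x = lprod (map snd zs) \<Longrightarrow> x \<in> prod_nbhd \<alpha>"
  unfolding prod_nbhd_def by blast

lemma prod_nbhdE:
  assumes "x \<in> prod_nbhd \<alpha>"
  obtains zs where "distinct (map fst zs)" "\<And>z. z \<in> set zs \<Longrightarrow> snd z \<in> P (fst z) (\<alpha> (fst z))"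
    "x = lprod (map snd zs)" "set (map snd zs) \<subseteq> carrier G"
proof -
  obtain zs where zs: "distinct (map fst zs)" "\<forall>z\<in>set zs. snd z \<in> P (fst z) (\<alpha> (fst z))"
    "x = lprod (map snd zs)"
    using assms unfolding prod_nbhd_def by blast
  moreover have "set (map snd zs) \<subseteq> carrier G"
    using zs(2) P_carrier by fastforce
  ultimately show thesis using that by blast
qed

lemma prod_nbhd_antimono: "(\<And>i. \<alpha> i \<le> \<beta> i) \<Longrightarrow> prod_nbhd \<beta> \<subseteq> prod_nbhd \<alpha>"
proof
  fix x assume le: "\<And>i. \<alpha> i \<le> \<beta> i" and "x \<in> prod_nbhd \<beta>"
  from this(2) show "x \<in> prod_nbhd \<alpha>"
  proof (rule prod_nbhdE)
    fix zs assume "distinct (map fst zs)" "x = lprod (map snd zs)"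
      "\<And>z. z \<in> set zs \<Longrightarrow> snd z \<in> P (fst z) (\<beta> (fst z))"
    then show ?thesis
      using P_antimono[OF le] by (intro prod_nbhdI[of zs]) blast+
  qed
qed

lemma P_subset_prod_nbhd: "P n (\<alpha> n) \<subseteq> prod_nbhd \<alpha>"
proof
  fix x assume "x \<in> P n (\<alpha> n)"
  then show "x \<in> prod_nbhd \<alpha>"
    using P_carrier[of n "\<alpha> n"] by (intro prod_nbhdI[of "[(n, x)]"]) auto
qed

sublocale group_G_base G prod_nbhd
proof
  show "prod_nbhd \<alpha> \<subseteq> carrier G" for \<alpha>
  proof
    fix x assume "x \<in> prod_nbhd \<alpha>"
    then show "x \<in> carrier G"
      by (rule prod_nbhdE) (simp del: set_map)
  qed
  show "\<one> \<in> prod_nbhd \<alpha>" for \<alpha>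
    by (rule prod_nbhdI[of "[]"]) auto
  show "\<exists>\<gamma>. prod_nbhd \<gamma> \<subseteq> prod_nbhd \<alpha> \<inter> prod_nbhd \<beta>" for \<alpha> \<beta>
    using prod_nbhd_antimono[of \<alpha> "\<lambda>i. max (\<alpha> i) (\<beta> i)"]
      prod_nbhd_antimono[of \<beta> "\<lambda>i. max (\<alpha> i) (\<beta> i)"]
    by (intro exI[of _ "\<lambda>i. max (\<alpha> i) (\<beta> i)"]) auto
  show "\<exists>\<beta>. \<forall>x\<in>prod_nbhd \<beta>. \<forall>y\<in>prod_nbhd \<beta>. x \<otimes> y \<in> prod_nbhd \<alpha>" for \<alpha>
  proof (intro exI ballI)
    fix x y
    \<comment> \<open>The levels of \<open>x\<close> are moved to even numbers and those of
      \<open>y\<close> to odd ones, so that the concatenated list has distinct levels; the tolerance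
      must suit both targets.\<close>
    let ?\<beta> = "\<lambda>n. max (\<alpha> (2 * n)) (\<alpha> (2 * n + 1))"
    assume "x \<in> prod_nbhd ?\<beta>" "y \<in> prod_nbhd ?\<beta>"
    then obtain as bs where
      as: "distinct (map fst as)" "\<And>z. z \<in> set as \<Longrightarrow> snd z \<in> P (fst z) (?\<beta> (fst z))"
        "x = lprod (map snd as)" "set (map snd as) \<subseteq> carrier G" and
      bs: "distinct (map fst bs)" "\<And>z. z \<in> set bs \<Longrightarrow> snd z \<in> P (fst z) (?\<beta> (fst z))"
        "y = lprod (map snd bs)" "set (map snd bs) \<subseteq> carrier G"
      by (elim prod_nbhdE) (rule that)
    let ?zs = "map (\<lambda>z. (2 * fst z, snd z)) as @ map (\<lambda>z. (2 * fst z + 1, snd z)) bs"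
    show "x \<otimes> y \<in> prod_nbhd \<alpha>"
    proof (rule prod_nbhdI)
      have "2 * m \<noteq> Suc (2 * n)" for m n :: nat by presburger
      moreover have "distinct (map (\<lambda>n. 2 * n) (map fst as))" "distinct (map (\<lambda>n. 2 * n + 1) (map fst bs))"
        using as(1) bs(1) by (subst distinct_map; auto simp: inj_on_def)+
      ultimately show "distinct (map fst ?zs)"
        by (auto simp: comp_def)
      have "P n (?\<beta> n) \<subseteq> P (2 * n) (\<alpha> (2 * n))" "P n (?\<beta> n) \<subseteq> P (2 * n + 1) (\<alpha> (2 * n + 1))" for n
        by (rule order_trans[OF P_antimono P_mono]; simp)+
      then show "snd z \<in> P (fst z) (\<alpha> (fst z))" if "z \<in> set ?zs" for z
        using that as(2) bs(2) by fastforce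
      show "x \<otimes> y = lprod (map snd ?zs)"
        using as bs by (simp add: lprod_append comp_def)
    qed
  qed
  show "\<exists>\<beta>. \<forall>x\<in>prod_nbhd \<beta>. inv x \<in> prod_nbhd \<alpha>" for \<alpha>
  proof (intro exI ballI)
    fix x assume "x \<in> prod_nbhd \<alpha>"
    then show "inv x \<in> prod_nbhd \<alpha>"
    proof (rule prod_nbhdE)
      fix zs assume zs: "distinct (map fst zs)" "\<And>z. z \<in> set zs \<Longrightarrow> snd z \<in> P (fst z) (\<alpha> (fst z))"
        "x = lprod (map snd zs)" "set (map snd zs) \<subseteq> carrier G"
      show ?thesis
      proof (rule prod_nbhdI)
        show "distinct (map fst (rev (map (\<lambda>z. (fst z, inv (snd z))) zs)))"
          using zs(1) by (simp add: rev_map[symmetric] comp_def)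
        show "snd z \<in> P (fst z) (\<alpha> (fst z))" if "z \<in> set (rev (map (\<lambda>z. (fst z, inv (snd z))) zs))" for z
          using that zs(2) P_inv by auto
        show "inv x = lprod (map snd (rev (map (\<lambda>z. (fst z, inv (snd z))) zs)))"
          using zs(3,4) by (simp add: inv_lprod rev_map[symmetric] comp_def del: set_map)
      qed
    qed
  qed
  show "\<exists>\<beta>. \<forall>x\<in>prod_nbhd \<beta>. g \<otimes> x \<otimes> inv g \<in> prod_nbhd \<alpha>" if g: "g \<in> carrier G" for g \<alpha>
  proof -
    obtain m where m: "\<forall>n k. \<forall>x\<in>P n k. g \<otimes> x \<otimes> inv g \<in> P (n + m) k"
      using P_conj[OF g] by blast
    \<comment> \<open>Conjugating every factor raises all levels by the same \<open>m\<close>: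
      distinctness survives and \<open>\<alpha>\<close> is merely shifted.\<close>
    show ?thesis
    proof (intro exI[of _ "\<lambda>n. \<alpha> (n + m)"] ballI)
      fix x assume "x \<in> prod_nbhd (\<lambda>n. \<alpha> (n + m))"
      then show "g \<otimes> x \<otimes> inv g \<in> prod_nbhd \<alpha>"
      proof (rule prod_nbhdE)
        fix zs assume zs: "distinct (map fst zs)"
          "\<And>z. z \<in> set zs \<Longrightarrow> snd z \<in> P (fst z) (\<alpha> (fst z + m))"
          "x = lprod (map snd zs)" "set (map snd zs) \<subseteq> carrier G"
        let ?zs = "map (\<lambda>z. (fst z + m, g \<otimes> snd z \<otimes> inv g)) zs"
        show ?thesis
        proof (rule prod_nbhdI)
          have "distinct (map (\<lambda>n. n + m) (map fst zs))"
            using zs(1) by (subst distinct_map) (auto simp: inj_on_def)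
          then show "distinct (map fst ?zs)"
            by (simp add: comp_def)
          show "snd z \<in> P (fst z) (\<alpha> (fst z))" if "z \<in> set ?zs" for z
            using that zs(2) m by auto
          show "g \<otimes> x \<otimes> inv g = lprod (map snd ?zs)"
            using zs(3,4) conj_lprod[OF g] by (simp add: comp_def del: set_map)
        qed
      qed
    qed
  qed
  show "prod_nbhd \<beta> \<subseteq> prod_nbhd \<alpha>" if "\<And>i. \<alpha> i \<le> \<beta> i" for \<alpha> \<beta>
    using prod_nbhd_antimono[OF that] .
  show "\<exists>k. \<forall>\<beta>. (\<forall>i\<le>k. \<beta> i = \<alpha> i) \<longrightarrow> x \<in> prod_nbhd \<beta>" if "x \<in> prod_nbhd \<alpha>" for x \<alpha>
    using that
  proof (rule prod_nbhdE)
    fix zs assume zs: "distinct (map fst zs)" "\<And>z. z \<in> set zs \<Longrightarrow> snd z \<in> P (fst z) (\<alpha> (fst z))"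
        "x = lprod (map snd zs)"
    \<comment> \<open>The sum of the levels serves as a bound for each of them.\<close>
    have "x \<in> prod_nbhd \<beta>" if "\<forall>i\<le>sum_list (map fst zs). \<beta> i = \<alpha> i" for \<beta>
      using zs that by (intro prod_nbhdI[of zs]) (auto simp: member_le_sum_list)
    then show ?thesis by blast
  qed
qed

text \<open>Products with pairwise distinct indices stay small because the entry of least index splits
  such a product into three factors lying one level deeper.\<close>

lemma prod_nbhd_small:
  assumes T: "group_topology (carrier G) (mult G) (m_inv G) T"
    and small: "\<And>W n. openin T W \<Longrightarrow> \<one> \<in> W \<Longrightarrow> \<exists>k. P n k \<subseteq> W"
    and W: "openin T W" "\<one> \<in> W"
  shows "\<exists>\<alpha>. prod_nbhd \<alpha> \<subseteq> W"
proof -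
  interpret T: top_group G T
    by unfold_locales (rule T)
  let ?cube = "\<lambda>V V'. \<forall>x\<in>V'. \<forall>y\<in>V'. \<forall>z\<in>V'. x \<otimes> y \<otimes> z \<in> V"
  have "\<exists>V. \<forall>n. (openin T (V n) \<and> \<one> \<in> V n \<and> V n \<subseteq> W) \<and> ?cube (V n) (V (Suc n))"
  proof (rule dependent_nat_choice)
    show "\<exists>x. openin T x \<and> \<one> \<in> x \<and> x \<subseteq> W"
      using W by blast
    fix V :: "'g set" and n :: nat assume V: "openin T V \<and> \<one> \<in> V \<and> V \<subseteq> W"
    then have V': "openin T V" "\<one> \<in> V" by auto
    show "\<exists>V'. (openin T V' \<and> \<one> \<in> V' \<and> V' \<subseteq> W) \<and> ?cube V V'"
    proof (rule T.cube_nbhd[OF V'])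
      fix V' assume V': "openin T V'" "\<one> \<in> V'"
        "\<And>x y z. x \<in> V' \<Longrightarrow> y \<in> V' \<Longrightarrow> z \<in> V' \<Longrightarrow> x \<otimes> y \<otimes> z \<in> V"
      have "V' \<subseteq> V"
      proof
        fix x assume "x \<in> V'"
        then have "x \<otimes> \<one> \<otimes> \<one> \<in> V" "x \<in> carrier G"
          using V'(2,3) T.open_subset[OF V'(1)] by blast+
        then show "x \<in> V" by simp
      qed
      then show ?thesis
        using V V' by (intro exI[of _ V']) auto
    qed
  qed
  then obtain V where VV: "\<forall>n. (openin T (V n) \<and> \<one> \<in> V n \<and> V n \<subseteq> W) \<and> ?cube (V n) (V (Suc n))"
    by (rule exE)
  have V: "openin T (V n)" "\<one> \<in> V n" "V 0 \<subseteq> W" for n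
    using VV by blast+
  have V_cube: "x \<otimes> y \<otimes> z \<in> V n" if "x \<in> V (Suc n)" "y \<in> V (Suc n)" "z \<in> V (Suc n)" for n x y z
    using VV that by blast
  have "V (Suc n) \<subseteq> V n" for n
  proof
    fix x assume "x \<in> V (Suc n)"
    then have "x \<otimes> \<one> \<otimes> \<one> \<in> V n" "x \<in> carrier G"
      using V(2) V_cube T.open_subset[OF V(1)] by blast+
    then show "x \<in> V n" by simp
  qed
  then have V_anti: "V n \<subseteq> V m" if "m \<le> n" for m n
    using lift_Suc_antimono_le[of V] that by blast
  \<comment> \<open>A factor lies one step deeper than its level: beside the factor of least level
    \<open>m\<close> stand two products whose levels exceed \<open>m\<close>, and all three must lie
    in \<open>V (Suc m)\<close> for the whole product to lie in \<open>V m\<close>.\<close>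
  have split: "lprod (map snd zs) \<in> V n"
    if "distinct (map fst zs)" "\<forall>z\<in>set zs. n \<le> fst z \<and> snd z \<in> V (Suc (fst z))" for zs n
    using that
  proof (induction "length zs" arbitrary: zs n rule: less_induct)
    case less
    show ?case
    proof (cases "zs = []")
      case True then show ?thesis using V(2) by simp
    next
      case False
      define m where "m = Min (fst ` set zs)"
      have "m \<in> fst ` set zs"
        unfolding m_def using False by (intro Min_in) auto
      then obtain g where "(m, g) \<in> set zs" by auto
      then obtain as bs where zs: "zs = as @ (m, g) # bs"
        by (meson split_list)
      have m_le: "m \<le> fst z" if "z \<in> set zs" for z
        unfolding m_def using that by (intro Min_le) auto
      have "n \<le> m"
        using less.prems(2) \<open>(m, g) \<in> set zs\<close> by auto
      have deeper: "Suc m \<le> fst z \<and> snd z \<in> V (Suc (fst z))" if "z \<in> set as \<union> set bs" for z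
      proof -
        have "fst z \<noteq> m"
          using less.prems(1) that zs by force
        then show ?thesis
          using m_le[of z] less.prems(2) that zs by force
      qed
      have "lprod (map snd as) \<in> V (Suc m)" "lprod (map snd bs) \<in> V (Suc m)"
        using less.prems(1) deeper zs by (auto intro!: less.hyps)
      moreover have "g \<in> V (Suc m)"
        using less.prems(2) zs by auto
      ultimately have "lprod (map snd as) \<otimes> g \<otimes> lprod (map snd bs) \<in> V m"
        by (intro V_cube)
      moreover have "set (map snd zs) \<subseteq> carrier G"
        using less.prems(2) T.open_subset[OF V(1)] by fastforce
      then have "lprod (map snd zs) = lprod (map snd as) \<otimes> g \<otimes> lprod (map snd bs)"
        using zs by (auto simp: lprod_append m_assoc)
      ultimately show ?thesis
        using V_anti[OF \<open>n \<le> m\<close>] by auto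
    qed
  qed
  have "\<forall>n. \<exists>k. P n k \<subseteq> V (Suc n)"
    using small V(1,2) by blast
  then obtain \<alpha> where \<alpha>: "\<And>n. P n (\<alpha> n) \<subseteq> V (Suc n)" by metis
  have "prod_nbhd \<alpha> \<subseteq> W"
  proof
    fix x assume "x \<in> prod_nbhd \<alpha>"
    then show "x \<in> W"
    proof (rule prod_nbhdE)
      fix zs assume zs: "distinct (map fst zs)" "\<And>z. z \<in> set zs \<Longrightarrow> snd z \<in> P (fst z) (\<alpha> (fst z))"
        "x = lprod (map snd zs)"
      then have "x \<in> V 0"
        using split[of zs 0] \<alpha> by blast
      then show ?thesis using V(3) by blast
    qed
  qed
  then show ?thesis by blast
qed

end

section \<open>Spaces with a compact metrizable decomposition\<close>

locale mk_space =
  fixes X :: "'a topology" and K :: "nat \<Rightarrow> 'a set" and d :: "nat \<Rightarrow> 'a \<Rightarrow> 'a \<Rightarrow> real"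
  assumes K_Suc: "K n \<subseteq> K (Suc n)"
    and K_compact: "compactin X (K n)"
    and K_metric: "Metric_space (K n) (d n)"
    and K_top: "subtopology X (K n) = Metric_space.mtopology (K n) (d n)"
    and K_Union: "(\<Union>n. K n) = topspace X"
    and K_closed: "F \<subseteq> topspace X \<Longrightarrow>
      closedin X F \<longleftrightarrow> (\<forall>n. closedin (subtopology X (K n)) (F \<inter> K n))"

lemma MK_omega_space_imp_mk_space:
  assumes "MK_omega_space X"
  obtains K d where "mk_space X K d"
proof -
  obtain K where KK: "\<forall>n. K n \<subseteq> K (Suc n)"
    "\<forall>n. compactin X (K n) \<and> metrizable_space (subtopology X (K n))" "(\<Union>n. K n) = topspace X"
    "\<forall>F. F \<subseteq> topspace X \<longrightarrow>
      (closedin X F \<longleftrightarrow> (\<forall>n. closedin (subtopology X (K n)) (F \<inter> K n)))"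
    using assms unfolding MK_omega_space_def by (elim exE conjE) (rule that)
  have K: "compactin X (K n)" "metrizable_space (subtopology X (K n))" for n
    using KK(2) by auto
  have "\<exists>d. Metric_space (K n) d \<and> subtopology X (K n) = Metric_space.mtopology (K n) d" for n
  proof -
    obtain M d where M: "Metric_space M d" "subtopology X (K n) = Metric_space.mtopology M d"
      using K(2)[of n] unfolding metrizable_space_def by blast
    have "M = topspace (subtopology X (K n))"
      using M Metric_space.topspace_mtopology by metis
    also have "\<dots> = K n"
      using compactin_subset_topspace[OF K(1)] by (simp add: inf.absorb2)
    finally show ?thesis using M by blast
  qed
  then obtain d where d: "\<And>n. Metric_space (K n) (d n) \<and> subtopology X (K n) = Metric_space.mtopology (K n) (d n)"
    by metis
  then have "mk_space X K d"
    unfolding mk_space_def using KK d by (intro conjI allI impI) blast+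
  then show thesis by (rule that)
qed

context mk_space
begin

lemma K_mono: "n \<le> m \<Longrightarrow> K n \<subseteq> K m"
  using lift_Suc_mono_le[of K] K_Suc by blast

lemma K_topspace: "K n \<subseteq> topspace X"
  using K_Union by blast

lemma topspace_K [simp]: "topspace (subtopology X (K n)) = K n"
  using K_topspace by (simp add: inf.absorb2)

lemma K_normal: "normal_space (subtopology X (K n))"
  using metrizable_imp_normal_space Metric_space.metrizable_space_mtopology[OF K_metric] K_top by metis

lemma K_t1: "t1_space (subtopology X (K n))"
  using Metric_space.Hausdorff_space_mtopology[OF K_metric] K_top Hausdorff_imp_t1_space by metis

lemma continuous_map_pieces:
  assumes "\<And>n. continuous_map (subtopology X (K n)) T f"
  shows "continuous_map X T f"
  unfolding continuous_map_closedin
proof (intro conjI ballI allI impI Pi_I)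
  fix x assume "x \<in> topspace X"
  then obtain n where "x \<in> K n" using K_Union by blast
  then show "f x \<in> topspace T"
    using continuous_map_image_subset_topspace[OF assms[of n]] unfolding topspace_K by blast
next
  fix C assume "closedin T C"
  have "{x \<in> topspace X. f x \<in> C} \<inter> K n = {x \<in> K n. f x \<in> C}" for n
    using K_topspace by blast
  moreover have "closedin (subtopology X (K n)) {x \<in> K n. f x \<in> C}" for n
    using assms[of n] \<open>closedin T C\<close> unfolding continuous_map_closedin topspace_K by blast
  ultimately show "closedin X {x \<in> topspace X. f x \<in> C}"
    by (subst K_closed) auto
qed

text \<open>Tietze's theorem passes from each piece to the next, in which it is compact and hence
  closed. The extensions agree where they overlap, and continuity on all pieces is continuity on
  \<open>X\<close>.\<close>

lemma extend_from_piece: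
  fixes f :: "'a \<Rightarrow> real"
  assumes "continuous_map (subtopology X (K m)) euclideanreal f"
  obtains g where "continuous_map X euclideanreal g" "\<And>x. x \<in> K m \<Longrightarrow> g x = f x"
proof -
  let ?C = "\<lambda>j. continuous_map (subtopology X (K (m + j))) euclideanreal"
  \<comment> \<open>The clause for \<open>j = 0\<close> pins the start of the sequence to
    \<open>f\<close>.\<close>
  have "\<exists>F. \<forall>j. (?C j (F j) \<and> (j = 0 \<longrightarrow> F j = f)) \<and> (\<forall>x\<in>K (m + j). F (Suc j) x = F j x)"
  proof (rule dependent_nat_choice)
    show "\<exists>g. ?C 0 g \<and> (0 = 0 \<longrightarrow> g = f)"
      using assms by auto
    fix g j assume g: "?C j g \<and> (j = 0 \<longrightarrow> g = f)"
    have sub: "K (m + j) \<subseteq> K (m + Suc j)"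
      by (rule K_mono) simp
    have "compactin (subtopology X (K (m + Suc j))) (K (m + j))"
      using sub K_compact by (simp add: compactin_subtopology)
    then have closed: "closedin (subtopology X (K (m + Suc j))) (K (m + j))"
      using Metric_space.Hausdorff_space_mtopology[OF K_metric] K_top compactin_imp_closedin by metis
    have cont: "continuous_map (subtopology (subtopology X (K (m + Suc j))) (K (m + j))) euclideanreal g"
      using g sub by (simp add: subtopology_subtopology inf.absorb2)
    obtain g' where "?C (Suc j) g'" "\<And>x. x \<in> K (m + j) \<Longrightarrow> g' x = g x"
      by (rule Tietze_extension_realinterval[OF K_normal closed is_interval_univ UNIV_not_empty cont])
        (simp, rule that)
    then show "\<exists>g'. (?C (Suc j) g' \<and> (Suc j = 0 \<longrightarrow> g' = f)) \<and> (\<forall>x\<in>K (m + j). g' x = g x)"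
      by auto
  qed
  then obtain F where FF: "\<forall>j. (?C j (F j) \<and> (j = 0 \<longrightarrow> F j = f)) \<and> (\<forall>x\<in>K (m + j). F (Suc j) x = F j x)"
    by (rule exE)
  have F: "?C j (F j)" "F 0 = f" "x \<in> K (m + j) \<Longrightarrow> F (Suc j) x = F j x" for j x
    using FF by blast+
  have F_stable: "F (j + i) x = F j x" if "x \<in> K (m + j)" for i j x
  proof (induction i)
    case (Suc i)
    have "x \<in> K (m + (j + i))"
      using that K_mono[of "m + j" "m + (j + i)"] by auto
    then show ?case using Suc F(3) by simp
  qed simp
  define g where "g x = F (LEAST j. x \<in> K (m + j)) x" for x
  have g: "g x = F j x" if "x \<in> K (m + j)" for x j
  proof -
    let ?l = "LEAST j. x \<in> K (m + j)"
    have "x \<in> K (m + ?l)" "?l \<le> j"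
      using that by (auto intro: LeastI Least_le)
    then show ?thesis
      unfolding g_def using F_stable[of x ?l "j - ?l"] by simp
  qed
  have "continuous_map (subtopology X (K n)) euclideanreal g" for n
  proof (rule continuous_map_eq)
    have "K n \<subseteq> K (m + n)" by (rule K_mono) simp
    then show "continuous_map (subtopology X (K n)) euclideanreal (F n)"
      using continuous_map_from_subtopology_mono[OF F(1)] by blast
    show "F n x = g x" if "x \<in> topspace (subtopology X (K n))" for x
      using that g \<open>K n \<subseteq> K (m + n)\<close> by auto
  qed
  then have "continuous_map X euclideanreal g"
    by (rule continuous_map_pieces)
  moreover have "g x = f x" if "x \<in> K m" for x
    using g[of x 0] that F(2) by simp
  ultimately show thesis by (rule that)
qed

lemma finite_subset_piece:
  assumes "finite S" "S \<subseteq> topspace X"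
  obtains m where "S \<subseteq> K m"
proof -
  have "\<exists>m. S \<subseteq> K m"
    using assms
  proof (induction S rule: finite_induct)
    case (insert x S)
    then obtain m where m: "S \<subseteq> K m" by auto
    obtain n where "x \<in> K n" using insert.prems K_Union by blast
    then have "insert x S \<subseteq> K (max m n)"
      using m K_mono[of m "max m n"] K_mono[of n "max m n"] by auto
    then show ?case by blast
  qed simp
  then show thesis using that by blast
qed

text \<open>A finite set is closed and discrete in some piece, so Tietze's theorem applies there.
  The lemma takes the part of complete regularity in the separation arguments.\<close>

lemma interpolating_function:
  fixes f :: "'a \<Rightarrow> real"
  assumes "finite S" "S \<subseteq> topspace X"
  obtains g where "continuous_map X euclideanreal g" "\<And>x. x \<in> S \<Longrightarrow> g x = f x"
proof -
  obtain m where m: "S \<subseteq> K m"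
    using finite_subset_piece[OF assms] .
  let ?Y = "subtopology X (K m)"
  have closed: "closedin ?Y S"
    using K_t1[of m] assms m by (simp add: t1_space_closedin_finite)
  have "subtopology ?Y S = discrete_topology S"
    by (rule finite_t1_space_imp_discrete_topology[OF _ assms(1) t1_space_subtopology[OF K_t1]])
      (use assms m in auto)
  then have cont: "continuous_map (subtopology ?Y S) euclideanreal f"
    by simp
  obtain g where g: "continuous_map ?Y euclideanreal g" "\<And>x. x \<in> S \<Longrightarrow> g x = f x"
    by (rule Tietze_extension_realinterval[OF K_normal closed is_interval_univ UNIV_not_empty cont])
      (simp, rule that)
  obtain g' where g': "continuous_map X euclideanreal g'" "\<And>x. x \<in> K m \<Longrightarrow> g' x = g x"
    by (rule extend_from_piece[OF g(1)]) (rule that)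
  show thesis
    by (rule that[OF g'(1)]) (use g g' m in auto)
qed

text \<open>The metrics of different pieces are unrelated, so closeness in one says nothing
  quantitative about another. Admitting all pieces up to \<open>n\<close> makes the relation
  increase with \<open>n\<close>.\<close>

definition E :: "nat \<Rightarrow> nat \<Rightarrow> ('a \<times> 'a) set" where
  "E n k = {(x, y). \<exists>i\<le>n. x \<in> K i \<and> y \<in> K i \<and> d i x y < 1 / (real k + 1)}"

lemma E_I: "x \<in> K n \<Longrightarrow> y \<in> K n \<Longrightarrow> d n x y < 1 / (real k + 1) \<Longrightarrow> (x, y) \<in> E n k"
  unfolding E_def by blast

lemma E_mono: "n \<le> m \<Longrightarrow> E n k \<subseteq> E m k"
  unfolding E_def by (auto intro: order_trans)

lemma E_antimono: "k \<le> l \<Longrightarrow> E n l \<subseteq> E n k"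
proof -
  assume "k \<le> l"
  then have "1 / (real l + 1) \<le> 1 / (real k + 1)"
    by (intro divide_left_mono) auto
  then show ?thesis
    unfolding E_def by (auto intro: less_le_trans)
qed

lemma E_sym: "(x, y) \<in> E n k \<Longrightarrow> (y, x) \<in> E n k"
  unfolding E_def using Metric_space.commute[OF K_metric] by fastforce

lemma E_subset: "E n k \<subseteq> K n \<times> K n"
  unfolding E_def using K_mono by fastforce

lemma E_topspace: "(x, y) \<in> E n k \<Longrightarrow> x \<in> topspace X \<and> y \<in> topspace X"
  using E_subset K_topspace by blast

text \<open>By a Lebesgue number: the preimages of the open sets on which \<open>R\<close> holds for
  all pairs cover the compact piece. \<open>R\<close> is arbitrary so as to serve closeness of
  reals, smallness of left quotients and equality.\<close>

lemma E_uniform: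
  assumes f: "continuous_map X T f"
    and local: "\<And>x. x \<in> topspace X \<Longrightarrow> \<exists>V. openin T V \<and> f x \<in> V \<and> (\<forall>p\<in>V. \<forall>q\<in>V. R p q)"
  shows "\<exists>k. \<forall>(x, y)\<in>E n k. R (f x) (f y)"
proof -
  have "\<exists>k. \<forall>x\<in>K i. \<forall>y\<in>K i. d i x y < 1 / (real k + 1) \<longrightarrow> R (f x) (f y)" for i
  proof -
    interpret Metric_space "K i" "d i" by (rule K_metric)
    define \<C> where "\<C> = {{y \<in> K i. f y \<in> V} | V. openin T V \<and> (\<forall>p\<in>V. \<forall>q\<in>V. R p q)}"
    have "continuous_map (subtopology X (K i)) T f"
      using f continuous_map_from_subtopology by blast
    have op: "openin mtopology U" if U: "U \<in> \<C>" for U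
    proof -
      obtain V where V: "U = {y \<in> K i. f y \<in> V}" "openin T V"
        using U unfolding \<C>_def by blast
      then show ?thesis
        using openin_continuous_map_preimage[OF \<open>continuous_map (subtopology X (K i)) T f\<close> V(2)]
        unfolding topspace_K K_top by simp
    qed
    have cover: "K i \<subseteq> \<Union>\<C>"
    proof
      fix x assume x: "x \<in> K i"
      then have "x \<in> topspace X" using K_topspace by blast
      from local[OF this] obtain V where "openin T V" "f x \<in> V" "\<forall>p\<in>V. \<forall>q\<in>V. R p q"
        by (elim exE conjE) (rule that)
      then show "x \<in> \<Union>\<C>"
        unfolding \<C>_def using x by blast
    qed
    have comp: "compactin mtopology (K i)"
      unfolding K_top[symmetric] using K_compact by (simp add: compactin_subtopology)
    obtain \<epsilon> where \<epsilon>: "\<epsilon> > 0" "\<forall>x\<in>K i. \<exists>U\<in>\<C>. mball x \<epsilon> \<subseteq> U"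
      using lebesgue_number[of "K i" \<C>, OF comp cover, simplified] op by auto
    obtain k where k: "1 / (real k + 1) < \<epsilon>"
      using reals_Archimedean[OF \<epsilon>(1)] by (auto simp: inverse_eq_divide add.commute)
    have "R (f x) (f y)" if xy: "x \<in> K i" "y \<in> K i" "d i x y < 1 / (real k + 1)" for x y
    proof -
      obtain U where "U \<in> \<C>" "mball x \<epsilon> \<subseteq> U"
        using \<epsilon>(2) xy by blast
      moreover have "x \<in> mball x \<epsilon>" "y \<in> mball x \<epsilon>"
        using xy k \<epsilon>(1) by auto
      ultimately show ?thesis
        unfolding \<C>_def by blast
    qed
    then show ?thesis by blast
  qed
  then have "\<exists>k. \<forall>i. \<forall>x\<in>K i. \<forall>y\<in>K i. d i x y < 1 / (real (k i) + 1) \<longrightarrow> R (f x) (f y)"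
    by (intro choice allI)
  then obtain k where k: "\<forall>i. \<forall>x\<in>K i. \<forall>y\<in>K i. d i x y < 1 / (real (k i) + 1) \<longrightarrow> R (f x) (f y)"
    by (rule exE)
  \<comment> \<open>\<open>E n\<close> involves only the pieces up to \<open>n\<close>, so the
    largest of their thresholds works.\<close>
  have "R (f x) (f y)" if xy: "(x, y) \<in> E n (Max (k ` {..n}))" for x y
  proof -
    obtain i where i: "i \<le> n" "x \<in> K i" "y \<in> K i" "d i x y < 1 / (real (Max (k ` {..n})) + 1)"
      using xy unfolding E_def by blast
    have "k i \<le> Max (k ` {..n})"
      using i(1) by (intro Max_ge) auto
    then have "1 / (real (Max (k ` {..n})) + 1) \<le> 1 / (real (k i) + 1)"
      by (intro divide_left_mono) auto
    then show ?thesis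
      using i k[rule_format, of x i y] by linarith
  qed
  then show ?thesis by blast
qed

lemma E_uniform_real:
  assumes "continuous_map X euclideanreal f" and "\<epsilon> > 0"
  shows "\<exists>k. \<forall>(x, y)\<in>E n k. \<bar>f x - f y\<bar> < \<epsilon>"
proof (rule E_uniform[OF assms(1)])
  fix x
  have "\<bar>p - q\<bar> < \<epsilon>" if "p \<in> ball (f x) (\<epsilon> / 2)" "q \<in> ball (f x) (\<epsilon> / 2)" for p q
    using that unfolding mem_ball dist_real_def by linarith
  then show "\<exists>V. openin euclideanreal V \<and> f x \<in> V \<and> (\<forall>p\<in>V. \<forall>q\<in>V. \<bar>p - q\<bar> < \<epsilon>)"
    using assms(2) by (intro exI[of _ "ball (f x) (\<epsilon> / 2)"]) auto
qed

text \<open>Near \<open>x\<close> the map stays in the translate of \<open>V\<close> by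
  \<open>f x\<close>, and the left quotient of two points of that translate is a left quotient of
  two points of \<open>V\<close>.\<close>

lemma E_uniform_group:
  assumes "top_group G T" and "continuous_map X T f" and "openin T W" and "\<one>\<^bsub>G\<^esub> \<in> W"
  shows "\<exists>k. \<forall>(x, y)\<in>E n k. inv\<^bsub>G\<^esub> (f x) \<otimes>\<^bsub>G\<^esub> f y \<in> W"
proof (rule E_uniform[OF assms(2)])
  interpret top_group G T by fact
  fix x assume "x \<in> topspace X"
  then have x: "f x \<in> carrier G"
    using assms(2) topspace_eq by (auto simp: continuous_map_def)
  obtain V where V: "openin T V" "\<one>\<^bsub>G\<^esub> \<in> V" "\<And>x y. x \<in> V \<Longrightarrow> y \<in> V \<Longrightarrow> inv\<^bsub>G\<^esub> x \<otimes>\<^bsub>G\<^esub> y \<in> W"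
    by (rule left_quotient_nbhd[OF assms(3,4)]) (rule that)
  let ?V = "{y \<in> carrier G. inv\<^bsub>G\<^esub> (f x) \<otimes>\<^bsub>G\<^esub> y \<in> V}"
  have "openin T ?V"
    using left_translate_open[OF V(1)] x by simp
  moreover have "f x \<in> ?V"
    using x V(2) by simp
  moreover have "inv\<^bsub>G\<^esub> p \<otimes>\<^bsub>G\<^esub> q \<in> W" if "p \<in> ?V" "q \<in> ?V" for p q
  proof -
    have "inv\<^bsub>G\<^esub> (inv\<^bsub>G\<^esub> (f x) \<otimes>\<^bsub>G\<^esub> p) \<otimes>\<^bsub>G\<^esub> (inv\<^bsub>G\<^esub> (f x) \<otimes>\<^bsub>G\<^esub> q) \<in> W"
      using V(3) that by blast
    moreover have "inv\<^bsub>G\<^esub> (inv\<^bsub>G\<^esub> (f x) \<otimes>\<^bsub>G\<^esub> p) \<otimes>\<^bsub>G\<^esub> (inv\<^bsub>G\<^esub> (f x) \<otimes>\<^bsub>G\<^esub> q) = inv\<^bsub>G\<^esub> p \<otimes>\<^bsub>G\<^esub> q"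
      using that x by (simp add: inv_mult_group m_assoc inv_mult_cancel_left)
    ultimately show ?thesis by simp
  qed
  ultimately show "\<exists>V. openin T V \<and> f x \<in> V \<and> (\<forall>p\<in>V. \<forall>q\<in>V. inv\<^bsub>G\<^esub> p \<otimes>\<^bsub>G\<^esub> q \<in> W)"
    by blast
qed

lemma E_nbhd:
  assumes "x \<in> K n"
  obtains V where "openin (subtopology X (K n)) V" "x \<in> V" "\<And>y. y \<in> V \<Longrightarrow> (x, y) \<in> E n k"
proof -
  interpret Metric_space "K n" "d n" by (rule K_metric)
  show thesis
    by (rule that[of "mball x (1 / (real k + 1))"]) (use assms in \<open>auto simp: K_top intro: E_I\<close>)
qed

text \<open>A converse to \<open>E_uniform_group\<close> for the constructed topologies: on each
  piece the points close to \<open>x\<close> are mapped into the translate of \<open>U i\<close> by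
  \<open>f x\<close>.\<close>

lemma continuous_into_base_topology:
  fixes G (structure)
  assumes "group_nbhd_base G U" and f: "\<And>x. x \<in> topspace X \<Longrightarrow> f x \<in> carrier G"
    and small: "\<And>n i. \<exists>k. \<forall>(x, y)\<in>E n k. inv (f x) \<otimes> f y \<in> U i"
  shows "continuous_map X (group_nbhd_base.base_topology G U) f"
proof -
  interpret group_nbhd_base G U by fact
  have "continuous_map (subtopology X (K n)) base_topology f" for n
    unfolding continuous_map topspace_K
  proof (intro conjI allI impI)
    show "f ` K n \<subseteq> topspace base_topology"
      using f K_topspace[of n] by auto
    fix S assume S: "openin base_topology S"
    show "openin (subtopology X (K n)) {x \<in> K n. f x \<in> S}"
    proof (subst openin_subopen, intro ballI)
      fix x assume x: "x \<in> {x \<in> K n. f x \<in> S}"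
      then obtain i where i: "\<forall>u\<in>U i. f x \<otimes> u \<in> S"
        using S unfolding openin_base_topology by blast
      obtain k where k: "\<forall>(x, y)\<in>E n k. inv (f x) \<otimes> f y \<in> U i"
        using small ..
      have xK: "x \<in> K n" using x by blast
      show "\<exists>V. openin (subtopology X (K n)) V \<and> x \<in> V \<and> V \<subseteq> {x \<in> K n. f x \<in> S}"
      proof (rule E_nbhd[OF xK, of k])
        fix V assume V: "openin (subtopology X (K n)) V" "x \<in> V" "\<And>y. y \<in> V \<Longrightarrow> (x, y) \<in> E n k"
        have "y \<in> {x \<in> K n. f x \<in> S}" if "y \<in> V" for y
        proof -
          have yx: "f x \<in> carrier G" "f y \<in> carrier G" "y \<in> K n"
            using V(3)[OF that] E_subset f K_topspace by blast+
          have "f x \<otimes> (inv (f x) \<otimes> f y) \<in> S"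
            using i k V(3)[OF that] by blast
          then show ?thesis using yx by (simp add: inv_mult_cancel_left)
        qed
        then show ?thesis using V by blast
      qed
    qed
  qed
  then show ?thesis
    by (rule continuous_map_pieces)
qed

text \<open>Balls around finite nets of the pieces. They need not be open in \<open>X\<close>, which
  may fail to be second countable, so they form a network rather than a base.\<close>

lemma countable_network:
  obtains \<B> where "countable \<B>"
    "\<And>W x. openin X W \<Longrightarrow> x \<in> W \<Longrightarrow> \<exists>B\<in>\<B>. x \<in> B \<and> B \<subseteq> W"
proof -
  have "\<exists>\<B>. countable \<B> \<and>
      (\<forall>W x. openin X W \<longrightarrow> x \<in> W \<inter> K n \<longrightarrow> (\<exists>B\<in>\<B>. x \<in> B \<and> B \<subseteq> W))" for n
  proof -
    interpret Metric_space "K n" "d n" by (rule K_metric)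
    have "compactin mtopology (K n)"
      unfolding K_top[symmetric] using K_compact by (simp add: compactin_subtopology)
    then have "\<forall>k. \<exists>F. finite F \<and> F \<subseteq> K n \<and> K n \<subseteq> (\<Union>x\<in>F. mball x (1 / (real k + 1)))"
      using compactin_imp_mtotally_bounded by (simp add: mtotally_bounded_def)
    then obtain F where F: "\<And>k. finite (F k)" "\<And>k. F k \<subseteq> K n"
      "\<And>k. K n \<subseteq> (\<Union>x\<in>F k. mball x (1 / (real k + 1)))"
      by metis
    define \<B> where "\<B> = (\<Union>k. (\<lambda>x. mball x (1 / (real k + 1))) ` F k)"
    have "countable \<B>"
      unfolding \<B>_def using F(1) by (intro countable_UN) (auto intro: countable_finite)
    moreover have "\<exists>B\<in>\<B>. x \<in> B \<and> B \<subseteq> W" if W: "openin X W" and x: "x \<in> W \<inter> K n" for W x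
    proof -
      have "openin mtopology (W \<inter> K n)"
        unfolding K_top[symmetric] using W by (rule openin_subtopology_Int)
      then obtain r where r: "r > 0" "mball x r \<subseteq> W \<inter> K n"
        using x unfolding openin_mtopology by blast
      obtain k where k: "1 / (real k + 1) < r / 2"
        using reals_Archimedean[of "r / 2"] r(1) by (auto simp: inverse_eq_divide add.commute)
      obtain c where c: "c \<in> F k" "x \<in> mball c (1 / (real k + 1))"
        using F(3)[of k] x by blast
      have "mball c (1 / (real k + 1)) \<subseteq> mball x r"
      proof
        fix y assume y: "y \<in> mball c (1 / (real k + 1))"
        have "d n x y \<le> d n x c + d n c y"
          using c y x by (intro triangle) auto
        then show "y \<in> mball x r"
          using c y k by (auto simp: commute)
      qed
      then show ?thesis
        unfolding \<B>_def using c r(2) by blast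
    qed
    ultimately show ?thesis by blast
  qed
  then obtain \<B> where \<B>: "\<And>n. countable (\<B> n)"
    "\<And>n W x. openin X W \<Longrightarrow> x \<in> W \<inter> K n \<Longrightarrow> \<exists>B\<in>\<B> n. x \<in> B \<and> B \<subseteq> W"
    by metis
  show thesis
  proof (rule that[of "\<Union>n. \<B> n"])
    fix W x assume W: "openin X W" "x \<in> W"
    then obtain n where "x \<in> K n"
      using K_Union openin_subset by blast
    then show "\<exists>B\<in>\<Union>n. \<B> n. x \<in> B \<and> B \<subseteq> W"
      using \<B>(2)[OF W(1), of x n] W(2) by blast
  qed (use \<B>(1) in blast)
qed

text \<open>If \<open>{a}\<close> is not open, its complement is not closed, and this is witnessed
  on a single piece, in which \<open>a\<close> is then not isolated. The whole sequence thus lives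
  in one compact metric space.\<close>

lemma nonisolated_sequence:
  assumes "X \<noteq> discrete_topology (topspace X)"
  obtains n a s where "a \<in> K n" "\<And>i. s i \<in> K n" "\<And>i. s i \<noteq> a" "\<And>i. d n a (s i) < 1 / (real i + 1)"
proof -
  obtain a where a: "a \<in> topspace X" "\<not> openin X {a}"
    using assms discrete_topology_unique[of "topspace X" X] by metis
  then have "\<not> closedin X (topspace X - {a})"
    by (simp add: closedin_def Diff_Diff_Int)
  then obtain n where n: "\<not> closedin (subtopology X (K n)) ((topspace X - {a}) \<inter> K n)"
    by (subst (asm) K_closed) auto
  interpret Metric_space "K n" "d n" by (rule K_metric)
  have eq: "(topspace X - {a}) \<inter> K n = K n - {a}"
    using K_topspace by blast
  have aK: "a \<in> K n"
  proof (rule ccontr)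
    assume "a \<notin> K n"
    then show False
      using n eq closedin_topspace[of "subtopology X (K n)"] unfolding topspace_K by simp
  qed
  have "\<exists>s. s \<in> K n \<and> s \<noteq> a \<and> d n a s < 1 / (real i + 1)" for i
  proof (rule ccontr)
    assume none: "\<nexists>s. s \<in> K n \<and> s \<noteq> a \<and> d n a s < 1 / (real i + 1)"
    have "mball a (1 / (real i + 1)) \<subseteq> {a}"
      using none by (auto; blast)
    moreover have "a \<in> mball a (1 / (real i + 1))"
      using aK by simp
    ultimately have "{a} = mball a (1 / (real i + 1))"
      by blast
    then have "openin (subtopology X (K n)) {a}"
      by (metis K_top openin_mball)
    then show False
      using n aK unfolding eq closedin_def topspace_K by (simp add: double_diff)
  qed
  then obtain s where "\<And>i. s i \<in> K n \<and> s i \<noteq> a \<and> d n a (s i) < 1 / (real i + 1)"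
    by metis
  then show thesis
    using that aK by blast
qed

text \<open>The factors \<open>\<delta> n\<close> are chosen so that \<open>min 1 (d m a x / \<delta> n) = 1\<close> at the first \<open>g n\<close> terms
  of the sequence.\<close>

lemma slowly_vanishing_function:
  fixes s :: "nat \<Rightarrow> 'a" and g :: "nat \<Rightarrow> nat"
  assumes "a \<in> K m" and "\<And>i. s i \<in> K m" and "\<And>i. s i \<noteq> a"
  obtains h where "continuous_map X euclideanreal h" "h a = 0"
    "\<And>n i. i < g n \<Longrightarrow> 1 \<le> 2 ^ n * h (s i)"
proof -
  interpret Metric_space "K m" "d m" by (rule K_metric)
  define \<delta> where "\<delta> n = Min (insert 1 ((\<lambda>i. d m a (s i)) ` {..<g n}))" for n
  have \<delta>_pos: "\<delta> n > 0" for n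
    unfolding \<delta>_def using assms by (subst Min_gr_iff) auto
  have \<delta>_le: "\<delta> n \<le> d m a (s i)" if "i < g n" for n i
    unfolding \<delta>_def using that by (intro Min_le) auto
  \<comment> \<open>For \<open>i < g n\<close> the summand of index \<open>n\<close> alone is
    \<open>(1/2) ^ n\<close> at \<open>d m a (s i)\<close>, whence the factor \<open>2 ^ n\<close>
    in the conclusion. The cut-off \<open>max 0 t\<close> bounds the summands on the whole line, so
    the series converges uniformly.\<close>
  define \<phi> where "\<phi> t = (\<Sum>n. (1/2) ^ n * min 1 (max 0 t / \<delta> n))" for t :: real
  have bound: "norm ((1/2) ^ n * min 1 (max 0 t / \<delta> n)) \<le> (1/2 :: real) ^ n" for n t
    using \<delta>_pos[of n] by (simp add: abs_mult mult_left_le)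
  have summ: "summable (\<lambda>n. (1/2) ^ n * min 1 (max 0 t / \<delta> n))" for t
    by (rule summable_comparison_test'[OF summable_geometric[of "1/2::real"] bound]) auto
  have "uniform_limit UNIV (\<lambda>N t. \<Sum>n<N. (1/2) ^ n * min 1 (max 0 t / \<delta> n)) \<phi> sequentially"
    unfolding \<phi>_def by (rule Weierstrass_m_test[OF bound]) (simp add: summable_geometric)
  then have "continuous_on UNIV \<phi>"
    by (rule uniform_limit_theorem[rotated])
      (auto intro!: always_eventually continuous_intros simp: \<delta>_pos less_imp_neq[OF \<delta>_pos, symmetric])
  then have "continuous_map euclideanreal euclideanreal \<phi>" by simp
  moreover have "continuous_map mtopology euclideanreal (d m a)"
    unfolding Met_TC.continuous_map_to_metric[where ?'a = real, unfolded mtopology_is_euclidean]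
  proof (intro ballI allI impI)
    fix x and \<epsilon> :: real assume x: "x \<in> topspace mtopology" "0 < \<epsilon>"
    have "d m a y \<in> Met_TC.mball (d m a x) \<epsilon>" if "y \<in> mball x \<epsilon>" for y
      using that assms(1) triangle[of a x y] triangle[of a y x] commute[of x y]
      by (auto simp: dist_real_def)
    then show "\<exists>U. openin mtopology U \<and> x \<in> U \<and> (\<forall>y\<in>U. d m a y \<in> Met_TC.mball (d m a x) \<epsilon>)"
      using x by (intro exI[of _ "mball x \<epsilon>"]) auto
  qed
  ultimately have "continuous_map (subtopology X (K m)) euclideanreal (\<phi> \<circ> d m a)"
    unfolding K_top by (rule continuous_map_compose[rotated])
  then obtain h where h: "continuous_map X euclideanreal h" "\<And>x. x \<in> K m \<Longrightarrow> h x = (\<phi> \<circ> d m a) x"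
    by (rule extend_from_piece) (rule that)
  show thesis
  proof (rule that[OF h(1)])
    show "h a = 0"
      using h(2) assms(1) by (simp add: \<phi>_def)
    fix n i assume i: "i < g n"
    have "(1/2) ^ n * min 1 (max 0 (d m a (s i)) / \<delta> n) \<le> \<phi> (d m a (s i))"
      unfolding \<phi>_def
      using sum_le_suminf[OF summ[of "d m a (s i)"], of "{n}"] \<delta>_pos by (simp add: less_imp_le)
    moreover have "min 1 (max 0 (d m a (s i)) / \<delta> n) = 1"
      using \<delta>_le[OF i] \<delta>_pos[of n] by (simp add: min_def divide_simps)
    ultimately have "(1/2) ^ n \<le> h (s i)"
      using h(2) assms(2) by simp
    then have "2 ^ n * (1/2) ^ n \<le> 2 ^ n * h (s i)"
      by (intro mult_left_mono) auto
    then show "1 \<le> 2 ^ n * h (s i)"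
      by (simp add: power_divide)
  qed
qed

end

section \<open>Free groups over such spaces\<close>

context top_group
begin

text \<open>Iterated squaring. The exponents are powers of two to match the weights in
  \<open>slowly_vanishing_function\<close>.\<close>

lemma pow2_nbhd:
  assumes "openin T W" and "\<one> \<in> W"
  shows "\<exists>V. openin T V \<and> \<one> \<in> V \<and> (\<forall>x\<in>V. x [^] (2 ^ n :: nat) \<in> W)"
  using assms
proof (induction n arbitrary: W)
  case 0
  then show ?case using subsetD[OF open_subset[OF 0(1)]] by (intro exI[of _ W]) auto
next
  case (Suc n)
  show ?case
  proof (rule square_nbhd[OF Suc.prems])
    fix V0 assume V0: "openin T V0" "\<one> \<in> V0" "\<And>x y. x \<in> V0 \<Longrightarrow> y \<in> V0 \<Longrightarrow> x \<otimes> y \<in> W"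
    obtain V where V: "openin T V" "\<one> \<in> V" "\<forall>x\<in>V. x [^] (2 ^ n :: nat) \<in> V0"
      using Suc.IH[OF V0(1,2)] by (elim exE conjE) (rule that)
    have "x [^] (2 ^ Suc n :: nat) \<in> W" if x: "x \<in> V" for x
    proof -
      have "x [^] (2 ^ n :: nat) \<otimes> x [^] (2 ^ n :: nat) \<in> W"
        using V0(3) V(3) x by blast
      moreover have "x [^] (2 ^ n :: nat) \<otimes> x [^] (2 ^ n :: nat) = x [^] (2 ^ Suc n :: nat)"
        using x open_subset[OF V(1)] by (subst nat_pow_mult) (auto simp: mult_2)
      ultimately show ?thesis by simp
    qed
    then show ?thesis using V by blast
  qed
qed

text \<open>If a word lies in an open set, its letters have neighbourhoods whose product stays in
  that set, and each of these contains a member of \<open>\<B>\<close> around the letter. There are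
  only countably many finite products of members of \<open>\<B>\<close>.\<close>

lemma countable_network_products:
  assumes "countable \<B>"
    and net: "\<And>W l. openin T W \<Longrightarrow> l \<in> W \<Longrightarrow> l \<in> L \<Longrightarrow> \<exists>B\<in>\<B>. l \<in> B \<and> B \<subseteq> W"
    and "L \<subseteq> carrier G"
    and gen: "\<And>g. g \<in> carrier G \<Longrightarrow> \<exists>xs. set xs \<subseteq> L \<and> g = lprod xs"
  obtains \<N> where "countable \<N>" "\<And>W x. openin T W \<Longrightarrow> x \<in> W \<Longrightarrow> \<exists>N\<in>\<N>. x \<in> N \<and> N \<subseteq> W"
proof -
  define sprod where "sprod Bs = foldr (\<lambda>B N. (\<lambda>(b, c). b \<otimes> c) ` (B \<times> N)) Bs {\<one>}" for Bs
  have sprod_simps: "sprod [] = {\<one>}" "sprod (B # Bs) = (\<lambda>(b, c). b \<otimes> c) ` (B \<times> sprod Bs)" for B Bs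
    by (simp_all add: sprod_def)
  have key: "\<exists>Bs. set Bs \<subseteq> \<B> \<and> lprod xs \<in> sprod Bs \<and> sprod Bs \<subseteq> W"
    if "openin T W" "lprod xs \<in> W" "set xs \<subseteq> L" for xs W
    using that
  proof (induction xs arbitrary: W)
    case Nil
    then show ?case by (intro exI[of _ "[]"]) (auto simp: sprod_simps)
  next
    case (Cons x xs)
    have cl: "x \<in> carrier G" "lprod xs \<in> carrier G"
      using Cons.prems(3) \<open>L \<subseteq> carrier G\<close> by auto
    have "x \<otimes> lprod xs \<in> W" using Cons.prems(2) by simp
    from Cons.prems(1) this cl show ?case
    proof (rule mult_nbhds)
      fix A C assume AC: "openin T A" "openin T C" "x \<in> A" "lprod xs \<in> C"
        "\<And>a b. a \<in> A \<Longrightarrow> b \<in> C \<Longrightarrow> a \<otimes> b \<in> W"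
      obtain Bs where Bs: "set Bs \<subseteq> \<B>" "lprod xs \<in> sprod Bs" "sprod Bs \<subseteq> C"
        using Cons.IH[OF AC(2,4)] Cons.prems(3) by auto
      obtain B where B: "B \<in> \<B>" "x \<in> B" "B \<subseteq> A"
        using net[OF AC(1,3)] Cons.prems(3) by auto
      have "sprod (B # Bs) \<subseteq> W"
        unfolding sprod_simps using AC(5) B(3) Bs(3) by auto
      moreover have "lprod (x # xs) \<in> sprod (B # Bs)"
        unfolding sprod_simps using B(2) Bs(2) by force
      ultimately show ?thesis
        using B(1) Bs(1) by (intro exI[of _ "B # Bs"]) auto
    qed
  qed
  have "countable (sprod ` lists \<B>)"
    using assms(1) by (intro countable_image countable_lists)
  moreover have "\<exists>N\<in>sprod ` lists \<B>. x \<in> N \<and> N \<subseteq> W" if W: "openin T W" and x: "x \<in> W" for W x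
  proof -
    have "x \<in> carrier G" using W x open_subset by blast
    then obtain xs where xs: "set xs \<subseteq> L" "x = lprod xs"
      using gen[of x] by blast
    obtain Bs where "set Bs \<subseteq> \<B>" "x \<in> sprod Bs" "sprod Bs \<subseteq> W"
      using key[OF W, of xs] x xs by blast
    then show ?thesis by (intro bexI[of _ "sprod Bs"]) auto
  qed
  ultimately show thesis by (rule that)
qed

end

lemma (in group) real_hom_simps:
  fixes H :: "'a \<Rightarrow> real"
  assumes H: "\<forall>x\<in>carrier G. \<forall>y\<in>carrier G. H (x \<otimes> y) = H x + H y" and x: "x \<in> carrier G"
  shows "H \<one> = 0" "H (inv x) = - H x" "H (x [^] (n::nat)) = real n * H x"
proof -
  have "H (\<one> \<otimes> \<one>) = H \<one> + H \<one>"
    using H by blast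
  then show one: "H \<one> = 0" by simp
  have "H (x \<otimes> inv x) = H x + H (inv x)"
    using H x by blast
  then show "H (inv x) = - H x" using x one by simp
  show "H (x [^] (n::nat)) = real n * H x"
    by (induction n) (use H x one in \<open>auto simp: algebra_simps\<close>)
qed

text \<open>When \<open>H\<close> is continuous on the generators, the topology it induces is
  admissible, hence coarser than the free topology. This is how homomorphisms into the reals become
  continuous on the free groups.\<close>

lemma (in group) group_topology_pullback:
  fixes H :: "'a \<Rightarrow> real"
  assumes H: "\<forall>x\<in>carrier G. \<forall>y\<in>carrier G. H (x \<otimes> y) = H x + H y"
  shows "group_topology (carrier G) (mult G) (m_inv G) (pullback_topology (carrier G) H euclideanreal)"
    (is "group_topology _ _ _ ?T")
  unfolding group_topology_def
proof (intro conjI)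
  show top: "topspace ?T = carrier G"
    by (simp add: topspace_pullback_topology)
  have HT: "continuous_map ?T euclideanreal H"
    using continuous_map_pullback[OF continuous_map_id, of "carrier G" H] by simp
  show "continuous_map (prod_topology ?T ?T) ?T (\<lambda>(x, y). x \<otimes> y)"
  proof (rule continuous_map_pullback')
    have "continuous_map (prod_topology ?T ?T) euclideanreal (\<lambda>z. H (fst z) + H (snd z))"
      using continuous_map_compose[OF continuous_map_fst HT] continuous_map_compose[OF continuous_map_snd HT]
      by (intro continuous_map_add) (simp_all add: o_def)
    then show "continuous_map (prod_topology ?T ?T) euclideanreal (H \<circ> (\<lambda>(x, y). x \<otimes> y))"
      by (rule continuous_map_eq) (auto simp: top H)
  qed (auto simp: top)
  show "continuous_map ?T ?T (m_inv G)"
  proof (rule continuous_map_pullback')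
    show "continuous_map ?T euclideanreal (H \<circ> m_inv G)"
      by (rule continuous_map_eq[OF continuous_map_minus[OF HT]]) (auto simp: top real_hom_simps[OF H])
  qed (auto simp: top)
qed

text \<open>The hypothesis \<open>ext\<close> lets one argument serve all three free objects. As
  \<open>h a = 0\<close>, the extension takes the value \<open>2 ^ n * h (s i)\<close> on the power
  with exponent \<open>2 ^ n\<close>, so the set where \<open>\<bar>H g\<bar> < 1\<close> excludes
  that power for \<open>i\<close> below the given bound.\<close>

lemma (in mk_space) dfrak_le_character_free:
  fixes ins :: "'a \<Rightarrow> 'g" and G (structure)
  assumes "top_group G T" and ins: "continuous_map X T ins"
    and "X \<noteq> discrete_topology (topspace X)"
    and ext: "\<And>h. continuous_map X euclideanreal h \<Longrightarrow>
      \<exists>H. (\<forall>x\<in>carrier G. \<forall>y\<in>carrier G. H (x \<otimes> y) = H x + H y) \<and>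
        (\<forall>x\<in>topspace X. H (ins x) = h x) \<and> openin T {g \<in> carrier G. \<bar>H g\<bar> < (1::real)}"
    and "char_le T C"
  shows "|dfrak| \<le>o |C|"
proof -
  interpret top_group G T by fact
  have ins_closed: "ins x \<in> carrier G" if "x \<in> topspace X" for x
    using ins that topspace_eq by (auto simp: continuous_map_def)
  show ?thesis
  proof (rule nonisolated_sequence[OF assms(3)])
    fix m a s assume s: "a \<in> K m" "\<And>i. s i \<in> K m" "\<And>i. s i \<noteq> a" "\<And>i. d m a (s i) < 1 / (real i + 1)"
    have top: "a \<in> topspace X" "s i \<in> topspace X" for i
      using s K_topspace by blast+
    let ?u = "\<lambda>n i. (inv (ins a) \<otimes> ins (s i)) [^] (2 ^ n :: nat)"
    show ?thesis
    proof (rule dfrak_le_character[of \<one> T C ?u])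
      fix W n assume "nbhd T \<one> W"
      then obtain W' where W': "openin T W'" "\<one> \<in> W'" "W' \<subseteq> W"
        unfolding nbhd_def by blast
      obtain V where V: "openin T V" "\<one> \<in> V" "\<forall>x\<in>V. x [^] (2 ^ n :: nat) \<in> W'"
        using pow2_nbhd[OF W'(1,2), of n] by (elim exE conjE) (rule that)
      obtain k where "\<forall>(x, y)\<in>E m k. inv (ins x) \<otimes> ins y \<in> V"
        using E_uniform_group[OF assms(1) ins V(1,2)] by (rule exE)
      moreover have "(a, s k) \<in> E m k"
        using s by (intro E_I)
      ultimately have "inv (ins a) \<otimes> ins (s k) \<in> V" by blast
      then have "?u n k \<in> W" using V(3) W'(3) by blast
      then show "\<exists>i. ?u n i \<in> W" by (rule exI)
    next
      fix g :: "nat \<Rightarrow> nat"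
      show "\<exists>W. nbhd T \<one> W \<and> (\<forall>n i. ?u n i \<in> W \<longrightarrow> g n \<le> i)"
      proof (rule slowly_vanishing_function[OF s(1-3), of g])
        fix h assume h: "continuous_map X euclideanreal h" "h a = 0" "\<And>n i. i < g n \<Longrightarrow> 1 \<le> 2 ^ n * h (s i)"
        obtain H where H: "\<forall>x\<in>carrier G. \<forall>y\<in>carrier G. H (x \<otimes> y) = H x + H y"
          "\<forall>x\<in>topspace X. H (ins x) = h x" "openin T {g \<in> carrier G. \<bar>H g\<bar> < 1}"
          using ext[OF h(1)] by (elim exE conjE) (rule that)
        note H_simps = real_hom_simps[OF H(1)]
        have "H (?u n i) = 2 ^ n * h (s i)" for n i
        proof -
          have "H (inv (ins a) \<otimes> ins (s i)) = h (s i)"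
            using H(1,2) top ins_closed h(2) H_simps(2) by simp
          then show ?thesis
            using top ins_closed H_simps(3) by simp
        qed
        then have "g n \<le> i" if "?u n i \<in> {g \<in> carrier G. \<bar>H g\<bar> < 1}" for n i
          using h(3)[of i n] that by force
        moreover have "nbhd T \<one> {g \<in> carrier G. \<bar>H g\<bar> < 1}"
          using H(3) H_simps(1)[OF one_closed] openin_subset[OF H(3)] unfolding nbhd_def
          by (intro exI[of _ "{g \<in> carrier G. \<bar>H g\<bar> < 1}"]) auto
        ultimately show ?thesis by blast
      qed
    qed (use topspace_eq assms(5) in auto)
  qed
qed

text \<open>The intervals are collapsed one after another. The induction also carries monotonicity
  and the Lipschitz constant 1, so that the image of the next interval is no longer than the
  interval and collapsing it costs at most \<open>\<bar>a - b\<bar>\<close>.\<close>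

lemma collapse_intervals:
  fixes es :: "(real \<times> real) list"
  obtains \<psi> :: "real \<Rightarrow> real" where "\<And>a b. (a, b) \<in> set es \<Longrightarrow> \<psi> a = \<psi> b"
    "\<And>s t. s \<le> t \<Longrightarrow> t - s - (\<Sum>(a, b)\<leftarrow>es. \<bar>a - b\<bar>) \<le> \<psi> t - \<psi> s"
proof -
  have "\<exists>\<psi>. (\<forall>(a, b)\<in>set es. \<psi> a = \<psi> b) \<and>
    (\<forall>s t. s \<le> t \<longrightarrow> \<psi> s \<le> \<psi> t \<and> \<psi> t - \<psi> s \<le> t - s \<and> t - s - (\<Sum>(a, b)\<leftarrow>es. \<bar>a - b\<bar>) \<le> \<psi> t - \<psi> s)"
  proof (induction es)
    case Nil
    show ?case by (intro exI[of _ "\<lambda>t. t"]) auto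
  next
    case (Cons e es)
    then obtain \<psi> where \<psi>: "\<forall>(a, b)\<in>set es. \<psi> a = \<psi> b"
      "\<And>s t. s \<le> t \<Longrightarrow> \<psi> s \<le> \<psi> t \<and> \<psi> t - \<psi> s \<le> t - s \<and> t - s - (\<Sum>(a, b)\<leftarrow>es. \<bar>a - b\<bar>) \<le> \<psi> t - \<psi> s"
      by blast
    obtain a b where e: "e = (a, b)" by (cases e)
    define A where "A = \<psi> (min a b)"
    define B where "B = \<psi> (max a b)"
    have AB: "A \<le> B" "B - A \<le> \<bar>a - b\<bar>"
      unfolding A_def B_def using \<psi>(2)[of "min a b" "max a b"] by (auto simp: min_def max_def)
    \<comment> \<open>The identity below \<open>A\<close>, constant between \<open>A\<close> and
      \<open>B\<close>, and a shift by \<open>B - A\<close> above \<open>B\<close>.\<close>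
    define c where "c u = min u (max A (u - (B - A)))" for u
    have c: "c u \<le> c v" "c v - c u \<le> v - u" "v - u - (B - A) \<le> c v - c u" if "u \<le> v" for u v
      unfolding c_def using that AB(1) by (auto simp: min_def max_def)
    have "c (\<psi> a) = c (\<psi> b)"
      unfolding c_def A_def B_def using AB(1) unfolding A_def B_def
      by (cases "a \<le> b") (auto simp: min_def max_def)
    then have "\<forall>(a, b)\<in>set (e # es). (c \<circ> \<psi>) a = (c \<circ> \<psi>) b"
      using \<psi>(1) e by auto
    moreover have "(c \<circ> \<psi>) s \<le> (c \<circ> \<psi>) t \<and> (c \<circ> \<psi>) t - (c \<circ> \<psi>) s \<le> t - s \<and>
        t - s - (\<Sum>(a, b)\<leftarrow>e # es. \<bar>a - b\<bar>) \<le> (c \<circ> \<psi>) t - (c \<circ> \<psi>) s" if "s \<le> t" for s t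
      using \<psi>(2)[OF that] c[of "\<psi> s" "\<psi> t"] AB(2) e by auto
    ultimately show ?case by blast
  qed
  then show thesis using that by blast
qed

section \<open>The topology of groups generated by a copy of the space\<close>

text \<open>The algebra that A(X) and F(X) share. \<open>real_hom\<close> is required for every
  function \<open>h\<close>, continuous or not; continuity of the extension is derived later from
  the topology.\<close>

locale mk_free = mk_space X K d + group G
  for X :: "'a topology" and K and d and G :: "('g, 'm) monoid_scheme" (structure) +
  fixes ins :: "'a \<Rightarrow> 'g"
  assumes ins_closed: "x \<in> topspace X \<Longrightarrow> ins x \<in> carrier G"
    and generated: "g \<in> carrier G \<Longrightarrow>
      \<exists>xs. set xs \<subseteq> ins ` topspace X \<union> (\<lambda>x. inv (ins x)) ` topspace X \<and> g = lprod xs"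
    and real_hom: "\<exists>H. (\<forall>x\<in>carrier G. \<forall>y\<in>carrier G. H (x \<otimes> y) = H x + H y) \<and>
      (\<forall>x\<in>topspace X. H (ins x) = (h x :: real))"
begin

definition letters :: "'a set \<Rightarrow> 'g set" where
  "letters A = ins ` A \<union> (\<lambda>x. inv (ins x)) ` A"

lemma letters_closed: "A \<subseteq> topspace X \<Longrightarrow> letters A \<subseteq> carrier G"
  unfolding letters_def using ins_closed by auto

lemma letters_mono: "A \<subseteq> B \<Longrightarrow> letters A \<subseteq> letters B"
  unfolding letters_def by blast

text \<open>Alphabet and length are bounded by the same number, so that these sets increase to the
  whole group and multiplying by an element of \<open>words m\<close> leads from
  \<open>words n\<close> into \<open>words (n + m)\<close>.\<close>

definition words :: "nat \<Rightarrow> 'g set" where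
  "words n = {lprod xs | xs. set xs \<subseteq> letters (K n) \<and> length xs \<le> n}"

definition P :: "nat \<Rightarrow> nat \<Rightarrow> 'g set" where
  "P n k = {h \<otimes> (inv (ins x) \<otimes> ins y) \<otimes> inv h | h x y. h \<in> words n \<and> (x, y) \<in> E n k}"

lemma one_words: "\<one> \<in> words n"
  unfolding words_def by (intro CollectI exI[of _ "[]"]) auto

lemma words_closed: "words n \<subseteq> carrier G"
  unfolding words_def using letters_closed[OF K_topspace] lprod_closed by blast

lemma words_mono: "n \<le> m \<Longrightarrow> words n \<subseteq> words m"
proof
  fix g assume nm: "n \<le> m" and "g \<in> words n"
  then obtain xs where "set xs \<subseteq> letters (K n)" "length xs \<le> n" "g = lprod xs"
    unfolding words_def by blast
  then show "g \<in> words m"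
    unfolding words_def using letters_mono[OF K_mono[OF nm]] nm by (intro CollectI exI[of _ xs]) auto
qed

lemma words_mult:
  assumes "g \<in> words m" "h \<in> words n"
  shows "g \<otimes> h \<in> words (n + m)"
proof -
  obtain xs ys where xs: "set xs \<subseteq> letters (K m)" "length xs \<le> m" "g = lprod xs"
    and ys: "set ys \<subseteq> letters (K n)" "length ys \<le> n" "h = lprod ys"
    using assms unfolding words_def by blast
  have "set xs \<subseteq> carrier G" "set ys \<subseteq> carrier G"
    using xs ys letters_closed[OF K_topspace] by blast+
  then have "g \<otimes> h = lprod (xs @ ys)"
    using xs ys by (simp add: lprod_append)
  moreover have "set (xs @ ys) \<subseteq> letters (K (n + m))"
    using xs ys letters_mono[OF K_mono[of m "n + m"]] letters_mono[OF K_mono[of n "n + m"]] by auto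
  ultimately show ?thesis
    unfolding words_def using xs ys by (intro CollectI exI[of _ "xs @ ys"]) auto
qed

lemma words_exhaust: "g \<in> carrier G \<Longrightarrow> \<exists>n. g \<in> words n"
proof -
  assume "g \<in> carrier G"
  then obtain xs where xs: "set xs \<subseteq> letters (topspace X)" "g = lprod xs"
    using generated unfolding letters_def by blast
  have "\<exists>m. set xs \<subseteq> letters (K m)"
    using xs(1)
  proof (induction xs)
    case (Cons x xs)
    then obtain m where m: "set xs \<subseteq> letters (K m)" by auto
    have "\<exists>n. x \<in> letters (K n)"
      using Cons.prems unfolding letters_def K_Union[symmetric] by auto
    then obtain n where "x \<in> letters (K n)" ..
    then have "set (x # xs) \<subseteq> letters (K (max m n))"
      using m letters_mono[OF K_mono[of m "max m n"]] letters_mono[OF K_mono[of n "max m n"]] by auto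
    then show ?case ..
  qed simp
  then obtain m where m: "set xs \<subseteq> letters (K m)" ..
  have "g \<in> words (max m (length xs))"
    unfolding words_def using xs(2) m letters_mono[OF K_mono[of m "max m (length xs)"]]
    by (intro CollectI exI[of _ xs]) auto
  then show ?thesis ..
qed

lemma P_E:
  assumes "z \<in> P n k"
  obtains h x y where "z = h \<otimes> (inv (ins x) \<otimes> ins y) \<otimes> inv h" "h \<in> words n" "(x, y) \<in> E n k"
    "h \<in> carrier G" "ins x \<in> carrier G" "ins y \<in> carrier G"
proof -
  obtain h x y where *: "z = h \<otimes> (inv (ins x) \<otimes> ins y) \<otimes> inv h" "h \<in> words n" "(x, y) \<in> E n k"
    using assms unfolding P_def by blast
  show thesis
    by (rule that[OF *]) (use * words_closed E_topspace ins_closed in blast)+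
qed

lemma P_I: "h \<in> words n \<Longrightarrow> (x, y) \<in> E n k \<Longrightarrow> h \<otimes> (inv (ins x) \<otimes> ins y) \<otimes> inv h \<in> P n k"
  unfolding P_def by blast

text \<open>Inverting a factor swaps the two points of its pair, whence the symmetry of
  \<open>E\<close>. Conjugating it by an element of \<open>words m\<close> lengthens the conjugator
  and leaves the pair alone.\<close>

sublocale group_product_base G P
proof
  show "P n k \<subseteq> carrier G" for n k
    by (auto elim!: P_E)
  show "inv z \<in> P n k" if "z \<in> P n k" for z n k
    using that
  proof (rule P_E)
    fix h x y assume *: "z = h \<otimes> (inv (ins x) \<otimes> ins y) \<otimes> inv h" "h \<in> words n" "(x, y) \<in> E n k"
      "h \<in> carrier G" "ins x \<in> carrier G" "ins y \<in> carrier G"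
    then have "inv z = h \<otimes> (inv (ins y) \<otimes> ins x) \<otimes> inv h"
      by (simp add: inv_mult_group m_assoc)
    then show ?thesis
      using P_I[OF *(2) E_sym[OF *(3)]] by simp
  qed
  show "P n k \<subseteq> P m k" if "n \<le> m" for n m k
    unfolding P_def using words_mono[OF that] E_mono[OF that] by blast
  show "P n l \<subseteq> P n k" if "k \<le> l" for n k l
    unfolding P_def using E_antimono[OF that] by blast
  show "\<exists>m. \<forall>n k. \<forall>z\<in>P n k. g \<otimes> z \<otimes> inv g \<in> P (n + m) k" if g: "g \<in> carrier G" for g
  proof -
    obtain m where m: "g \<in> words m"
      using words_exhaust[OF g] ..
    have "g \<otimes> z \<otimes> inv g \<in> P (n + m) k" if "z \<in> P n k" for n k z
      using that
    proof (rule P_E)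
      fix h x y assume *: "z = h \<otimes> (inv (ins x) \<otimes> ins y) \<otimes> inv h" "h \<in> words n" "(x, y) \<in> E n k"
        "h \<in> carrier G" "ins x \<in> carrier G" "ins y \<in> carrier G"
      then have "g \<otimes> z \<otimes> inv g = (g \<otimes> h) \<otimes> (inv (ins x) \<otimes> ins y) \<otimes> inv (g \<otimes> h)"
        using \<open>g \<in> carrier G\<close> by (simp add: inv_mult_group m_assoc)
      then show ?thesis
        using P_I[OF words_mult[OF m *(2)] subsetD[OF E_mono *(3)]] by simp
    qed
    then show ?thesis by blast
  qed
qed

lemma continuous_ins: "continuous_map X base_topology ins"
proof (rule continuous_into_base_topology[OF group_nbhd_base_axioms ins_closed])
  fix n \<alpha>
  have "inv (ins x) \<otimes> ins y \<in> prod_nbhd \<alpha>" if "(x, y) \<in> E n (\<alpha> n)" for x y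
  proof -
    have "\<one> \<otimes> (inv (ins x) \<otimes> ins y) \<otimes> inv \<one> \<in> prod_nbhd \<alpha>"
      using P_I[OF one_words that] P_subset_prod_nbhd by blast
    then show ?thesis
      using E_topspace[OF that] ins_closed by simp
  qed
  then show "\<exists>k. \<forall>(x, y)\<in>E n k. inv (ins x) \<otimes> ins y \<in> prod_nbhd \<alpha>" by blast
qed

text \<open>Induction on the length, conjugating by one letter at a time: the letters over
  \<open>K n\<close> form a compact set in \<open>T\<close>, as the union of the image of
  \<open>K n\<close> and its inverse.\<close>

lemma conj_words_nbhd:
  assumes "top_group G T" and ins: "continuous_map X T ins" and "openin T W" and "\<one> \<in> W"
  shows "\<exists>V. openin T V \<and> \<one> \<in> V \<and>
    (\<forall>xs. set xs \<subseteq> letters (K n) \<longrightarrow> length xs \<le> m \<longrightarrow> (\<forall>x\<in>V. lprod xs \<otimes> x \<otimes> inv (lprod xs) \<in> W))"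
  using assms(3,4)
proof (induction m arbitrary: W)
  case 0
  interpret T: top_group G T by fact
  show ?case
    using 0 subsetD[OF T.open_subset[OF 0(1)]] by (intro exI[of _ W]) auto
next
  case (Suc m)
  interpret T: top_group G T by fact
  have "compactin T (ins ` K n)"
    by (rule image_compactin[OF K_compact ins])
  moreover from this have "compactin T (m_inv G ` ins ` K n)"
    using T.group_topology by (auto intro: image_compactin simp: group_topology_def)
  ultimately have comp: "compactin T (letters (K n))"
    unfolding letters_def by (auto simp: image_image intro: compactin_Un)
  show ?case
  proof (rule T.compact_conj_nbhd[OF Suc.prems comp])
    fix V0 assume V0: "openin T V0" "\<one> \<in> V0"
      "\<And>g x. g \<in> letters (K n) \<Longrightarrow> x \<in> V0 \<Longrightarrow> g \<otimes> x \<otimes> inv g \<in> W"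
    obtain V where V: "openin T V" "\<one> \<in> V" "\<forall>xs. set xs \<subseteq> letters (K n) \<longrightarrow> length xs \<le> m \<longrightarrow>
        (\<forall>x\<in>V. lprod xs \<otimes> x \<otimes> inv (lprod xs) \<in> V0)"
      using Suc.IH[OF V0(1,2)] by (elim exE conjE) (rule that)
    \<comment> \<open>Restricting \<open>x\<close> to \<open>W\<close> as well takes care of the
      empty word.\<close>
    have "lprod xs \<otimes> x \<otimes> inv (lprod xs) \<in> W"
      if xs: "set xs \<subseteq> letters (K n)" "length xs \<le> Suc m" and x: "x \<in> V \<inter> W" for xs x
    proof (cases xs)
      case Nil
      then show ?thesis using x T.open_subset[OF V(1)] by auto
    next
      case (Cons l ls)
      have cl: "l \<in> carrier G" "lprod ls \<in> carrier G" "x \<in> carrier G"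
        using Cons xs(1) letters_closed[OF K_topspace, of n] x T.open_subset[OF V(1)] by auto
      have "lprod ls \<otimes> x \<otimes> inv (lprod ls) \<in> V0"
        using V(3) Cons xs x by simp
      then have "l \<otimes> (lprod ls \<otimes> x \<otimes> inv (lprod ls)) \<otimes> inv l \<in> W"
        using V0(3) Cons xs(1) by simp
      moreover have "l \<otimes> (lprod ls \<otimes> x \<otimes> inv (lprod ls)) \<otimes> inv l
          = (l \<otimes> lprod ls) \<otimes> x \<otimes> inv (l \<otimes> lprod ls)"
        using cl by (simp add: inv_mult_group m_assoc)
      ultimately show ?thesis using Cons by simp
    qed
    then show ?thesis
      using V Suc.prems by (intro exI[of _ "V \<inter> W"]) auto
  qed
qed

lemma P_small:
  assumes "top_group G T" and "continuous_map X T ins" and "openin T W" and "\<one> \<in> W"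
  shows "\<exists>k. P n k \<subseteq> W"
proof -
  obtain V where V: "openin T V" "\<one> \<in> V" "\<forall>xs. set xs \<subseteq> letters (K n) \<longrightarrow> length xs \<le> n \<longrightarrow>
      (\<forall>x\<in>V. lprod xs \<otimes> x \<otimes> inv (lprod xs) \<in> W)"
    using conj_words_nbhd[OF assms, of n n] by (elim exE conjE) (rule that)
  obtain k where k: "\<forall>(x, y)\<in>E n k. inv (ins x) \<otimes> ins y \<in> V"
    using E_uniform_group[OF assms(1,2) V(1,2)] by (rule exE)
  have "P n k \<subseteq> W"
    unfolding P_def words_def using V(3) k by auto
  then show ?thesis ..
qed

text \<open>\<open>continuous_ins\<close> makes the constructed topology admissible;
  \<open>P_small\<close> and \<open>prod_nbhd_small\<close> fit some \<open>prod_nbhd\<close> into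
  every unit neighbourhood of any other admissible topology.\<close>

theorem free_topology_eq:
  "sup_topology (carrier G) (\<lambda>T. group_topology (carrier G) (mult G) (m_inv G) T \<and> continuous_map X T ins)
    = base_topology"
proof (rule sup_topology_eq_greatest)
  show "group_topology (carrier G) (mult G) (m_inv G) base_topology \<and> continuous_map X base_topology ins"
    using group_topology_base_topology continuous_ins by blast
  fix T U assume T: "group_topology (carrier G) (mult G) (m_inv G) T \<and> continuous_map X T ins"
    and U: "openin T U"
  then have "top_group G T"
    by unfold_locales blast
  then have "\<exists>k. P n k \<subseteq> W" if "openin T W" "\<one> \<in> W" for n W
    using P_small T that by blast
  then show "openin base_topology U"
    using base_topology_finest[OF conjunct1[OF T] prod_nbhd_small[OF conjunct1[OF T]] U] by blast
qed simp

lemma base_topology_finer: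
  assumes "group_topology (carrier G) (mult G) (m_inv G) T" and "continuous_map X T ins" and "openin T U"
  shows "openin base_topology U"
  unfolding free_topology_eq[symmetric] sup_topology_def
  by (rule topology_generated_by_Basis) (use assms in blast)

sublocale base: top_group G base_topology
  by unfold_locales (rule group_topology_base_topology)

lemma real_hom_open:
  fixes H :: "'g \<Rightarrow> real"
  assumes H: "\<forall>x\<in>carrier G. \<forall>y\<in>carrier G. H (x \<otimes> y) = H x + H y"
    and "continuous_map X euclideanreal (H \<circ> ins)"
  shows "openin base_topology {g \<in> carrier G. \<bar>H g\<bar> < \<epsilon>}"
proof (rule base_topology_finer[OF group_topology_pullback[OF H]])
  show "continuous_map X (pullback_topology (carrier G) H euclideanreal) ins"
    by (rule continuous_map_pullback') (use assms(2) ins_closed in auto)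
  show "openin (pullback_topology (carrier G) H euclideanreal) {g \<in> carrier G. \<bar>H g\<bar> < \<epsilon>}"
    unfolding openin_pullback_topology
    by (rule exI[of _ "{-\<epsilon><..<\<epsilon>}"]) auto
qed

lemma real_hom_continuous:
  assumes "continuous_map X euclideanreal h"
  shows "\<exists>H. (\<forall>x\<in>carrier G. \<forall>y\<in>carrier G. H (x \<otimes> y) = H x + H y) \<and>
      (\<forall>x\<in>topspace X. H (ins x) = h x) \<and> openin base_topology {g \<in> carrier G. \<bar>H g\<bar> < (1::real)}"
proof -
  obtain H where H: "\<forall>x\<in>carrier G. \<forall>y\<in>carrier G. H (x \<otimes> y) = H x + H y" "\<forall>x\<in>topspace X. H (ins x) = h x"
    using real_hom[of h] by blast
  have "continuous_map X euclideanreal (H \<circ> ins)"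
    by (rule continuous_map_eq[OF assms]) (use H in auto)
  then show ?thesis
    using H real_hom_open[OF H(1)] by blast
qed

lemma separated_by_real_hom:
  fixes H :: "'g \<Rightarrow> real"
  assumes H: "\<forall>x\<in>carrier G. \<forall>y\<in>carrier G. H (x \<otimes> y) = H x + H y"
    and "continuous_map X euclideanreal (H \<circ> ins)" and "H g \<noteq> 0"
  shows "\<exists>\<alpha>. g \<notin> prod_nbhd \<alpha>"
proof -
  let ?W = "{x \<in> carrier G. \<bar>H x\<bar> < \<bar>H g\<bar>}"
  have "openin base_topology ?W" "\<one> \<in> ?W"
    using real_hom_open[OF H assms(2)] real_hom_simps(1)[OF H one_closed] assms(3) by auto
  then obtain \<alpha> where "\<forall>u\<in>prod_nbhd \<alpha>. \<one> \<otimes> u \<in> ?W"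
    unfolding openin_base_topology by blast
  then have "g \<notin> prod_nbhd \<alpha>"
    using U_closed by auto
  then show ?thesis by (rule exI[of _ \<alpha>])
qed

lemma P0_space_free:
  assumes "\<And>g. g \<in> carrier G \<Longrightarrow> g \<noteq> \<one> \<Longrightarrow> \<exists>\<alpha>. g \<notin> prod_nbhd \<alpha>"
  shows "P0_space base_topology"
proof (rule countable_network)
  fix \<B> assume \<B>: "countable \<B>"
    "\<And>W x. openin X W \<Longrightarrow> x \<in> W \<Longrightarrow> \<exists>B\<in>\<B>. x \<in> B \<and> B \<subseteq> W"
  let ?L = "(\<lambda>B. ins ` B) ` \<B> \<union> (\<lambda>B. (\<lambda>x. inv (ins x)) ` B) ` \<B>"
  have net: "\<exists>B\<in>\<B>. x \<in> B \<and> f ` B \<subseteq> W"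
    if f: "continuous_map X base_topology f" and x: "x \<in> topspace X" and W: "openin base_topology W" "f x \<in> W" for f x W
  proof -
    have "openin X {x \<in> topspace X. f x \<in> W}"
      using openin_continuous_map_preimage[OF f W(1)] .
    then show ?thesis
      using \<B>(2)[of "{x \<in> topspace X. f x \<in> W}" x] x W(2) by blast
  qed
  have cont_inv: "continuous_map X base_topology (\<lambda>x. inv (ins x))"
    using continuous_map_compose[OF continuous_ins continuous_inv] by (simp add: o_def)
  show ?thesis
  proof (rule base.countable_network_products[where \<B> = ?L and L = "letters (topspace X)"])
    show "countable ?L" using \<B>(1) by auto
    show "letters (topspace X) \<subseteq> carrier G"
      by (rule letters_closed) simp
    show "\<exists>xs. set xs \<subseteq> letters (topspace X) \<and> g = lprod xs" if "g \<in> carrier G" for g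
      using generated[OF that] unfolding letters_def .
    fix W l assume W: "openin base_topology W" "l \<in> W" "l \<in> letters (topspace X)"
    then consider x where "x \<in> topspace X" "l = ins x" | x where "x \<in> topspace X" "l = inv (ins x)"
      unfolding letters_def by blast
    then show "\<exists>B\<in>?L. l \<in> B \<and> B \<subseteq> W"
    proof cases
      case 1
      then show ?thesis using net[OF continuous_ins 1(1) W(1)] W(2) by blast
    next
      case 2
      then show ?thesis using net[OF cont_inv 2(1) W(1)] W(2) by blast
    qed
  qed (rule P0_space_base_topology[OF assms])
qed

lemma character_free_nondiscrete:
  assumes "X \<noteq> discrete_topology (topspace X)"
  shows "character_eq base_topology dfrak"
  unfolding character_eq_def
proof (intro conjI allI impI)
  fix C :: "'g set set set" assume "char_le base_topology C"
  with base.top_group_axioms continuous_ins assms _ show "|dfrak| \<le>o |C|"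
    by (rule dfrak_le_character_free) (use real_hom_continuous in blast)
qed (rule char_le_dfrak)

text \<open>Over a discrete space the discrete group topology is admissible, so the free topology is
  discrete and one set suffices at each point; conversely a base at a point is never empty.\<close>

lemma character_free_discrete:
  assumes "X = discrete_topology (topspace X)"
  shows "character_eq base_topology {()}"
proof -
  have "continuous_map X (discrete_topology (carrier G)) ins"
    by (subst assms) (use ins_closed in \<open>auto simp: continuous_map\<close>)
  moreover have "group_topology (carrier G) (mult G) (m_inv G) (discrete_topology (carrier G))"
    by (auto simp: group_topology_def prod_topology_discrete_topology[symmetric] continuous_map)
  ultimately have op: "openin base_topology {x}" if "x \<in> carrier G" for x
    using base_topology_finer[of "discrete_topology (carrier G)" "{x}"] that by simp
  show ?thesis
    unfolding character_eq_def
  proof (intro conjI allI impI)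
    show "char_le base_topology {()}"
      unfolding char_le_def
    proof
      fix x assume x: "x \<in> topspace base_topology"
      then have "nbhd_base base_topology x {{x}}"
        unfolding nbhd_base_def nbhd_def using op[of x] by (auto intro!: exI[of _ "{x}"])
      moreover have "|{{x}}| \<le>o |{()}|"
        by (rule card_of_singl_ordLeq) simp
      ultimately show "\<exists>B. nbhd_base base_topology x B \<and> |B| \<le>o |{()}|" by blast
    qed
    fix C :: "'g set set set" assume "char_le base_topology C"
    then obtain B where B: "nbhd_base base_topology \<one> B" "|B| \<le>o |C|"
      unfolding char_le_def by auto
    have "B \<noteq> {}"
      using B(1) U_nbhd unfolding nbhd_base_def by blast
    then have "|{()}| \<le>o |B|"
      by (rule card_of_singl_ordLeq)
    then show "|{()}| \<le>o |C|"
      using B(2) by (rule ordLeq_transitive)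
  qed
qed

text \<open>The neighbourhood is chosen so that the \<open>f\<close>-lengths of all pairs \<open>(x, y)\<close> occurring in a product
  add up to less than \<open>1\<close>, the minimal distance between points of \<open>f ` S\<close>.  Collapsing the corresponding
  intervals keeps \<open>S\<close> separated and gives an endomorphism killing the product.\<close>

lemma separated_by_endomorphisms:
  assumes g: "g \<in> carrier G" "g \<noteq> \<one>" and S: "finite S" "S \<subseteq> topspace X"
    and endo: "\<And>\<phi>. (\<And>x. x \<in> topspace X \<Longrightarrow> \<phi> x \<in> carrier G) \<Longrightarrow> (\<And>s. s \<in> S \<Longrightarrow> \<phi> s = ins s) \<Longrightarrow>
      \<exists>\<Phi>. \<Phi> \<in> hom G G \<and> (\<forall>x\<in>topspace X. \<Phi> (ins x) = \<phi> x) \<and> \<Phi> g = g"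
  shows "\<exists>\<alpha>. g \<notin> prod_nbhd \<alpha>"
proof -
  obtain f0 :: "'a \<Rightarrow> nat" where f0: "inj_on f0 S"
    using finite_imp_inj_to_nat_seg[OF S(1)] by blast
  obtain f where f: "continuous_map X euclideanreal f" "\<And>x. x \<in> S \<Longrightarrow> f x = real (f0 x)"
    by (rule interpolating_function[OF S, of "\<lambda>x. real (f0 x)"]) (rule that)
  \<comment> \<open>As the levels in a product are distinct, these tolerances add up to at most 1/2,
    half the least possible gap between distinct integers \<open>f s\<close>.\<close>
  have "\<exists>k. \<forall>(x, y)\<in>E n k. \<bar>f x - f y\<bar> < (1/2) ^ (n + 2)" for n
    by (rule E_uniform_real[OF f(1)]) simp
  then have "\<exists>\<alpha>. \<forall>n. \<forall>(x, y)\<in>E n (\<alpha> n). \<bar>f x - f y\<bar> < (1/2) ^ (n + 2)"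
    by (intro choice allI)
  then obtain \<alpha> where \<alpha>: "\<forall>n. \<forall>(x, y)\<in>E n (\<alpha> n). \<bar>f x - f y\<bar> < (1/2) ^ (n + 2)"
    by (rule exE)
  have "g \<notin> prod_nbhd \<alpha>"
  proof
    assume "g \<in> prod_nbhd \<alpha>"
    then show False
    proof (rule prod_nbhdE)
      fix zs assume zs: "distinct (map fst zs)" "\<And>z. z \<in> set zs \<Longrightarrow> snd z \<in> P (fst z) (\<alpha> (fst z))"
        "g = lprod (map snd zs)" "set (map snd zs) \<subseteq> carrier G"
      have "\<forall>z\<in>set zs. \<exists>h e. snd z = h \<otimes> (inv (ins (fst e)) \<otimes> ins (snd e)) \<otimes> inv h \<and>
          h \<in> carrier G \<and> e \<in> E (fst z) (\<alpha> (fst z))"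
      proof
        fix z assume "z \<in> set zs"
        from zs(2)[OF this] show "\<exists>h e. snd z = h \<otimes> (inv (ins (fst e)) \<otimes> ins (snd e)) \<otimes> inv h \<and>
          h \<in> carrier G \<and> e \<in> E (fst z) (\<alpha> (fst z))"
          by (rule P_E) (metis fst_conv snd_conv)
      qed
      then obtain h e where he: "\<And>z. z \<in> set zs \<Longrightarrow>
          snd z = h z \<otimes> (inv (ins (fst (e z))) \<otimes> ins (snd (e z))) \<otimes> inv (h z)"
        "\<And>z. z \<in> set zs \<Longrightarrow> h z \<in> carrier G" "\<And>z. z \<in> set zs \<Longrightarrow> e z \<in> E (fst z) (\<alpha> (fst z))"
        by metis
      let ?es = "map (\<lambda>z. (f (fst (e z)), f (snd (e z)))) zs"
      obtain \<psi> :: "real \<Rightarrow> real" where \<psi>: "\<And>a b. (a, b) \<in> set ?es \<Longrightarrow> \<psi> a = \<psi> b"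
        "\<And>s t. s \<le> t \<Longrightarrow> t - s - (\<Sum>(a, b)\<leftarrow>?es. \<bar>a - b\<bar>) \<le> \<psi> t - \<psi> s"
        by (rule collapse_intervals[of ?es]) (rule that)
      have "(\<Sum>(a, b)\<leftarrow>?es. \<bar>a - b\<bar>) \<le> (\<Sum>z\<leftarrow>zs. (1/2) ^ (fst z + 2))"
        unfolding map_map comp_def prod.case
        using \<alpha> he(3) by (intro sum_list_mono) (fastforce intro: less_imp_le)
      also have "\<dots> = (\<Sum>n\<leftarrow>map fst zs. (1/2) ^ (n + 2))"
        by (simp add: comp_def)
      also have "\<dots> = (\<Sum>n\<in>fst ` set zs. (1/2) ^ (n + 2))"
        using zs(1) by (subst sum_list_distinct_conv_sum_set) auto
      also have "\<dots> \<le> (\<Sum>n. (1/2) ^ (n + 2))"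
        by (intro sum_le_suminf) (auto simp: summable_geometric power_add intro!: summable_mult2)
      also have "\<dots> = 1/2"
        using suminf_geometric[of "1/2::real"] suminf_divide[of "\<lambda>n. (1/2::real) ^ n" 4]
        by (simp add: power_add summable_geometric)
      finally have small: "(\<Sum>(a, b)\<leftarrow>?es. \<bar>a - b\<bar>) \<le> 1/2" .
      have inj: "s = t" if st: "s \<in> S" "t \<in> S" "\<psi> (f s) = \<psi> (f t)" for s t
      proof (rule ccontr)
        assume "s \<noteq> t"
        then have "f0 s \<noteq> f0 t" using f0 st by (auto simp: inj_on_def)
        then have "1 \<le> \<bar>f s - f t\<bar>" using f(2)[OF st(1)] f(2)[OF st(2)] by linarith
        then show False
          using \<psi>(2)[of "f s" "f t"] \<psi>(2)[of "f t" "f s"] small st(3) by linarith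
      qed
      \<comment> \<open>\<open>\<phi>\<close> factors through \<open>\<psi> \<circ> f\<close> and
        thus identifies the two points of every pair in the product. Points that
        \<open>\<psi> \<circ> f\<close> identifies with no point of \<open>S\<close> go to the
        unit.\<close>
      define \<phi> where "\<phi> x = (if \<exists>s\<in>S. \<psi> (f x) = \<psi> (f s) then ins (THE s. s \<in> S \<and> \<psi> (f x) = \<psi> (f s)) else \<one>)" for x
      have \<phi>_eq: "\<phi> x = ins s" if "s \<in> S" "\<psi> (f x) = \<psi> (f s)" for x s
      proof -
        have "(THE s. s \<in> S \<and> \<psi> (f x) = \<psi> (f s)) = s"
          using that inj by (intro the_equality) auto
        then show ?thesis unfolding \<phi>_def using that by auto
      qed
      have "\<phi> x \<in> carrier G" for x
      proof (cases "\<exists>s\<in>S. \<psi> (f x) = \<psi> (f s)")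
        case True
        then obtain s where "s \<in> S" "\<psi> (f x) = \<psi> (f s)" by blast
        then show ?thesis using \<phi>_eq[of s x] S(2) ins_closed by auto
      qed (simp add: \<phi>_def)
      moreover have "\<phi> s = ins s" if "s \<in> S" for s
        using \<phi>_eq that by blast
      ultimately obtain \<Phi> where \<Phi>: "\<Phi> \<in> hom G G" "\<forall>x\<in>topspace X. \<Phi> (ins x) = \<phi> x" "\<Phi> g = g"
        using endo[of \<phi>] by blast
      interpret \<Phi>: group_hom G G \<Phi>
        by unfold_locales (rule \<Phi>(1))
      have "\<Phi> (snd z) = \<one>" if z: "z \<in> set zs" for z
      proof -
        have top: "fst (e z) \<in> topspace X" "snd (e z) \<in> topspace X"
          using E_topspace[of "fst (e z)" "snd (e z)"] he(3)[OF z] by auto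
        have "\<psi> (f (fst (e z))) = \<psi> (f (snd (e z)))"
          using z by (intro \<psi>(1)) auto
        then have "\<Phi> (ins (fst (e z))) = \<Phi> (ins (snd (e z)))"
          using \<Phi>(2) top by (simp add: \<phi>_def)
        then show ?thesis
          using he(1,2)[OF z] top ins_closed by simp
      qed
      then have "\<forall>x\<in>set (map snd zs). \<Phi> x = \<one>" by auto
      moreover have "\<Phi> (lprod xs) = \<one>" if "\<forall>x\<in>set xs. \<Phi> x = \<one>" "set xs \<subseteq> carrier G" for xs
        using that by (induction xs) auto
      ultimately have "\<Phi> g = \<one>"
        using zs(3,4) by blast
      then show False using \<Phi>(3) g(2) by simp
    qed
  qed
  then show ?thesis by (rule exI[of _ \<alpha>])
qed

end

section \<open>Free abelian and free topological groups\<close>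

lemma group_topology_cong:
  assumes "\<And>x. x \<in> C \<Longrightarrow> gi x = gi' x"
  shows "group_topology C gm gi T \<longleftrightarrow> group_topology C gm gi' T"
proof -
  have "continuous_map T T gi \<longleftrightarrow> continuous_map T T gi'" if "topspace T = C"
    using assms that by (intro iffI) (auto elim!: continuous_map_eq)
  then show ?thesis unfolding group_topology_def by blast
qed

section \<open>The free abelian group of integer-valued functions with finite support\<close>

definition fa_group :: "'a topology \<Rightarrow> ('a \<Rightarrow> int) monoid" where
  "fa_group X = \<lparr>carrier = fa_carrier X, mult = (\<lambda>f g y. f y + g y), one = (\<lambda>_. 0)\<rparr>"

lemma fa_group_simps [simp]:
  "carrier (fa_group X) = fa_carrier X" "mult (fa_group X) = (\<lambda>f g y. f y + g y)"
  "one (fa_group X) = (\<lambda>_. 0)"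
  by (simp_all add: fa_group_def)

lemma fa_carrier_uminus: "f \<in> fa_carrier X \<Longrightarrow> (\<lambda>y. - f y) \<in> fa_carrier X"
  by (simp add: fa_carrier_def)

lemma group_fa_group: "group (fa_group X)"
proof (rule groupI)
  fix f g assume "f \<in> carrier (fa_group X)" "g \<in> carrier (fa_group X)"
  moreover have "{x. f x + g x \<noteq> 0} \<subseteq> {x. f x \<noteq> 0} \<union> {x. g x \<noteq> 0}" by auto
  ultimately show "f \<otimes>\<^bsub>fa_group X\<^esub> g \<in> carrier (fa_group X)"
    by (auto simp: fa_carrier_def intro: finite_subset)
next
  fix f assume "f \<in> carrier (fa_group X)"
  then show "\<exists>g\<in>carrier (fa_group X). g \<otimes>\<^bsub>fa_group X\<^esub> f = \<one>\<^bsub>fa_group X\<^esub>"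
    using fa_carrier_uminus by (intro bexI[of _ "\<lambda>y. - f y"]) auto
qed (auto simp: fa_carrier_def add.assoc)

lemma fa_group_inv: "f \<in> fa_carrier X \<Longrightarrow> inv\<^bsub>fa_group X\<^esub> f = (\<lambda>y. - f y)"
  using group.inv_equality[OF group_fa_group, of X "\<lambda>y. - f y" f] fa_carrier_uminus by auto

lemma fa_ins_carrier: "x \<in> topspace X \<Longrightarrow> fa_ins x \<in> fa_carrier X"
  by (auto simp: fa_carrier_def fa_ins_def)

text \<open>Induction on the support: the value at one point is split off as
  \<open>\<bar>f x\<bar>\<close> copies of the letter \<open>l\<close>, which carries the sign of
  \<open>f x\<close>.\<close>

lemma fa_generated:
  assumes "finite S" "S \<subseteq> topspace X" "{x. f x \<noteq> 0} \<subseteq> S"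
  shows "\<exists>xs. set xs \<subseteq> fa_ins ` topspace X \<union> (\<lambda>x. inv\<^bsub>fa_group X\<^esub> (fa_ins x)) ` topspace X \<and>
    f = group.lprod (fa_group X) xs"
proof -
  interpret group "fa_group X" by (rule group_fa_group)
  show ?thesis
    using assms
  proof (induction S arbitrary: f rule: finite_induct)
    case empty
    then have "f = (\<lambda>_. 0)" by auto
    then show ?case by (intro exI[of _ "[]"]) auto
  next
    case (insert x S)
    let ?L = "fa_ins ` topspace X \<union> (\<lambda>x. inv\<^bsub>fa_group X\<^esub> (fa_ins x)) ` topspace X"
    have "{y. (f(x := 0)) y \<noteq> 0} \<subseteq> S" using insert.prems(2) by auto
    then obtain xs where xs: "set xs \<subseteq> ?L" "f(x := 0) = lprod xs"
      using insert.IH[of "f(x := 0)"] insert.prems(1) by blast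
    define l where "l = (if f x \<ge> 0 then fa_ins x else inv\<^bsub>fa_group X\<^esub> (fa_ins x))"
    have "lprod (replicate n l @ xs) = (\<lambda>y. int n * l y + lprod xs y)" for n
      by (induction n) (auto simp: algebra_simps)
    moreover have "int (nat \<bar>f x\<bar>) * l y + (f(x := 0)) y = f y" for y
      using fa_group_inv[OF fa_ins_carrier[of x X]] insert.prems(1) by (auto simp: l_def fa_ins_def)
    ultimately have "f = lprod (replicate (nat \<bar>f x\<bar>) l @ xs)"
      using xs(2) by (metis (no_types, lifting) ext)
    moreover have "set (replicate (nat \<bar>f x\<bar>) l @ xs) \<subseteq> ?L"
      using xs(1) insert.prems(1) by (auto simp: l_def)
    ultimately show ?case by blast
  qed
qed

lemma sum_support:
  fixes F :: "'a \<Rightarrow> 'b::zero \<Rightarrow> real"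
  assumes "finite S" "{x. f x \<noteq> 0} \<subseteq> S" "\<And>x. F x 0 = 0"
  shows "(\<Sum>x | f x \<noteq> 0. F x (f x)) = (\<Sum>x\<in>S. F x (f x))"
  using assms by (intro sum.mono_neutral_left) auto

lemma fa_real_hom:
  "\<forall>f\<in>fa_carrier X. \<forall>g\<in>fa_carrier X.
    (\<Sum>x | f x + g x \<noteq> 0. of_int (f x + g x) * h x) =
    (\<Sum>x | f x \<noteq> 0. of_int (f x) * h x) + (\<Sum>x | g x \<noteq> 0. of_int (g x) * (h x :: real))"
proof (intro ballI)
  fix f g assume "f \<in> fa_carrier X" "g \<in> fa_carrier X"
  then have fin: "finite ({x. f x \<noteq> 0} \<union> {x. g x \<noteq> 0})" by (simp add: fa_carrier_def)
  note sum = sum_support[OF fin, where F = "\<lambda>x c. of_int c * h x"]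
  have "(\<Sum>x | f x + g x \<noteq> 0. of_int (f x + g x) * h x)
      = (\<Sum>x\<in>{x. f x \<noteq> 0} \<union> {x. g x \<noteq> 0}. of_int (f x + g x) * h x)"
    by (rule sum) auto
  also have "\<dots> = (\<Sum>x\<in>{x. f x \<noteq> 0} \<union> {x. g x \<noteq> 0}. of_int (f x) * h x)
      + (\<Sum>x\<in>{x. f x \<noteq> 0} \<union> {x. g x \<noteq> 0}. of_int (g x) * h x)"
    by (simp add: sum.distrib algebra_simps)
  finally show "(\<Sum>x | f x + g x \<noteq> 0. of_int (f x + g x) * h x) =
    (\<Sum>x | f x \<noteq> 0. of_int (f x) * h x) + (\<Sum>x | g x \<noteq> 0. of_int (g x) * h x)"
    using sum[of f] sum[of g] by simp
qed

lemma fa_real_hom_ins: "(\<Sum>y | fa_ins x y \<noteq> 0. of_int (fa_ins x y) * h y) = (h x :: real)"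
  by (simp add: fa_ins_def)

lemma mk_free_fa:
  assumes "mk_space X K d"
  shows "mk_free X K d (fa_group X) fa_ins"
proof -
  interpret mk_space X K d by fact
  interpret group "fa_group X" by (rule group_fa_group)
  show ?thesis
  proof
    show "fa_ins x \<in> carrier (fa_group X)" if "x \<in> topspace X" for x
      using fa_ins_carrier[OF that] by simp
    show "\<exists>xs. set xs \<subseteq> fa_ins ` topspace X \<union> (\<lambda>x. inv\<^bsub>fa_group X\<^esub> (fa_ins x)) ` topspace X \<and> g = lprod xs"
      if "g \<in> carrier (fa_group X)" for g
      using that by (intro fa_generated[of "{x. g x \<noteq> 0}"]) (auto simp: fa_carrier_def)
    show "\<exists>H. (\<forall>x\<in>carrier (fa_group X). \<forall>y\<in>carrier (fa_group X). H (x \<otimes>\<^bsub>fa_group X\<^esub> y) = H x + H y) \<and>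
        (\<forall>x\<in>topspace X. H (fa_ins x) = h x)" for h :: "'a \<Rightarrow> real"
      using fa_real_hom[of X h] fa_real_hom_ins[of _ h]
      by (intro exI[of _ "\<lambda>f. \<Sum>x | f x \<noteq> 0. of_int (f x) * h x"]) simp
  qed
qed

theorem free_abelian_top_group_properties:
  assumes "mk_space X K d"
  shows "has_G_base_D (free_abelian_top_group X) (\<lambda>_. 0)"
    and "P0_space (free_abelian_top_group X)"
    and "X \<noteq> discrete_topology (topspace X) \<Longrightarrow> character_eq (free_abelian_top_group X) dfrak"
    and "X = discrete_topology (topspace X) \<Longrightarrow> character_eq (free_abelian_top_group X) {()}"
proof -
  interpret mk_free X K d "fa_group X" fa_ins
    by (rule mk_free_fa[OF assms])
  have "group_topology (fa_carrier X) (\<lambda>f g y. f y + g y) (\<lambda>f y. - f y) T \<longleftrightarrow>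
      group_topology (fa_carrier X) (\<lambda>f g y. f y + g y) (m_inv (fa_group X)) T" for T
    by (rule group_topology_cong) (simp add: fa_group_inv)
  then have eq: "free_abelian_top_group X = base_topology"
    using free_topology_eq unfolding free_abelian_top_group_def by simp
  show "has_G_base_D (free_abelian_top_group X) (\<lambda>_. 0)"
    unfolding eq has_G_base_D_def using G_base_D_base_topology by auto
  have "\<exists>\<alpha>. g \<notin> prod_nbhd \<alpha>" if g: "g \<in> carrier (fa_group X)" "g \<noteq> \<one>\<^bsub>fa_group X\<^esub>" for g
  proof -
    obtain x where x: "g x \<noteq> 0" using g(2) by auto
    have supp: "finite {x. g x \<noteq> 0}" "{x. g x \<noteq> 0} \<subseteq> topspace X"
      using g(1) by (auto simp: fa_carrier_def)
    \<comment> \<open>A continuous function that is the indicator of \<open>x\<close> on the support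
      of \<open>g\<close>; the homomorphism it induces reads off the coefficient
      \<open>g x\<close>.\<close>
    obtain h where h: "continuous_map X euclideanreal h" "\<And>y. y \<in> {x. g x \<noteq> 0} \<Longrightarrow> h y = (if y = x then 1 else 0)"
      by (rule interpolating_function[OF supp, of "\<lambda>y. if y = x then 1 else 0"]) (rule that)
    show ?thesis
    proof (rule separated_by_real_hom[where H = "\<lambda>f. \<Sum>x | f x \<noteq> 0. of_int (f x) * h x"])
      have "(\<Sum>y | g y \<noteq> 0. of_int (g y) * h y) = (\<Sum>y | g y \<noteq> 0. if y = x then of_int (g y) else 0)"
        using h(2) by (intro sum.cong) auto
      also have "\<dots> = of_int (g x)"
        using supp(1) x by simp
      finally show "(\<Sum>y | g y \<noteq> 0. of_int (g y) * h y) \<noteq> 0" using x by simp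
    qed (use fa_real_hom[of X h] h(1) fa_real_hom_ins[of _ h] in \<open>simp_all add: comp_def\<close>)
  qed
  then show "P0_space (free_abelian_top_group X)"
    unfolding eq by (rule P0_space_free)
  show "character_eq (free_abelian_top_group X) dfrak" if "X \<noteq> discrete_topology (topspace X)"
    unfolding eq using that by (rule character_free_nondiscrete)
  show "character_eq (free_abelian_top_group X) {()}" if "X = discrete_topology (topspace X)"
    unfolding eq using that by (rule character_free_discrete)
qed

section \<open>The free group of reduced words\<close>

text \<open>Left multiplication by one letter. Reduction is the fold of these steps, so the group
  laws come from the action of letters on reduced words, as in van der Waerden's
  construction.\<close>

definition fstep :: "bool \<times> 'a \<Rightarrow> (bool \<times> 'a) list \<Rightarrow> (bool \<times> 'a) list" where
  "fstep a w = (case w of [] \<Rightarrow> [a]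
     | b # w' \<Rightarrow> (if fst b = (\<not> fst a) \<and> snd b = snd a then w' else a # b # w'))"

lemma freduce_Cons: "freduce (a # w) = fstep a (freduce w)"
  by (simp add: fstep_def)

declare freduce.simps(2) [simp del]
declare freduce_Cons [simp]

definition flip :: "bool \<times> 'a \<Rightarrow> bool \<times> 'a" where
  "flip = (\<lambda>(b, x). (\<not> b, x))"

lemma flip_flip [simp]: "flip (flip a) = a"
  by (simp add: flip_def split: prod.split)

lemma fstep_eq: "fstep a w = (case w of [] \<Rightarrow> [a] | b # w' \<Rightarrow> (if b = flip a then w' else a # b # w'))"
  by (auto simp: fstep_def flip_def prod_eq_iff split: list.split prod.split)

lemma fstep_reduced:
  "successively (\<lambda>a b. b \<noteq> flip a) w \<Longrightarrow> successively (\<lambda>a b. b \<noteq> flip a) (fstep a w)"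
  by (cases w) (auto simp: fstep_eq successively_Cons)

lemma freduce_reduced: "successively (\<lambda>a b. b \<noteq> flip a) (freduce w)"
  by (induction w) (auto simp: fstep_reduced)

text \<open>Makes membership in \<open>fg_carrier\<close> a condition on adjacent letters, which is
  stable under reversing a word and inverting its letters.\<close>

lemma freduce_fixed_iff: "freduce w = w \<longleftrightarrow> successively (\<lambda>a b. b \<noteq> flip a) w"
proof
  assume "successively (\<lambda>a b. b \<noteq> flip a) w"
  then show "freduce w = w"
    by (induction w) (auto simp: fstep_eq successively_Cons split: list.split)
qed (metis freduce_reduced)

lemma freduce_idem [simp]: "freduce (freduce w) = freduce w"
  using freduce_reduced freduce_fixed_iff by metis

lemma freduce_append: "freduce (u @ v) = foldr fstep u (freduce v)"
  by (induction u) auto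

lemma fstep_flip:
  "successively (\<lambda>a b. b \<noteq> flip a) w \<Longrightarrow> fstep a (fstep (flip a) w) = w"
  by (cases w) (auto simp: fstep_eq successively_Cons split: list.split)

lemma freduce_append_right [simp]: "freduce (u @ freduce v) = freduce (u @ v)"
  by (simp add: freduce_append)

lemma foldr_fstep_reduced:
  "successively (\<lambda>a b. b \<noteq> flip a) r \<Longrightarrow> successively (\<lambda>a b. b \<noteq> flip a) (foldr fstep w r)"
  by (induction w) (auto simp: fstep_reduced)

text \<open>If \<open>a\<close> cancels the head of \<open>w\<close>, the right side applies two
  mutually inverse letters in succession to a reduced word, which has no effect by
  \<open>fstep_flip\<close>; otherwise both sides are the same fold. Associativity of
  \<open>fg_mult\<close> rests on this.\<close>

lemma foldr_fstep:
  assumes "successively (\<lambda>a b. b \<noteq> flip a) r"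
  shows "foldr fstep (fstep a w) r = fstep a (foldr fstep w r)"
proof (cases w)
  case (Cons b w')
  then show ?thesis
    using fstep_flip[OF foldr_fstep_reduced[OF assms, of w'], of a] by (auto simp: fstep_eq[of a "b # w'"])
qed (simp add: fstep_eq)

lemma freduce_append_left [simp]: "freduce (freduce u @ v) = freduce (u @ v)"
  unfolding freduce_append
  by (induction u) (auto simp: foldr_fstep freduce_reduced)

lemma set_freduce: "set (freduce w) \<subseteq> set w"
proof (induction w)
  case (Cons a w)
  have "set (fstep a (freduce w)) \<subseteq> insert a (set (freduce w))"
    by (auto simp: fstep_eq split: list.splits if_splits)
  then show ?case using Cons by auto
qed simp

lemma fg_inv_eq: "fg_inv w = rev (map flip w)"
  by (simp add: fg_inv_def flip_def)

lemma fg_inv_carrier: "w \<in> fg_carrier X \<Longrightarrow> fg_inv w \<in> fg_carrier X"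
proof -
  assume "w \<in> fg_carrier X"
  then have w: "successively (\<lambda>a b. b \<noteq> flip a) w" "snd ` set w \<subseteq> topspace X"
    by (auto simp: fg_carrier_def freduce_fixed_iff)
  have "successively (\<lambda>a b. b \<noteq> flip a) (rev (map flip w))"
    unfolding successively_rev successively_map
    by (rule successively_mono[OF w(1)]) (metis flip_flip)
  moreover have "snd ` set (rev (map flip w)) \<subseteq> topspace X"
    using w(2) by (auto simp: flip_def)
  ultimately show ?thesis
    by (auto simp: fg_carrier_def freduce_fixed_iff fg_inv_eq)
qed

lemma freduce_fg_inv_append: "freduce (fg_inv w @ w) = []"
  unfolding fg_inv_eq
proof (induction w)
  case (Cons a w)
  have "freduce (rev (map flip (a # w)) @ a # w) = foldr fstep (rev (map flip w)) (fstep (flip a) (fstep a (freduce w)))"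
    by (simp add: freduce_append)
  also have "fstep (flip a) (fstep a (freduce w)) = freduce w"
    using fstep_flip[OF freduce_reduced, of "flip a" w] by simp
  also have "foldr fstep (rev (map flip w)) (freduce w) = []"
    using Cons by (simp add: freduce_append)
  finally show ?case .
qed simp

definition fg_group :: "'a topology \<Rightarrow> (bool \<times> 'a) list monoid" where
  "fg_group X = \<lparr>carrier = fg_carrier X, mult = fg_mult, one = []\<rparr>"

lemma fg_group_simps [simp]:
  "carrier (fg_group X) = fg_carrier X" "mult (fg_group X) = fg_mult" "one (fg_group X) = []"
  by (simp_all add: fg_group_def)

lemma group_fg_group: "group (fg_group X)"
proof (rule groupI)
  fix u v assume "u \<in> carrier (fg_group X)" "v \<in> carrier (fg_group X)"
  then show "u \<otimes>\<^bsub>fg_group X\<^esub> v \<in> carrier (fg_group X)"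
    using set_freduce[of "u @ v"] by (fastforce simp: fg_carrier_def fg_mult_def)
next
  fix u assume "u \<in> carrier (fg_group X)"
  then show "\<exists>v\<in>carrier (fg_group X). v \<otimes>\<^bsub>fg_group X\<^esub> u = \<one>\<^bsub>fg_group X\<^esub>"
    using fg_inv_carrier freduce_fg_inv_append by (intro bexI[of _ "fg_inv u"]) (auto simp: fg_mult_def)
qed (auto simp: fg_carrier_def fg_mult_def)

lemma fg_group_inv: "w \<in> fg_carrier X \<Longrightarrow> inv\<^bsub>fg_group X\<^esub> w = fg_inv w"
  using group.inv_equality[OF group_fg_group, of X "fg_inv w" w] fg_inv_carrier freduce_fg_inv_append[of w]
  by (auto simp: fg_mult_def)

lemma fg_ins_carrier: "x \<in> topspace X \<Longrightarrow> fg_ins x \<in> fg_carrier X"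
  by (auto simp: fg_carrier_def fg_ins_def fstep_def)

lemma fg_lprod:
  assumes "w \<in> fg_carrier X"
  shows "w = group.lprod (fg_group X) (map (\<lambda>(b, x). if b then fg_ins x else inv\<^bsub>fg_group X\<^esub> (fg_ins x)) w)"
proof -
  interpret group "fg_group X" by (rule group_fg_group)
  have "snd ` set w \<subseteq> topspace X"
    using assms by (simp add: fg_carrier_def)
  then have "lprod (map (\<lambda>(b, x). if b then fg_ins x else inv\<^bsub>fg_group X\<^esub> (fg_ins x)) w) = freduce w"
  proof (induction w)
    case (Cons a w)
    have "(\<lambda>(b, x). if b then fg_ins x else inv\<^bsub>fg_group X\<^esub> (fg_ins x)) a = [a]"
      using Cons.prems fg_group_inv[OF fg_ins_carrier, of "snd a" X]
      by (auto simp: fg_ins_def fg_inv_def split: prod.split)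
    then show ?case using Cons by (simp add: fg_mult_def)
  qed simp
  then show ?thesis using assms by (simp add: fg_carrier_def)
qed

text \<open>Evaluation is unchanged by reduction because \<open>fstep\<close> acts on values as left
  multiplication. The target is the additive group of the reals for \<open>real_hom\<close> and the
  free group itself for separation.\<close>

lemma fg_universal:
  fixes H :: "'h monoid"
  assumes "group H" and \<phi>: "\<And>x. x \<in> topspace X \<Longrightarrow> \<phi> x \<in> carrier H"
  defines "\<Phi> \<equiv> \<lambda>w. group.lprod H (map (\<lambda>(b, x). if b then \<phi> x else inv\<^bsub>H\<^esub> (\<phi> x)) w)"
  shows "\<Phi> \<in> hom (fg_group X) H" and "\<And>x. x \<in> topspace X \<Longrightarrow> \<Phi> (fg_ins x) = \<phi> x"
proof -
  interpret H: group H by fact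
  define ev where "ev = (\<lambda>(b, x). if b then \<phi> x else inv\<^bsub>H\<^esub> (\<phi> x))"
  have \<Phi>: "\<Phi> w = H.lprod (map ev w)" for w
    by (simp add: \<Phi>_def ev_def)
  have ev: "ev a \<in> carrier H" if "snd a \<in> topspace X" for a
    using that \<phi> by (cases a) (auto simp: ev_def)
  have evs: "set (map ev w) \<subseteq> carrier H" if "snd ` set w \<subseteq> topspace X" for w
    using that ev by auto
  have step: "\<Phi> (fstep a w) = ev a \<otimes>\<^bsub>H\<^esub> \<Phi> w" if "snd ` set (a # w) \<subseteq> topspace X" for a w
  proof (cases w)
    case (Cons b w')
    have "ev a \<otimes>\<^bsub>H\<^esub> (ev (flip a) \<otimes>\<^bsub>H\<^esub> \<Phi> w') = \<Phi> w'"
    proof -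
      have "\<Phi> w' \<in> carrier H" "\<phi> (snd a) \<in> carrier H"
        unfolding \<Phi> using that Cons \<phi> by (auto intro!: H.lprod_closed evs simp del: set_map)
      then show ?thesis
        by (cases a) (auto simp: ev_def flip_def H.inv_mult_cancel_left)
    qed
    then show ?thesis
      using Cons by (auto simp: \<Phi> fstep_eq)
  qed (simp add: \<Phi> fstep_eq)
  have red: "\<Phi> (freduce w) = \<Phi> w" if "snd ` set w \<subseteq> topspace X" for w
    using that
  proof (induction w)
    case (Cons a w)
    have "snd ` set (a # freduce w) \<subseteq> topspace X"
      using Cons.prems set_freduce[of w] by auto
    then show ?case
      using Cons by (simp add: step) (simp add: \<Phi>)
  qed simp
  show "\<Phi> \<in> hom (fg_group X) H"
    unfolding hom_def
  proof (intro CollectI conjI ballI Pi_I)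
    fix u assume "u \<in> carrier (fg_group X)"
    then show "\<Phi> u \<in> carrier H"
      unfolding \<Phi> by (intro H.lprod_closed evs) (simp add: fg_carrier_def)
  next
    fix u v assume uv: "u \<in> carrier (fg_group X)" "v \<in> carrier (fg_group X)"
    then have top: "snd ` set u \<subseteq> topspace X" "snd ` set v \<subseteq> topspace X"
      by (auto simp: fg_carrier_def)
    then have "\<Phi> (freduce (u @ v)) = \<Phi> (u @ v)"
      by (intro red) auto
    also have "\<dots> = \<Phi> u \<otimes>\<^bsub>H\<^esub> \<Phi> v"
      unfolding \<Phi> map_append by (rule H.lprod_append[OF evs[OF top(1)] evs[OF top(2)]])
    finally show "\<Phi> (u \<otimes>\<^bsub>fg_group X\<^esub> v) = \<Phi> u \<otimes>\<^bsub>H\<^esub> \<Phi> v"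
      by (simp add: fg_mult_def)
  qed
  show "\<Phi> (fg_ins x) = \<phi> x" if "x \<in> topspace X" for x
    using \<phi>[OF that] by (simp add: \<Phi> fg_ins_def ev_def)
qed

lemma group_real_add: "group \<lparr>carrier = UNIV :: real set, mult = (+), one = 0\<rparr>"
proof (rule groupI, goal_cases)
  case (5 x)
  show ?case by (rule bexI[of _ "- x"]) auto
qed auto

lemma mk_free_fg:
  assumes "mk_space X K d"
  shows "mk_free X K d (fg_group X) fg_ins"
proof -
  interpret mk_space X K d by fact
  interpret group "fg_group X" by (rule group_fg_group)
  show ?thesis
  proof
    show "fg_ins x \<in> carrier (fg_group X)" if "x \<in> topspace X" for x
      using fg_ins_carrier[OF that] by simp
    show "\<exists>xs. set xs \<subseteq> fg_ins ` topspace X \<union> (\<lambda>x. inv\<^bsub>fg_group X\<^esub> (fg_ins x)) ` topspace X \<and> g = lprod xs"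
      if "g \<in> carrier (fg_group X)" for g
      using that fg_lprod[of g X]
      by (intro exI[of _ "map (\<lambda>(b, x). if b then fg_ins x else inv\<^bsub>fg_group X\<^esub> (fg_ins x)) g"])
        (force simp: fg_carrier_def)
    fix h :: "'a \<Rightarrow> real"
    note uni = fg_universal[OF group_real_add, of X h]
    show "\<exists>H. (\<forall>x\<in>carrier (fg_group X). \<forall>y\<in>carrier (fg_group X). H (x \<otimes>\<^bsub>fg_group X\<^esub> y) = H x + H y) \<and>
        (\<forall>x\<in>topspace X. H (fg_ins x) = h x)"
      using uni by (intro exI conjI ballI) (auto simp: hom_def)
  qed
qed

theorem free_top_group_properties:
  assumes "mk_space X K d"
  shows "has_G_base_D (free_top_group X) []"
    and "P0_space (free_top_group X)"
    and "X \<noteq> discrete_topology (topspace X) \<Longrightarrow> character_eq (free_top_group X) dfrak"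
    and "X = discrete_topology (topspace X) \<Longrightarrow> character_eq (free_top_group X) {()}"
proof -
  interpret mk_free X K d "fg_group X" fg_ins
    by (rule mk_free_fg[OF assms])
  have "group_topology (fg_carrier X) fg_mult fg_inv T \<longleftrightarrow>
      group_topology (fg_carrier X) fg_mult (m_inv (fg_group X)) T" for T
    by (rule group_topology_cong) (simp add: fg_group_inv)
  then have eq: "free_top_group X = base_topology"
    using free_topology_eq unfolding free_top_group_def by simp
  show "has_G_base_D (free_top_group X) []"
    unfolding eq has_G_base_D_def using G_base_D_base_topology by auto
  \<comment> \<open>An endomorphism fixes \<open>g\<close> once it fixes the letters occurring in
    \<open>g\<close>, so the finite set to be protected is the set of these letters.\<close>
  have "\<exists>\<alpha>. g \<notin> prod_nbhd \<alpha>" if g: "g \<in> carrier (fg_group X)" "g \<noteq> \<one>\<^bsub>fg_group X\<^esub>" for g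
  proof (rule separated_by_endomorphisms[OF g, of "snd ` set g"])
    show "snd ` set g \<subseteq> topspace X" using g(1) by (simp add: fg_carrier_def)
    fix \<phi> assume \<phi>: "\<And>x. x \<in> topspace X \<Longrightarrow> \<phi> x \<in> carrier (fg_group X)"
      "\<And>s. s \<in> snd ` set g \<Longrightarrow> \<phi> s = fg_ins s"
    let ?\<Phi> = "\<lambda>w. lprod (map (\<lambda>(b, x). if b then \<phi> x else inv\<^bsub>fg_group X\<^esub> (\<phi> x)) w)"
    have "?\<Phi> g = lprod (map (\<lambda>(b, x). if b then fg_ins x else inv\<^bsub>fg_group X\<^esub> (fg_ins x)) g)"
      using \<phi>(2) by (intro arg_cong[where f = lprod] map_cong) force+
    also have "\<dots> = g" using fg_lprod[of g X] g(1) by simp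
    finally show "\<exists>\<Phi>. \<Phi> \<in> hom (fg_group X) (fg_group X) \<and> (\<forall>x\<in>topspace X. \<Phi> (fg_ins x) = \<phi> x) \<and> \<Phi> g = g"
      using fg_universal[OF group_fg_group, of X \<phi>] \<phi>(1) by (intro exI[of _ ?\<Phi>]) auto
  qed simp
  then show "P0_space (free_top_group X)"
    unfolding eq by (rule P0_space_free)
  show "character_eq (free_top_group X) dfrak" if "X \<noteq> discrete_topology (topspace X)"
    unfolding eq using that by (rule character_free_nondiscrete)
  show "character_eq (free_top_group X) {()}" if "X = discrete_topology (topspace X)"
    unfolding eq using that by (rule character_free_discrete)
qed

section \<open>Absolutely convex sets\<close>

definition abs_convex :: "('a \<Rightarrow> real) set \<Rightarrow> bool" where
  "abs_convex V \<longleftrightarrow> (\<lambda>_. 0) \<in> V \<and>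
    (\<forall>u\<in>V. \<forall>v\<in>V. \<forall>s t. \<bar>s\<bar> + \<bar>t\<bar> \<le> 1 \<longrightarrow> (\<lambda>y. s * u y + t * v y) \<in> V)"

lemma abs_convexD:
  "abs_convex V \<Longrightarrow> u \<in> V \<Longrightarrow> v \<in> V \<Longrightarrow> \<bar>s\<bar> + \<bar>t\<bar> \<le> 1 \<Longrightarrow> (\<lambda>y. s * u y + t * v y) \<in> V"
  by (simp add: abs_convex_def)

lemma abs_convex_scale: "abs_convex V \<Longrightarrow> u \<in> V \<Longrightarrow> \<bar>r\<bar> \<le> 1 \<Longrightarrow> (\<lambda>y. r * u y) \<in> V"
  using abs_convexD[of V u u r 0] by simp

lemma abs_convex_zero: "abs_convex V \<Longrightarrow> (\<lambda>_. 0) \<in> V"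
  by (simp add: abs_convex_def)

lemma abs_convex_preimage:
  assumes "abs_convex V"
  shows "abs_convex {u. (\<lambda>y. r * u y) \<in> V}"
  unfolding abs_convex_def
proof (intro conjI ballI allI impI CollectI)
  fix u v s t assume "u \<in> {u. (\<lambda>y. r * u y) \<in> V}" "v \<in> {u. (\<lambda>y. r * u y) \<in> V}" "\<bar>s\<bar> + \<bar>t\<bar> \<le> (1::real)"
  then have "(\<lambda>y. s * (r * u y) + t * (r * v y)) \<in> V"
    using abs_convexD[OF assms] by blast
  then show "(\<lambda>y. r * (s * u y + t * v y)) \<in> V"
    by (simp add: algebra_simps)
qed (use abs_convex_zero[OF assms] in auto)

text \<open>The signs of \<open>s\<close> and \<open>t\<close> are absorbed into the vectors. What
  remains is a convex combination scaled by
  \<open>c = \<bar>s\<bar> + \<bar>t\<bar> \<le> 1\<close>, that is, moved towards 0.\<close>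

lemma symmetric_convex_imp_abs_convex:
  assumes "convex_fun_set V" "(\<lambda>_. 0) \<in> V" "\<And>u. u \<in> V \<Longrightarrow> (\<lambda>y. - u y) \<in> V"
  shows "abs_convex V"
  unfolding abs_convex_def
proof (intro conjI ballI allI impI)
  have conv: "(\<lambda>y. t * u y + (1 - t) * v y) \<in> V" if "u \<in> V" "v \<in> V" "0 \<le> t" "t \<le> 1" for u v and t :: real
    using assms(1) that unfolding convex_fun_set_def by blast
  fix u v s t assume uv: "u \<in> V" "v \<in> V" and st: "\<bar>s\<bar> + \<bar>t\<bar> \<le> (1::real)"
  define u' where "u' = (\<lambda>y. sgn s * u y)"
  define v' where "v' = (\<lambda>y. sgn t * v y)"
  have uv': "u' \<in> V" "v' \<in> V"
    using uv assms(2,3) unfolding u'_def v'_def by (auto simp: sgn_if)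
  define c where "c = \<bar>s\<bar> + \<bar>t\<bar>"
  show "(\<lambda>y. s * u y + t * v y) \<in> V"
  proof (cases "c = 0")
    case True
    then have "s = 0" "t = 0" by (auto simp: c_def)
    then show ?thesis using assms(2) by simp
  next
    case False
    then have c: "c > 0" "c \<le> 1" using st by (auto simp: c_def)
    define w where "w = (\<lambda>y. (\<bar>s\<bar> / c) * u' y + (1 - \<bar>s\<bar> / c) * v' y)"
    have "w \<in> V"
      unfolding w_def using c by (intro conv uv') (auto simp: c_def divide_simps)
    then have "(\<lambda>y. c * w y + (1 - c) * 0) \<in> V"
      using assms(2) c by (intro conv) auto
    moreover have "c * w y + (1 - c) * 0 = s * u y + t * v y" for y
    proof -
      have "c * w y = \<bar>s\<bar> * u' y + (c - \<bar>s\<bar>) * v' y"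
        unfolding w_def using c by (simp add: field_simps)
      then show ?thesis
        unfolding u'_def v'_def c_def by (simp add: sgn_if)
    qed
    ultimately show ?thesis by simp
  qed
qed (rule assms(2))

definition acx :: "('a \<Rightarrow> real) set \<Rightarrow> ('a \<Rightarrow> real) set" where
  "acx S = \<Inter>{V. S \<subseteq> V \<and> abs_convex V}"

lemma acx_superset: "S \<subseteq> acx S"
  unfolding acx_def by blast

lemma acx_least: "S \<subseteq> V \<Longrightarrow> abs_convex V \<Longrightarrow> acx S \<subseteq> V"
  unfolding acx_def by blast

lemma abs_convex_acx: "abs_convex (acx S)"
  unfolding acx_def abs_convex_def by simp

lemma acx_mono: "S \<subseteq> R \<Longrightarrow> acx S \<subseteq> acx R"
  by (meson abs_convex_acx acx_least acx_superset order_trans)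

text \<open>The hulls on the right increase with \<open>k\<close>, so any two points lie in a common
  one and the union is absolutely convex. Condition (D) for L(X) comes from here.\<close>

lemma acx_directed_Union:
  fixes S :: "nat \<Rightarrow> ('a \<Rightarrow> real) set"
  shows "acx (\<Union>m. S m) \<subseteq> (\<Union>k. acx (\<Union>m\<le>k. S m))"
proof (rule acx_least)
  show "(\<Union>m. S m) \<subseteq> (\<Union>k. acx (\<Union>m\<le>k. S m))"
  proof
    fix u assume "u \<in> (\<Union>m. S m)"
    then obtain m where "u \<in> S m" by blast
    then have "u \<in> (\<Union>i\<le>m. S i)" by blast
    then have "u \<in> acx (\<Union>i\<le>m. S i)"
      by (rule subsetD[OF acx_superset])
    then show "u \<in> (\<Union>k. acx (\<Union>m\<le>k. S m))" by blast
  qed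
  show "abs_convex (\<Union>k. acx (\<Union>m\<le>k. S m))"
    unfolding abs_convex_def
  proof (intro conjI ballI allI impI)
    fix u v s t assume uv: "u \<in> (\<Union>k. acx (\<Union>m\<le>k. S m))" "v \<in> (\<Union>k. acx (\<Union>m\<le>k. S m))"
      and st: "\<bar>s\<bar> + \<bar>t\<bar> \<le> (1::real)"
    obtain k where "u \<in> acx (\<Union>m\<le>k. S m)" using uv(1) by (rule UN_E)
    moreover obtain l where "v \<in> acx (\<Union>m\<le>l. S m)" using uv(2) by (rule UN_E)
    moreover have "acx (\<Union>m\<le>k. S m) \<subseteq> acx (\<Union>m\<le>max k l. S m)" "acx (\<Union>m\<le>l. S m) \<subseteq> acx (\<Union>m\<le>max k l. S m)"
      by (intro acx_mono; force)+
    ultimately have "(\<lambda>y. s * u y + t * v y) \<in> acx (\<Union>m\<le>max k l. S m)"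
      using abs_convexD[OF abs_convex_acx _ _ st] by blast
    then show "(\<lambda>y. s * u y + t * v y) \<in> (\<Union>k. acx (\<Union>m\<le>k. S m))" by blast
  qed (use abs_convex_zero[OF abs_convex_acx] in auto)
qed

section \<open>Finitely supported real functions and their locally convex topologies\<close>

definition fl_group :: "'a topology \<Rightarrow> ('a \<Rightarrow> real) monoid" where
  "fl_group X = \<lparr>carrier = fl_carrier X, mult = (\<lambda>f g y. f y + g y), one = (\<lambda>_. 0)\<rparr>"

lemma fl_group_simps [simp]:
  "carrier (fl_group X) = fl_carrier X" "mult (fl_group X) = (\<lambda>f g y. f y + g y)"
  "one (fl_group X) = (\<lambda>_. 0)"
  by (simp_all add: fl_group_def)

lemma fl_carrier_combination:
  assumes "f \<in> fl_carrier X" "g \<in> fl_carrier X"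
  shows "(\<lambda>y. s * f y + t * g y) \<in> fl_carrier X"
proof -
  have "{x. s * f x + t * g x \<noteq> 0} \<subseteq> {x. f x \<noteq> 0} \<union> {x. g x \<noteq> 0}" by auto
  then show ?thesis
    using assms unfolding fl_carrier_def by (auto intro: finite_subset)
qed

lemma fl_carrier_add: "f \<in> fl_carrier X \<Longrightarrow> g \<in> fl_carrier X \<Longrightarrow> (\<lambda>y. f y + g y) \<in> fl_carrier X"
  using fl_carrier_combination[of f X g 1 1] by simp

lemma fl_carrier_scale: "f \<in> fl_carrier X \<Longrightarrow> (\<lambda>y. r * f y) \<in> fl_carrier X"
  using fl_carrier_combination[of f X f r 0] by simp

lemma fl_carrier_zero: "(\<lambda>_. 0) \<in> fl_carrier X"
  by (simp add: fl_carrier_def)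

lemma abs_convex_fl_carrier: "abs_convex (fl_carrier X)"
  unfolding abs_convex_def using fl_carrier_combination fl_carrier_zero by blast

lemma group_fl_group: "group (fl_group X)"
proof (rule groupI)
  fix f assume "f \<in> carrier (fl_group X)"
  then show "\<exists>g\<in>carrier (fl_group X). g \<otimes>\<^bsub>fl_group X\<^esub> f = \<one>\<^bsub>fl_group X\<^esub>"
    using fl_carrier_scale[of f X "-1"] by (intro bexI[of _ "\<lambda>y. - f y"]) auto
qed (auto simp: fl_carrier_add fl_carrier_zero add.assoc)

lemma fl_group_inv: "f \<in> fl_carrier X \<Longrightarrow> inv\<^bsub>fl_group X\<^esub> f = (\<lambda>y. - f y)"
  using group.inv_equality[OF group_fl_group, of X "\<lambda>y. - f y" f] fl_carrier_scale[of f X "-1"] by auto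

lemma fl_ins_carrier: "x \<in> topspace X \<Longrightarrow> fl_ins x \<in> fl_carrier X"
  by (auto simp: fl_carrier_def fl_ins_def)

lemma fl_carrier_induct [consumes 1, case_names zero add]:
  assumes "f \<in> fl_carrier X" and zero: "Q (\<lambda>_. 0)"
    and add: "\<And>f x c. f \<in> fl_carrier X \<Longrightarrow> x \<in> topspace X \<Longrightarrow> Q f \<Longrightarrow> Q (\<lambda>y. c * fl_ins x y + f y)"
  shows "Q f"
proof -
  have "Q f" if "finite S" "S \<subseteq> topspace X" "{x. f x \<noteq> 0} \<subseteq> S" for S f
    using that
  proof (induction S arbitrary: f rule: finite_induct)
    case empty
    then have "f = (\<lambda>_. 0)" by auto
    then show ?case using zero by simp
  next
    case (insert x S)
    have sub: "{y. (f(x := 0)) y \<noteq> 0} \<subseteq> S" using insert.prems(2) by auto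
    then have "Q (f(x := 0))"
      using insert.IH insert.prems(1) by blast
    moreover have "f(x := 0) \<in> fl_carrier X"
      using finite_subset[OF sub insert.hyps(1)] order_trans[OF sub] insert.prems(1)
      unfolding fl_carrier_def by blast
    ultimately have "Q (\<lambda>y. f x * fl_ins x y + (f(x := 0)) y)"
      using insert.prems(1) by (intro add) blast+
    moreover have "(\<lambda>y. f x * fl_ins x y + (f(x := 0)) y) = f"
      by (auto simp: fl_ins_def)
    ultimately show ?case by simp
  qed
  then show ?thesis
    using assms(1) unfolding fl_carrier_def by blast
qed

lemma fl_functional_linear:
  fixes h :: "'a \<Rightarrow> real"
  assumes "f \<in> fl_carrier X" "g \<in> fl_carrier X"
  shows "(\<Sum>x | s * f x + t * g x \<noteq> 0. (s * f x + t * g x) * h x) =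
    s * (\<Sum>x | f x \<noteq> 0. f x * h x) + t * (\<Sum>x | g x \<noteq> 0. g x * h x)"
proof -
  let ?S = "{x. f x \<noteq> 0} \<union> {x. g x \<noteq> 0}"
  have fin: "finite ?S" using assms by (simp add: fl_carrier_def)
  note sum = sum_support[OF fin, where F = "\<lambda>x c. c * h x"]
  have "(\<Sum>x | s * f x + t * g x \<noteq> 0. (s * f x + t * g x) * h x) = (\<Sum>x\<in>?S. (s * f x + t * g x) * h x)"
    by (rule sum) auto
  also have "\<dots> = s * (\<Sum>x\<in>?S. f x * h x) + t * (\<Sum>x\<in>?S. g x * h x)"
    by (simp add: sum.distrib algebra_simps sum_distrib_left)
  finally show ?thesis
    using sum[of f] sum[of g] by simp
qed

text \<open>The counterpart of \<open>group_topology_pullback\<close> for linear functionals; local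
  convexity comes from the preimages of balls around 0.\<close>

lemma lc_topology_pullback:
  fixes H :: "('a \<Rightarrow> real) \<Rightarrow> real"
  assumes H: "\<And>f g s t. f \<in> fl_carrier X \<Longrightarrow> g \<in> fl_carrier X \<Longrightarrow> H (\<lambda>y. s * f y + t * g y) = s * H f + t * H g"
  shows "lc_topology (fl_carrier X) (pullback_topology (fl_carrier X) H euclideanreal)" (is "lc_topology _ ?T")
  unfolding lc_topology_def
proof (intro conjI allI impI)
  have H_add: "H (\<lambda>y. f y + g y) = H f + H g" if "f \<in> fl_carrier X" "g \<in> fl_carrier X" for f g
    using H[OF that, of 1 1] by simp
  have H_scale: "H (\<lambda>y. r * f y) = r * H f" if "f \<in> fl_carrier X" for f r
    using H[OF that that, of r 0] by simp
  have H_zero: "H (\<lambda>_. 0) = 0"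
    using H_scale[OF fl_carrier_zero, of 0] by simp
  show top: "topspace ?T = fl_carrier X"
    by (simp add: topspace_pullback_topology)
  have HT: "continuous_map ?T euclideanreal H"
    using continuous_map_pullback[OF continuous_map_id, of "fl_carrier X" H] by simp
  show "continuous_map (prod_topology ?T ?T) ?T (\<lambda>(f, g). \<lambda>y. f y + g y)"
  proof (rule continuous_map_pullback')
    have "continuous_map (prod_topology ?T ?T) euclideanreal (\<lambda>z. H (fst z) + H (snd z))"
      using continuous_map_compose[OF continuous_map_fst HT] continuous_map_compose[OF continuous_map_snd HT]
      by (intro continuous_map_add) (simp_all add: o_def)
    then show "continuous_map (prod_topology ?T ?T) euclideanreal (H \<circ> (\<lambda>(f, g). \<lambda>y. f y + g y))"
      by (rule continuous_map_eq) (auto simp: top H_add)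
  qed (auto simp: top fl_carrier_add)
  show "continuous_map (prod_topology euclideanreal ?T) ?T (\<lambda>(r, f). \<lambda>y. r * f y)"
  proof (rule continuous_map_pullback')
    have "continuous_map (prod_topology euclideanreal ?T) euclideanreal (\<lambda>z. fst z * H (snd z))"
      using continuous_map_fst[of euclideanreal ?T] continuous_map_compose[OF continuous_map_snd HT]
      by (intro continuous_map_real_mult) (simp_all add: o_def)
    then show "continuous_map (prod_topology euclideanreal ?T) euclideanreal (H \<circ> (\<lambda>(r, f). \<lambda>y. r * f y))"
      by (rule continuous_map_eq) (auto simp: top H_scale)
  qed (auto simp: top fl_carrier_scale)
  fix U assume "openin ?T U \<and> (\<lambda>_. 0) \<in> U"
  then obtain W where W: "open W" "U = H -` W \<inter> fl_carrier X" "0 \<in> W"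
    unfolding openin_pullback_topology using H_zero by auto
  then obtain e where e: "e > 0" "ball 0 e \<subseteq> W"
    using openE by blast
  let ?V = "H -` ball 0 e \<inter> fl_carrier X"
  have "convex_fun_set ?V"
    unfolding convex_fun_set_def
  proof (intro ballI allI impI)
    fix u v t assume uv: "u \<in> ?V" "v \<in> ?V" and t: "0 \<le> t \<and> t \<le> (1::real)"
    have "t *\<^sub>R H u + (1 - t) *\<^sub>R H v \<in> ball 0 e"
      using uv t by (intro convexD convex_ball) auto
    then show "(\<lambda>y. t * u y + (1 - t) * v y) \<in> ?V"
      using uv H[of u v t "1 - t"] fl_carrier_combination by auto
  qed
  moreover have "openin ?T ?V"
    unfolding openin_pullback_topology by (rule exI[of _ "ball 0 e"]) auto
  ultimately show "\<exists>V. openin ?T V \<and> (\<lambda>_. 0) \<in> V \<and> V \<subseteq> U \<and> convex_fun_set V"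
    using e W H_zero fl_carrier_zero by (intro exI[of _ ?V]) auto
qed

lemma lc_topology_scale:
  assumes "lc_topology C T"
  shows "continuous_map T T (\<lambda>f y. r * f y)"
proof -
  have "continuous_map T (prod_topology euclideanreal T) (\<lambda>f. (r, f))"
    by (simp add: continuous_map_pairedI)
  then have "continuous_map T T ((\<lambda>(r, f). \<lambda>y. r * f y) \<circ> (\<lambda>f. (r, f)))"
    using assms unfolding lc_topology_def by (blast intro: continuous_map_compose)
  then show ?thesis by (simp add: comp_def)
qed

lemma lc_topology_group_topology:
  assumes "lc_topology (fl_carrier X) T"
  shows "top_group (fl_group X) T"
proof -
  have "continuous_map T T (\<lambda>f y. - f y)"
    using lc_topology_scale[OF assms, of "-1"] by simp
  then have "group_topology (fl_carrier X) (\<lambda>f g y. f y + g y) (\<lambda>f y. - f y) T"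
    using assms by (simp add: lc_topology_def group_topology_def)
  moreover have "group_topology (fl_carrier X) (\<lambda>f g y. f y + g y) (\<lambda>f y. - f y) T \<longleftrightarrow>
      group_topology (fl_carrier X) (\<lambda>f g y. f y + g y) (m_inv (fl_group X)) T"
    by (rule group_topology_cong) (simp add: fl_group_inv)
  ultimately show ?thesis
    using group_fl_group by (simp add: top_group_def top_group_axioms_def)
qed

text \<open>An open convex \<open>V\<close> containing 0 becomes absolutely convex on intersecting
  it with its reflection.\<close>

lemma lc_topology_abs_convex_nbhd:
  assumes T: "lc_topology C T" and W: "openin T W" "(\<lambda>_. 0) \<in> W"
  shows "\<exists>V. openin T V \<and> V \<subseteq> W \<and> abs_convex V"
proof -
  obtain V where V: "openin T V" "(\<lambda>_. 0) \<in> V" "V \<subseteq> W" "convex_fun_set V"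
    using T W unfolding lc_topology_def by blast
  have top: "topspace T = C" using T by (simp add: lc_topology_def)
  have "openin T {f \<in> topspace T. (\<lambda>y. -1 * f y) \<in> V}"
    by (rule openin_continuous_map_preimage[OF lc_topology_scale[OF T] V(1)])
  then have op: "openin T (V \<inter> {f \<in> topspace T. (\<lambda>y. - f y) \<in> V})"
    using V(1) by (simp add: openin_Int)
  have eq: "V \<inter> {f \<in> topspace T. (\<lambda>y. - f y) \<in> V} = {f \<in> V. (\<lambda>y. - f y) \<in> V}"
    using openin_subset[OF V(1)] by auto
  have "abs_convex {f \<in> V. (\<lambda>y. - f y) \<in> V}"
  proof (rule symmetric_convex_imp_abs_convex)
    show "convex_fun_set {f \<in> V. (\<lambda>y. - f y) \<in> V}"
      unfolding convex_fun_set_def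
    proof (intro ballI allI impI CollectI conjI)
      fix u v t assume uv: "u \<in> {f \<in> V. (\<lambda>y. - f y) \<in> V}" "v \<in> {f \<in> V. (\<lambda>y. - f y) \<in> V}"
        and t: "0 \<le> t \<and> t \<le> (1::real)"
      show "(\<lambda>y. t * u y + (1 - t) * v y) \<in> V"
        using V(4) uv t unfolding convex_fun_set_def by blast
      have "(\<lambda>y. t * (- u y) + (1 - t) * (- v y)) \<in> V"
        using V(4)[unfolded convex_fun_set_def, rule_format, of "\<lambda>y. - u y" "\<lambda>y. - v y" t] uv t by blast
      then show "(\<lambda>y. - (t * u y + (1 - t) * v y)) \<in> V" by simp
    qed
  qed (use V(2) in auto)
  then show ?thesis
    using op V(3) unfolding eq by blast
qed

section \<open>The free locally convex space\<close>

context mk_space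
begin

text \<open>The factor \<open>m + 1\<close> makes all multiples of the differences small; doubling a neighbourhood
  amounts to passing from the index \<open>m\<close> to \<open>2 * m + 1\<close>.\<close>

definition lcs_gen :: "nat \<Rightarrow> nat \<Rightarrow> ('a \<Rightarrow> real) set" where
  "lcs_gen m k = {\<lambda>y. (real m + 1) * (fl_ins b y - fl_ins a y) | a b. (a, b) \<in> E m k} \<union>
    {\<lambda>y. t * fl_ins z y | t z. z \<in> K m \<and> \<bar>t\<bar> \<le> 1 / (real k + 1)}"

definition lcs_nbhd :: "(nat \<Rightarrow> nat) \<Rightarrow> ('a \<Rightarrow> real) set" where
  "lcs_nbhd \<alpha> = acx (\<Union>m. lcs_gen m (\<alpha> m))"

lemma lcs_gen_diff: "(a, b) \<in> E m k \<Longrightarrow> (\<lambda>y. (real m + 1) * (fl_ins b y - fl_ins a y)) \<in> lcs_gen m k"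
  unfolding lcs_gen_def by blast

lemma lcs_gen_scale: "z \<in> K m \<Longrightarrow> \<bar>t\<bar> \<le> 1 / (real k + 1) \<Longrightarrow> (\<lambda>y. t * fl_ins z y) \<in> lcs_gen m k"
  unfolding lcs_gen_def by blast

lemma lcs_gen_cases:
  assumes "u \<in> lcs_gen m k"
  obtains a b where "(a, b) \<in> E m k" "u = (\<lambda>y. (real m + 1) * (fl_ins b y - fl_ins a y))"
    | t z where "z \<in> K m" "\<bar>t\<bar> \<le> 1 / (real k + 1)" "u = (\<lambda>y. t * fl_ins z y)"
  using assms unfolding lcs_gen_def by blast

lemma lcs_gen_carrier: "lcs_gen m k \<subseteq> fl_carrier X"
proof
  fix u assume "u \<in> lcs_gen m k"
  then show "u \<in> fl_carrier X"
  proof (cases rule: lcs_gen_cases)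
    case (1 a b)
    then have "fl_ins b \<in> fl_carrier X" "fl_ins a \<in> fl_carrier X"
      using E_topspace[OF 1(1)] by (simp_all add: fl_ins_carrier)
    from fl_carrier_combination[OF this, of "real m + 1" "- (real m + 1)"] 1(2) show ?thesis
      by (simp add: algebra_simps)
  next
    case (2 t z)
    then show ?thesis
      using fl_carrier_scale[OF fl_ins_carrier, of z X t] K_topspace by auto
  qed
qed

lemma lcs_gen_antimono: "k \<le> l \<Longrightarrow> lcs_gen m l \<subseteq> lcs_gen m k"
proof
  fix u assume kl: "k \<le> l" and "u \<in> lcs_gen m l"
  from this(2) show "u \<in> lcs_gen m k"
  proof (cases rule: lcs_gen_cases)
    case (1 a b)
    then show ?thesis using E_antimono[OF kl] lcs_gen_diff by blast
  next
    case (2 t z)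
    have "1 / (real l + 1) \<le> 1 / (real k + 1)"
      using kl by (intro divide_left_mono) auto
    then show ?thesis using 2 lcs_gen_scale by simp
  qed
qed

lemma lcs_gen_nbhd: "lcs_gen m (\<alpha> m) \<subseteq> lcs_nbhd \<alpha>"
  unfolding lcs_nbhd_def using acx_superset[of "\<Union>m. lcs_gen m (\<alpha> m)"] by blast

lemma abs_convex_lcs_nbhd: "abs_convex (lcs_nbhd \<alpha>)"
  unfolding lcs_nbhd_def by (rule abs_convex_acx)

lemma lcs_nbhd_least: "(\<And>m. lcs_gen m (\<alpha> m) \<subseteq> V) \<Longrightarrow> abs_convex V \<Longrightarrow> lcs_nbhd \<alpha> \<subseteq> V"
  unfolding lcs_nbhd_def by (intro acx_least) blast

lemma lcs_nbhd_antimono: "(\<And>i. \<alpha> i \<le> \<beta> i) \<Longrightarrow> lcs_nbhd \<beta> \<subseteq> lcs_nbhd \<alpha>"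
  using lcs_gen_antimono lcs_gen_nbhd by (intro lcs_nbhd_least abs_convex_lcs_nbhd) blast

lemma lcs_nbhd_carrier: "lcs_nbhd \<alpha> \<subseteq> fl_carrier X"
  by (intro lcs_nbhd_least lcs_gen_carrier abs_convex_fl_carrier)

lemma lcs_nbhd_double: "\<exists>\<beta>. \<forall>u\<in>lcs_nbhd \<beta>. (\<lambda>y. 2 * u y) \<in> lcs_nbhd \<alpha>"
proof -
  \<comment> \<open>At level \<open>2 * m + 1\<close> the factor is \<open>2 * m + 2\<close>, twice
    that of level \<open>m\<close>. The entry \<open>2 * \<alpha> m + 1\<close> halves the bound for
    scalars, as \<open>1 / (2 * \<alpha> m + 2)\<close> is half of
    \<open>1 / (\<alpha> m + 1)\<close>.\<close>
  let ?\<beta> = "\<lambda>m. max (\<alpha> (2 * m + 1)) (2 * \<alpha> m + 1)"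
  have "lcs_nbhd ?\<beta> \<subseteq> {u. (\<lambda>y. 2 * u y) \<in> lcs_nbhd \<alpha>}"
  proof (rule lcs_nbhd_least[OF _ abs_convex_preimage[OF abs_convex_lcs_nbhd]], intro subsetI CollectI)
    fix m u assume "u \<in> lcs_gen m (?\<beta> m)"
    then show "(\<lambda>y. 2 * u y) \<in> lcs_nbhd \<alpha>"
    proof (cases rule: lcs_gen_cases)
      case (1 a b)
      have "(a, b) \<in> E (2 * m + 1) (\<alpha> (2 * m + 1))"
        using subsetD[OF E_mono[of m "2 * m + 1"]] subsetD[OF E_antimono[of "\<alpha> (2 * m + 1)" "?\<beta> m"]] 1(1) by simp
      from lcs_gen_diff[OF this] have "(\<lambda>y. (real (2 * m + 1) + 1) * (fl_ins b y - fl_ins a y)) \<in> lcs_nbhd \<alpha>"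
        using lcs_gen_nbhd by blast
      moreover have "(\<lambda>y. 2 * u y) = (\<lambda>y. (real (2 * m + 1) + 1) * (fl_ins b y - fl_ins a y))"
        unfolding 1(2) by (simp add: algebra_simps)
      ultimately show ?thesis by simp
    next
      case (2 t z)
      have "1 / (real (?\<beta> m) + 1) \<le> 1 / (2 * (real (\<alpha> m) + 1))"
        by (intro divide_left_mono) auto
      with 2(2) have "\<bar>t\<bar> \<le> 1 / (2 * (real (\<alpha> m) + 1))" by (rule order_trans)
      then have "\<bar>2 * t\<bar> \<le> 1 / (real (\<alpha> m) + 1)"
        by (simp add: field_simps abs_mult)
      from lcs_gen_scale[OF 2(1) this] have "(\<lambda>y. (2 * t) * fl_ins z y) \<in> lcs_nbhd \<alpha>"
        using lcs_gen_nbhd by blast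
      then show ?thesis unfolding 2(3) by (simp add: mult.assoc)
    qed
  qed
  then show ?thesis by blast
qed

text \<open>Iterated doubling reaches a power of two above \<open>c\<close>, and absolute convexity
  covers all smaller scalars.\<close>

lemma lcs_nbhd_scale: "\<exists>\<beta>. \<forall>u\<in>lcs_nbhd \<beta>. \<forall>r. \<bar>r\<bar> \<le> c \<longrightarrow> (\<lambda>y. r * u y) \<in> lcs_nbhd \<alpha>"
proof -
  have pow: "\<exists>\<beta>. \<forall>u\<in>lcs_nbhd \<beta>. (\<lambda>y. 2 ^ n * u y) \<in> lcs_nbhd \<alpha>" for n
  proof (induction n)
    case 0
    show ?case by (rule exI[of _ \<alpha>]) simp
  next
    case (Suc n)
    then obtain \<beta> where \<beta>: "\<forall>u\<in>lcs_nbhd \<beta>. (\<lambda>y. 2 ^ n * u y) \<in> lcs_nbhd \<alpha>" ..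
    obtain \<gamma> where \<gamma>: "\<forall>u\<in>lcs_nbhd \<gamma>. (\<lambda>y. 2 * u y) \<in> lcs_nbhd \<beta>"
      using lcs_nbhd_double ..
    have "(\<lambda>y. 2 ^ Suc n * u y) \<in> lcs_nbhd \<alpha>" if "u \<in> lcs_nbhd \<gamma>" for u
      using bspec[OF \<beta> bspec[OF \<gamma> that]] by (simp add: algebra_simps)
    then show ?case by blast
  qed
  obtain n :: nat where n: "c < 2 ^ n"
    using real_arch_pow[of 2 c] by auto
  obtain \<beta> where \<beta>: "\<forall>u\<in>lcs_nbhd \<beta>. (\<lambda>y. 2 ^ n * u y) \<in> lcs_nbhd \<alpha>"
    using pow ..
  have "(\<lambda>y. r * u y) \<in> lcs_nbhd \<alpha>" if "u \<in> lcs_nbhd \<beta>" "\<bar>r\<bar> \<le> c" for u r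
    using abs_convex_scale[OF abs_convex_lcs_nbhd bspec[OF \<beta> that(1)], of "r / 2 ^ n"] that(2) n
    by (simp add: divide_simps)
  then show ?thesis by blast
qed

text \<open>A sum \<open>u + v\<close> is the midpoint of \<open>2 u\<close> and
  \<open>2 v\<close>.\<close>

lemma lcs_nbhd_add: "\<exists>\<beta>. \<forall>u\<in>lcs_nbhd \<beta>. \<forall>v\<in>lcs_nbhd \<beta>. (\<lambda>y. u y + v y) \<in> lcs_nbhd \<alpha>"
proof -
  obtain \<beta> where \<beta>: "\<forall>u\<in>lcs_nbhd \<beta>. (\<lambda>y. 2 * u y) \<in> lcs_nbhd \<alpha>"
    using lcs_nbhd_double ..
  have "(\<lambda>y. u y + v y) \<in> lcs_nbhd \<alpha>" if "u \<in> lcs_nbhd \<beta>" "v \<in> lcs_nbhd \<beta>" for u v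
    using abs_convexD[OF abs_convex_lcs_nbhd bspec[OF \<beta> that(1)] bspec[OF \<beta> that(2)], of "1/2" "1/2"] by simp
  then show ?thesis by blast
qed

text \<open>The small multiples of single points are among the generators for this purpose:
  differences of points span only functions whose values sum to 0.\<close>

lemma lcs_nbhd_absorbing:
  assumes "f \<in> fl_carrier X"
  shows "\<exists>\<epsilon>>0. \<forall>r. \<bar>r\<bar> \<le> \<epsilon> \<longrightarrow> (\<lambda>y. r * f y) \<in> lcs_nbhd \<alpha>"
  using assms
proof (induction arbitrary: \<alpha> rule: fl_carrier_induct)
  case zero
  show ?case using abs_convex_zero[OF abs_convex_lcs_nbhd] by (intro exI[of _ 1]) auto
next
  case (add f x c)
  obtain \<beta> where \<beta>: "\<forall>u\<in>lcs_nbhd \<beta>. \<forall>v\<in>lcs_nbhd \<beta>. (\<lambda>y. u y + v y) \<in> lcs_nbhd \<alpha>"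
    using lcs_nbhd_add ..
  obtain \<epsilon> where \<epsilon>: "\<epsilon> > 0" "\<And>r. \<bar>r\<bar> \<le> \<epsilon> \<Longrightarrow> (\<lambda>y. r * f y) \<in> lcs_nbhd \<beta>"
    using add.IH[of \<beta>] by blast
  obtain m where m: "x \<in> K m" using add.hyps(2) K_Union by blast
  \<comment> \<open>\<open>\<bar>c\<bar> + 1\<close> stands in for \<open>\<bar>c\<bar>\<close> so
    that \<open>c = 0\<close> causes no division by zero.\<close>
  define \<delta> where "\<delta> = min \<epsilon> (1 / ((real (\<beta> m) + 1) * (\<bar>c\<bar> + 1)))"
  have "(\<lambda>y. r * (c * fl_ins x y + f y)) \<in> lcs_nbhd \<alpha>" if "\<bar>r\<bar> \<le> \<delta>" for r
  proof -
    have "\<bar>r * c\<bar> \<le> \<bar>r\<bar> * (\<bar>c\<bar> + 1)"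
      by (simp add: abs_mult mult_left_mono)
    also have "\<dots> \<le> 1 / ((real (\<beta> m) + 1) * (\<bar>c\<bar> + 1)) * (\<bar>c\<bar> + 1)"
      using that unfolding \<delta>_def by (intro mult_right_mono) auto
    also have "\<dots> = 1 / (real (\<beta> m) + 1)" by simp
    finally have "(\<lambda>y. (r * c) * fl_ins x y) \<in> lcs_nbhd \<beta>"
      using lcs_gen_scale[OF m] lcs_gen_nbhd by blast
    moreover have "(\<lambda>y. r * f y) \<in> lcs_nbhd \<beta>"
      using that by (intro \<epsilon>(2)) (simp add: \<delta>_def)
    ultimately have "(\<lambda>y. (r * c) * fl_ins x y + r * f y) \<in> lcs_nbhd \<alpha>"
      by (rule \<beta>[rule_format])
    then show ?thesis by (simp add: algebra_simps)
  qed
  moreover have "\<delta> > 0"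
    unfolding \<delta>_def using \<epsilon>(1) by (auto intro!: mult_pos_pos divide_pos_pos)
  ultimately show ?case by blast
qed

sublocale lcs: group_G_base "fl_group X" lcs_nbhd
proof (intro group_G_base.intro group_nbhd_base.intro group_fl_group, unfold_locales)
  show "lcs_nbhd \<alpha> \<subseteq> carrier (fl_group X)" for \<alpha>
    using lcs_nbhd_carrier by simp
  show "\<one>\<^bsub>fl_group X\<^esub> \<in> lcs_nbhd \<alpha>" for \<alpha>
    using abs_convex_zero[OF abs_convex_lcs_nbhd] by simp
  show "\<exists>\<gamma>. lcs_nbhd \<gamma> \<subseteq> lcs_nbhd \<alpha> \<inter> lcs_nbhd \<beta>" for \<alpha> \<beta>
    using lcs_nbhd_antimono[of \<alpha> "\<lambda>i. max (\<alpha> i) (\<beta> i)"] lcs_nbhd_antimono[of \<beta> "\<lambda>i. max (\<alpha> i) (\<beta> i)"]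
    by (intro exI[of _ "\<lambda>i. max (\<alpha> i) (\<beta> i)"]) auto
  show "\<exists>\<beta>. \<forall>x\<in>lcs_nbhd \<beta>. \<forall>y\<in>lcs_nbhd \<beta>. x \<otimes>\<^bsub>fl_group X\<^esub> y \<in> lcs_nbhd \<alpha>" for \<alpha>
    using lcs_nbhd_add by simp
  show "\<exists>\<beta>. \<forall>x\<in>lcs_nbhd \<beta>. inv\<^bsub>fl_group X\<^esub> x \<in> lcs_nbhd \<alpha>" for \<alpha>
  proof (intro exI ballI)
    fix x assume x: "x \<in> lcs_nbhd \<alpha>"
    then have "inv\<^bsub>fl_group X\<^esub> x = (\<lambda>y. - x y)"
      using lcs_nbhd_carrier by (intro fl_group_inv) blast
    then show "inv\<^bsub>fl_group X\<^esub> x \<in> lcs_nbhd \<alpha>"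
      using abs_convex_scale[OF abs_convex_lcs_nbhd x, of "-1"] by simp
  qed
  show "\<exists>\<beta>. \<forall>x\<in>lcs_nbhd \<beta>. g \<otimes>\<^bsub>fl_group X\<^esub> x \<otimes>\<^bsub>fl_group X\<^esub> inv\<^bsub>fl_group X\<^esub> g \<in> lcs_nbhd \<alpha>"
    if "g \<in> carrier (fl_group X)" for g \<alpha>
    using that by (intro exI[of _ \<alpha>]) (simp add: fl_group_inv)
  show "lcs_nbhd \<beta> \<subseteq> lcs_nbhd \<alpha>" if "\<And>i. \<alpha> i \<le> \<beta> i" for \<alpha> \<beta>
    using that by (rule lcs_nbhd_antimono)
  show "\<exists>k. \<forall>\<beta>. (\<forall>i\<le>k. \<beta> i = \<alpha> i) \<longrightarrow> x \<in> lcs_nbhd \<beta>" if "x \<in> lcs_nbhd \<alpha>" for x \<alpha>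
  proof -
    \<comment> \<open>An element of the hull already lies in the hull of the generators of finitely
      many levels.\<close>
    have "x \<in> (\<Union>k. acx (\<Union>m\<le>k. lcs_gen m (\<alpha> m)))"
      using that acx_directed_Union unfolding lcs_nbhd_def by blast
    then obtain k where k: "x \<in> acx (\<Union>m\<le>k. lcs_gen m (\<alpha> m))"
      by (rule UN_E)
    have "x \<in> lcs_nbhd \<beta>" if "\<forall>i\<le>k. \<beta> i = \<alpha> i" for \<beta>
    proof -
      have "(\<Union>m\<le>k. lcs_gen m (\<alpha> m)) = (\<Union>m\<le>k. lcs_gen m (\<beta> m))"
        using that by auto
      also have "\<dots> \<subseteq> (\<Union>m. lcs_gen m (\<beta> m))" by blast
      finally show ?thesis
        using k acx_mono unfolding lcs_nbhd_def by blast
    qed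
    then show ?thesis by blast
  qed
qed

lemma continuous_fl_ins: "continuous_map X lcs.base_topology fl_ins"
proof (rule continuous_into_base_topology[OF lcs.group_nbhd_base_axioms])
  fix n \<alpha>
  have "inv\<^bsub>fl_group X\<^esub> (fl_ins x) \<otimes>\<^bsub>fl_group X\<^esub> fl_ins y \<in> lcs_nbhd \<alpha>" if "(x, y) \<in> E n (\<alpha> n)" for x y
  proof -
    have "(\<lambda>z. (real n + 1) * (fl_ins y z - fl_ins x z)) \<in> lcs_nbhd \<alpha>"
      using lcs_gen_diff[OF that] lcs_gen_nbhd by blast
    from abs_convex_scale[OF abs_convex_lcs_nbhd this, of "1 / (real n + 1)"]
    have "(\<lambda>z. fl_ins y z - fl_ins x z) \<in> lcs_nbhd \<alpha>" by simp
    then show ?thesis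
      using E_topspace[OF that] by (simp add: fl_group_inv fl_ins_carrier)
  qed
  then show "\<exists>k. \<forall>(x, y)\<in>E n k. inv\<^bsub>fl_group X\<^esub> (fl_ins x) \<otimes>\<^bsub>fl_group X\<^esub> fl_ins y \<in> lcs_nbhd \<alpha>" by blast
qed (simp add: fl_ins_carrier)

text \<open>By \<open>q (f + u) - r f = (q - r) f + q u\<close>: the first term is small because the
  neighbourhoods are absorbing, the second because \<open>\<bar>q\<bar>\<close> stays below
  \<open>\<bar>r\<bar> + 1\<close>.\<close>

lemma lcs_continuous_scale:
  "continuous_map (prod_topology euclideanreal lcs.base_topology) lcs.base_topology (\<lambda>(r, f). \<lambda>y. r * f y)"
  unfolding continuous_map
proof (intro conjI allI impI)
  show "(\<lambda>(r, f). \<lambda>y. r * f y) ` topspace (prod_topology euclideanreal lcs.base_topology) \<subseteq> topspace lcs.base_topology"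
    by (auto simp: fl_carrier_scale)
  fix S assume S: "openin lcs.base_topology S"
  show "openin (prod_topology euclideanreal lcs.base_topology)
    {z \<in> topspace (prod_topology euclideanreal lcs.base_topology). (case z of (r, f) \<Rightarrow> \<lambda>y. r * f y) \<in> S}"
    (is "openin _ ?Z")
    unfolding openin_prod_topology_alt
  proof (intro allI impI)
    fix r f assume "(r, f) \<in> ?Z"
    then have rf: "f \<in> fl_carrier X" "(\<lambda>y. r * f y) \<in> S" by auto
    then obtain \<alpha> where \<alpha>: "\<forall>u\<in>lcs_nbhd \<alpha>. (\<lambda>y. r * f y) \<otimes>\<^bsub>fl_group X\<^esub> u \<in> S"
      using S unfolding lcs.openin_base_topology by blast
    obtain \<beta> where \<beta>: "\<forall>u\<in>lcs_nbhd \<beta>. \<forall>v\<in>lcs_nbhd \<beta>. (\<lambda>y. u y + v y) \<in> lcs_nbhd \<alpha>"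
      using lcs_nbhd_add ..
    obtain \<gamma> where \<gamma>: "\<forall>u\<in>lcs_nbhd \<gamma>. \<forall>q. \<bar>q\<bar> \<le> \<bar>r\<bar> + 1 \<longrightarrow> (\<lambda>y. q * u y) \<in> lcs_nbhd \<beta>"
      using lcs_nbhd_scale ..
    obtain \<epsilon> where \<epsilon>: "\<epsilon> > 0" "\<And>q. \<bar>q\<bar> \<le> \<epsilon> \<Longrightarrow> (\<lambda>y. q * f y) \<in> lcs_nbhd \<beta>"
      using lcs_nbhd_absorbing[OF rf(1), of \<beta>] by blast
    have "\<exists>V. openin lcs.base_topology V \<and> f \<in> V \<and> V \<subseteq> (\<lambda>u. f \<otimes>\<^bsub>fl_group X\<^esub> u) ` lcs_nbhd \<gamma>"
      by (rule lcs.translate_nbhd) (simp add: rf(1))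
    then obtain V where V: "openin lcs.base_topology V" "f \<in> V" "V \<subseteq> (\<lambda>u. f \<otimes>\<^bsub>fl_group X\<^esub> u) ` lcs_nbhd \<gamma>"
      by (elim exE conjE) (rule that)
    let ?B = "ball r (min 1 \<epsilon>)"
    have "(\<lambda>y. q * g y) \<in> S" if "q \<in> ?B" "g \<in> V" for q g
    proof -
      obtain u where u: "u \<in> lcs_nbhd \<gamma>" "g = (\<lambda>y. f y + u y)"
        using V(3) \<open>g \<in> V\<close> by auto
      have q: "\<bar>q - r\<bar> \<le> \<epsilon>" "\<bar>q\<bar> \<le> \<bar>r\<bar> + 1"
        using that(1) by (auto simp: dist_real_def)
      have "(\<lambda>y. (q - r) * f y + q * u y) \<in> lcs_nbhd \<alpha>"
        using bspec[OF bspec[OF \<beta> \<epsilon>(2)[OF q(1)]], of "\<lambda>y. q * u y"] \<gamma> u(1) q(2) by blast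
      from bspec[OF \<alpha> this] show ?thesis
        unfolding u(2) by (simp add: algebra_simps)
    qed
    then have "?B \<times> V \<subseteq> ?Z"
      using openin_subset[OF V(1)] by auto
    then show "\<exists>U V. openin euclideanreal U \<and> openin lcs.base_topology V \<and> r \<in> U \<and> f \<in> V \<and> U \<times> V \<subseteq> ?Z"
      using V \<epsilon>(1) by (intro exI[of _ ?B] exI[of _ V]) auto
  qed
qed

text \<open>The sets \<open>lcs_nbhd \<alpha>\<close> are convex but need not be open; their
  interiors are both.\<close>

lemma lc_topology_lcs: "lc_topology (fl_carrier X) lcs.base_topology"
  unfolding lc_topology_def
proof (intro conjI allI impI)
  show "continuous_map (prod_topology lcs.base_topology lcs.base_topology) lcs.base_topology (\<lambda>(f, g). \<lambda>y. f y + g y)"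
    using lcs.continuous_mult by simp
  fix W assume W: "openin lcs.base_topology W \<and> (\<lambda>_. 0) \<in> W"
  then obtain \<alpha> where \<alpha>: "\<forall>u\<in>lcs_nbhd \<alpha>. (\<lambda>_. 0) \<otimes>\<^bsub>fl_group X\<^esub> u \<in> W"
    unfolding lcs.openin_base_topology by blast
  let ?V = "{f \<in> carrier (fl_group X). \<exists>\<beta>. \<forall>u\<in>lcs_nbhd \<beta>. f \<otimes>\<^bsub>fl_group X\<^esub> u \<in> lcs_nbhd \<alpha>}"
  have "convex_fun_set ?V"
    unfolding convex_fun_set_def
  proof (intro ballI allI impI)
    fix f g t assume f: "f \<in> ?V" and g: "g \<in> ?V" and t: "0 \<le> t \<and> t \<le> (1::real)"
    obtain \<beta> where \<beta>: "\<forall>u\<in>lcs_nbhd \<beta>. (\<lambda>y. f y + u y) \<in> lcs_nbhd \<alpha>"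
      using f by auto
    obtain \<gamma> where \<gamma>: "\<forall>u\<in>lcs_nbhd \<gamma>. (\<lambda>y. g y + u y) \<in> lcs_nbhd \<alpha>"
      using g by auto
    obtain \<delta> where \<delta>: "lcs_nbhd \<delta> \<subseteq> lcs_nbhd \<beta> \<inter> lcs_nbhd \<gamma>"
      using lcs.U_inter ..
    have "(\<lambda>y. t * f y + (1 - t) * g y) \<otimes>\<^bsub>fl_group X\<^esub> u \<in> lcs_nbhd \<alpha>" if "u \<in> lcs_nbhd \<delta>" for u
    proof -
      have "(\<lambda>y. f y + u y) \<in> lcs_nbhd \<alpha>" "(\<lambda>y. g y + u y) \<in> lcs_nbhd \<alpha>"
        using that \<beta> \<gamma> \<delta> by blast+
      from abs_convexD[OF abs_convex_lcs_nbhd this, of t "1 - t"] t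
      have "(\<lambda>y. t * (f y + u y) + (1 - t) * (g y + u y)) \<in> lcs_nbhd \<alpha>" by simp
      then show ?thesis by (simp add: algebra_simps)
    qed
    moreover have "(\<lambda>y. t * f y + (1 - t) * g y) \<in> fl_carrier X"
      using f g fl_carrier_combination by auto
    ultimately show "(\<lambda>y. t * f y + (1 - t) * g y) \<in> ?V" by auto
  qed
  moreover have "(\<lambda>_. 0) \<in> ?V"
    using fl_carrier_zero by (auto intro!: exI[of _ \<alpha>])
  moreover have "?V \<subseteq> W"
    using lcs.core_subset[of "lcs_nbhd \<alpha>"] \<alpha> by auto
  ultimately show "\<exists>V. openin lcs.base_topology V \<and> (\<lambda>_. 0) \<in> V \<and> V \<subseteq> W \<and> convex_fun_set V"
    using lcs.openin_core[of "lcs_nbhd \<alpha>"] by (intro exI[of _ ?V]) blast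
qed (use lcs_continuous_scale in auto)

text \<open>Differences fall, by uniform continuity, into the open set of vectors whose multiple by
  \<open>m + 1\<close> lies in \<open>V\<close>. For the multiples of points, the open sets
  \<open>Q k\<close> increase and cover the compact \<open>K m\<close>, so one of them contains
  it.\<close>

lemma lcs_gen_small:
  assumes T: "lc_topology (fl_carrier X) T" and ins: "continuous_map X T fl_ins"
    and V: "openin T V" "abs_convex V"
  shows "\<exists>k. lcs_gen m k \<subseteq> V"
proof -
  interpret T: top_group "fl_group X" T
    by (rule lc_topology_group_topology[OF T])
  have top: "topspace T = fl_carrier X" using T by (simp add: lc_topology_def)
  define V' where "V' = {f \<in> topspace T. (\<lambda>y. (real m + 1) * f y) \<in> V}"
  have V': "openin T V'"
    unfolding V'_def by (rule openin_continuous_map_preimage[OF lc_topology_scale[OF T] V(1)])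
  have "\<one>\<^bsub>fl_group X\<^esub> \<in> V'"
    unfolding V'_def using top fl_carrier_zero abs_convex_zero[OF V(2)] by simp
  from E_uniform_group[OF T.top_group_axioms ins V' this]
  obtain k1 where k1: "\<forall>(x, y)\<in>E m k1. inv\<^bsub>fl_group X\<^esub> (fl_ins x) \<otimes>\<^bsub>fl_group X\<^esub> fl_ins y \<in> V'" by (rule exE)
  define Q where "Q k = {z \<in> topspace X. (\<lambda>y. 1 / (real k + 1) * fl_ins z y) \<in> V}" for k :: nat
  have Q_open: "openin X (Q k)" for k
    using openin_continuous_map_preimage[OF continuous_map_compose[OF ins lc_topology_scale[OF T]] V(1)]
    unfolding Q_def comp_def .
  have Q_mono: "Q k \<subseteq> Q l" if "k \<le> l" for k l
  proof
    fix z assume z: "z \<in> Q k"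
    have "\<bar>(real k + 1) / (real l + 1)\<bar> \<le> 1" using that by simp
    from abs_convex_scale[OF V(2) _ this, of "\<lambda>y. 1 / (real k + 1) * fl_ins z y"] z
    show "z \<in> Q l" by (simp add: Q_def)
  qed
  have "K m \<subseteq> (\<Union>k. Q k)"
  proof
    fix z assume z: "z \<in> K m"
    then have zX: "z \<in> topspace X" using K_topspace by blast
    have "continuous_map euclideanreal (prod_topology euclideanreal T) (\<lambda>r. (r, fl_ins z))"
      using fl_ins_carrier[OF zX] top by (simp add: continuous_map_pairedI)
    then have "continuous_map euclideanreal T ((\<lambda>(r, f). \<lambda>y. r * f y) \<circ> (\<lambda>r. (r, fl_ins z)))"
      using T unfolding lc_topology_def by (blast intro: continuous_map_compose)
    from openin_continuous_map_preimage[OF this V(1)]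
    have "open {r. (\<lambda>y. r * fl_ins z y) \<in> V}" by simp
    moreover have "0 \<in> {r. (\<lambda>y. r * fl_ins z y) \<in> V}"
      using abs_convex_zero[OF V(2)] by simp
    ultimately obtain e where e: "e > 0" "ball 0 e \<subseteq> {r. (\<lambda>y. r * fl_ins z y) \<in> V}"
      using openE by blast
    obtain k where "1 / (real k + 1) < e"
      using reals_Archimedean[OF e(1)] by (auto simp: inverse_eq_divide add.commute)
    then have "1 / (real k + 1) \<in> ball 0 e" by simp
    then show "z \<in> (\<Union>k. Q k)"
      using e(2) zX unfolding Q_def by blast
  qed
  then have "\<exists>F. finite F \<and> F \<subseteq> range Q \<and> K m \<subseteq> \<Union>F"
    using K_compact[of m] Q_open unfolding compactin_def by auto
  then obtain F where F: "finite F" "F \<subseteq> range Q" "K m \<subseteq> \<Union>F"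
    by (elim exE conjE) (rule that)
  then obtain D where D: "finite D" "F = Q ` D"
    using finite_subset_image[of F Q UNIV] by auto
  define k2 where "k2 = Max (insert 0 D)"
  have k2: "K m \<subseteq> Q k2"
  proof
    fix z assume "z \<in> K m"
    then obtain k where "k \<in> D" "z \<in> Q k" using F(3) D(2) by auto
    moreover have "k \<le> k2" unfolding k2_def using D(1) \<open>k \<in> D\<close> by (intro Max_ge) auto
    ultimately show "z \<in> Q k2" using Q_mono by blast
  qed
  have "lcs_gen m (max k1 k2) \<subseteq> V"
  proof
    fix u assume "u \<in> lcs_gen m (max k1 k2)"
    then show "u \<in> V"
    proof (cases rule: lcs_gen_cases)
      case (1 a b)
      then have "(a, b) \<in> E m k1" using E_antimono[of k1 "max k1 k2"] by auto
      moreover from this have "fl_ins a \<in> fl_carrier X" using E_topspace by (simp add: fl_ins_carrier)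
      ultimately have "(\<lambda>y. - fl_ins a y + fl_ins b y) \<in> V'"
        using k1 by (auto simp: fl_group_inv)
      then show ?thesis unfolding V'_def 1(2) by (simp add: algebra_simps)
    next
      case (2 t z)
      have "1 / (real (max k1 k2) + 1) \<le> 1 / (real k2 + 1)"
        by (intro divide_left_mono) auto
      with 2(2) have "\<bar>t\<bar> \<le> 1 / (real k2 + 1)" by (rule order_trans)
      then have "\<bar>t * (real k2 + 1)\<bar> \<le> 1"
        by (simp add: abs_mult divide_simps)
      moreover have "(\<lambda>y. 1 / (real k2 + 1) * fl_ins z y) \<in> V"
        using k2 2(1) by (auto simp: Q_def)
      ultimately have "(\<lambda>y. (t * (real k2 + 1)) * (1 / (real k2 + 1) * fl_ins z y)) \<in> V"
        using abs_convex_scale[OF V(2)] by blast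
      then show ?thesis unfolding 2(3) by simp
    qed
  qed
  then show ?thesis ..
qed

theorem free_lcs_eq: "free_lcs X = lcs.base_topology"
  unfolding free_lcs_def
proof (rule sup_topology_eq_greatest)
  show "lc_topology (fl_carrier X) lcs.base_topology \<and> continuous_map X lcs.base_topology fl_ins"
    using lc_topology_lcs continuous_fl_ins by blast
  fix T U assume T: "lc_topology (fl_carrier X) T \<and> continuous_map X T fl_ins" and U: "openin T U"
  interpret T: top_group "fl_group X" T
    using T lc_topology_group_topology by blast
  show "openin lcs.base_topology U"
  proof (rule lcs.base_topology_finest[OF T.group_topology _ U])
    fix W assume "openin T W" "\<one>\<^bsub>fl_group X\<^esub> \<in> W"
    then obtain V where V: "openin T V" "V \<subseteq> W" "abs_convex V"
      using lc_topology_abs_convex_nbhd[OF conjunct1[OF T], of W] by auto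
    have "\<forall>m. \<exists>k. lcs_gen m k \<subseteq> V"
      using lcs_gen_small T V(1,3) by blast
    then obtain \<alpha> where "\<forall>m. lcs_gen m (\<alpha> m) \<subseteq> V" by metis
    then have "lcs_nbhd \<alpha> \<subseteq> W"
      using lcs_nbhd_least[of \<alpha> V] V(2,3) by blast
    then show "\<exists>\<alpha>. lcs_nbhd \<alpha> \<subseteq> W" by (rule exI[of _ \<alpha>])
  qed
qed simp

text \<open>The topology induced by the functional is admissible, hence coarser than the free
  one.\<close>

lemma lcs_functional_open:
  fixes h :: "'a \<Rightarrow> real"
  assumes "continuous_map X euclideanreal h"
  shows "openin lcs.base_topology {f \<in> fl_carrier X. \<bar>\<Sum>x | f x \<noteq> 0. f x * h x\<bar> < \<epsilon>}"
proof -
  let ?H = "\<lambda>f. \<Sum>x | f x \<noteq> 0. f x * h x"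
  let ?T = "pullback_topology (fl_carrier X) ?H euclideanreal"
  have "?H (fl_ins x) = h x" for x
    by (simp add: fl_ins_def)
  then have "continuous_map X ?T fl_ins"
    using assms fl_ins_carrier by (intro continuous_map_pullback') (auto simp: comp_def)
  moreover have "lc_topology (fl_carrier X) ?T"
    by (rule lc_topology_pullback) (rule fl_functional_linear)
  moreover have "openin ?T {f \<in> fl_carrier X. \<bar>?H f\<bar> < \<epsilon>}"
    unfolding openin_pullback_topology by (rule exI[of _ "{-\<epsilon><..<\<epsilon>}"]) auto
  ultimately show ?thesis
    unfolding free_lcs_eq[symmetric] free_lcs_def sup_topology_def
    by (intro topology_generated_by_Basis) blast
qed

end

section \<open>Properties of the free locally convex space\<close>

context mk_space
begin

lemma lcs_separated:
  assumes g: "g \<in> fl_carrier X" "g \<noteq> (\<lambda>_. 0)"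
  shows "\<exists>\<alpha>. g \<notin> lcs_nbhd \<alpha>"
proof -
  obtain x where x: "g x \<noteq> 0" using g(2) by auto
  have supp: "finite {x. g x \<noteq> 0}" "{x. g x \<noteq> 0} \<subseteq> topspace X"
    using g(1) by (auto simp: fl_carrier_def)
  obtain h where h: "continuous_map X euclideanreal h" "\<And>y. y \<in> {x. g x \<noteq> 0} \<Longrightarrow> h y = (if y = x then 1 else 0)"
    by (rule interpolating_function[OF supp, of "\<lambda>y. if y = x then 1 else 0"]) (rule that)
  have "(\<Sum>y | g y \<noteq> 0. g y * h y) = (\<Sum>y | g y \<noteq> 0. if y = x then g y else 0)"
    using h(2) by (intro sum.cong) auto
  also have "\<dots> = g x"
    using supp(1) x by simp
  finally have gx: "(\<Sum>y | g y \<noteq> 0. g y * h y) = g x" .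
  let ?W = "{f \<in> fl_carrier X. \<bar>\<Sum>x | f x \<noteq> 0. f x * h x\<bar> < \<bar>g x\<bar>}"
  have "openin lcs.base_topology ?W" "(\<lambda>_. 0) \<in> ?W"
    using lcs_functional_open[OF h(1)] x fl_carrier_zero by auto
  then obtain \<alpha> where "\<forall>u\<in>lcs_nbhd \<alpha>. (\<lambda>_. 0) \<otimes>\<^bsub>fl_group X\<^esub> u \<in> ?W"
    unfolding lcs.openin_base_topology by blast
  then have "g \<notin> lcs_nbhd \<alpha>"
    using gx by auto
  then show ?thesis by (rule exI[of _ \<alpha>])
qed

text \<open>Every element is a finite sum of vectors \<open>r x\<close>. These are the image of the
  product of the line with \<open>X\<close> under a continuous map, which carries products of a
  countable base and a countable network to a network.\<close>

lemma P0_space_lcs: "P0_space lcs.base_topology"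
proof (rule countable_network)
  fix \<B> assume \<B>: "countable \<B>"
    "\<And>W x. openin X W \<Longrightarrow> x \<in> W \<Longrightarrow> \<exists>B\<in>\<B>. x \<in> B \<and> B \<subseteq> W"
  obtain \<R> :: "real set set" where \<R>: "countable \<R>" "topological_basis \<R>"
    using ex_countable_basis by blast
  let ?m = "\<lambda>(r, x). (\<lambda>y. r * fl_ins x y)"
  let ?\<L> = "(\<lambda>(R, B). ?m ` (R \<times> B)) ` (\<R> \<times> \<B>)"
  let ?L = "?m ` (UNIV \<times> topspace X)"
  have m_carrier: "(\<lambda>y. r * fl_ins x y) \<in> fl_carrier X" if "x \<in> topspace X" for r x
    using fl_carrier_scale[OF fl_ins_carrier[OF that]] .
  interpret T: top_group "fl_group X" lcs.base_topology
    by (rule lc_topology_group_topology[OF lc_topology_lcs])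
  have "continuous_map (prod_topology euclideanreal X) (prod_topology euclideanreal lcs.base_topology)
      (\<lambda>z. (fst z, fl_ins (snd z)))"
    using continuous_map_fst[of euclideanreal X] continuous_map_compose[OF continuous_map_snd continuous_fl_ins, of euclideanreal]
    by (intro continuous_map_pairedI) (auto simp: comp_def)
  from continuous_map_compose[OF this lcs_continuous_scale]
  have cont: "continuous_map (prod_topology euclideanreal X) lcs.base_topology ?m"
    by (simp add: comp_def case_prod_unfold)
  show ?thesis
  proof (rule T.countable_network_products[where \<B> = ?\<L> and L = ?L])
    show "countable ?\<L>" using \<R>(1) \<B>(1) by (intro countable_image countable_SIGMA)
    show "?L \<subseteq> carrier (fl_group X)"
      using m_carrier by auto
    show "\<exists>xs. set xs \<subseteq> ?L \<and> g = lcs.lprod xs" if "g \<in> carrier (fl_group X)" for g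
    proof -
      have "g \<in> fl_carrier X" using that by simp
      then show ?thesis
      proof (induction rule: fl_carrier_induct)
        case zero
        show ?case by (intro exI[of _ "[]"]) simp
      next
        case (add f x c)
        then obtain xs where "set xs \<subseteq> ?L" "f = lcs.lprod xs" by blast
        then show ?case
          using add.hyps(2) by (intro exI[of _ "(\<lambda>y. c * fl_ins x y) # xs"]) auto
      qed
    qed
    fix W l assume W: "openin lcs.base_topology W" "l \<in> W" "l \<in> ?L"
    then obtain r x where l: "x \<in> topspace X" "l = (\<lambda>y. r * fl_ins x y)" by auto
    define Z where "Z = {z \<in> topspace (prod_topology euclideanreal X). ?m z \<in> W}"
    have "openin (prod_topology euclideanreal X) Z"
      unfolding Z_def by (rule openin_continuous_map_preimage[OF cont W(1)])
    moreover have "(r, x) \<in> Z"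
      unfolding Z_def using l W(2) by simp
    ultimately have "\<exists>A Q. openin euclideanreal A \<and> openin X Q \<and> r \<in> A \<and> x \<in> Q \<and> A \<times> Q \<subseteq> Z"
      unfolding openin_prod_topology_alt by simp
    then obtain A Q where AQ: "open A" "openin X Q" "r \<in> A" "x \<in> Q" "A \<times> Q \<subseteq> Z"
      by auto
    obtain R where R: "R \<in> \<R>" "r \<in> R" "R \<subseteq> A"
      using topological_basisE[OF \<R>(2) AQ(1,3)] by blast
    obtain B where B: "B \<in> \<B>" "x \<in> B" "B \<subseteq> Q"
      using \<B>(2)[OF AQ(2,4)] by blast
    have "?m ` (R \<times> B) \<subseteq> W"
      using AQ(5) R(3) B(3) unfolding Z_def by blast
    moreover have "l \<in> ?m ` (R \<times> B)"
      unfolding l(2) using R(2) B(2) by (intro image_eqI[of _ _ "(r, x)"]) auto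
    moreover have "?m ` (R \<times> B) \<in> ?\<L>"
      using R(1) B(1) by (intro image_eqI[of _ _ "(R, B)"]) auto
    ultimately show "\<exists>B\<in>?\<L>. l \<in> B \<and> B \<subseteq> W"
      by (intro bexI[of _ "?m ` (R \<times> B)"] conjI)
  next
    fix \<N> assume "countable \<N>" "\<And>W x. openin lcs.base_topology W \<Longrightarrow> x \<in> W \<Longrightarrow> \<exists>N\<in>\<N>. x \<in> N \<and> N \<subseteq> W"
    then show ?thesis
      using lcs_separated by (intro lcs.P0_space_base_topology[of \<N>]) auto
  qed
qed

lemma character_lcs_nondiscrete:
  assumes "X \<noteq> discrete_topology (topspace X)"
  shows "character_eq lcs.base_topology dfrak"
  unfolding character_eq_def
proof (intro conjI allI impI)
  fix C :: "('a \<Rightarrow> real) set set set" assume C: "char_le lcs.base_topology C"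
  show "|dfrak| \<le>o |C|"
  proof (rule dfrak_le_character_free[OF lc_topology_group_topology[OF lc_topology_lcs] continuous_fl_ins assms _ C])
    fix h :: "'a \<Rightarrow> real" assume h: "continuous_map X euclideanreal h"
    let ?H = "\<lambda>f. \<Sum>x | f x \<noteq> 0. f x * h x"
    have "?H (\<lambda>y. f y + g y) = ?H f + ?H g" if "f \<in> fl_carrier X" "g \<in> fl_carrier X" for f g
      using fl_functional_linear[OF that, of 1 1 h] by simp
    moreover have "?H (fl_ins x) = h x" for x
      by (simp add: fl_ins_def)
    ultimately show "\<exists>H. (\<forall>x\<in>carrier (fl_group X). \<forall>y\<in>carrier (fl_group X). H (x \<otimes>\<^bsub>fl_group X\<^esub> y) = H x + H y) \<and>
        (\<forall>x\<in>topspace X. H (fl_ins x) = h x) \<and>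
        openin lcs.base_topology {g \<in> carrier (fl_group X). \<bar>H g\<bar> < 1}"
      using lcs_functional_open[OF h, of 1] by (intro exI[of _ ?H]) simp
  qed
qed (rule lcs.char_le_dfrak)

text \<open>Scalars replace the convergent sequence: \<open>p n / (i + 1)\<close> tends to 0 for
  each \<open>n\<close>. Since every function on \<open>X\<close> is continuous, a continuous
  functional can take the value \<open>g n + 1\<close> at \<open>p n\<close>, and
  \<open>(g n + 1) / (i + 1) < 1\<close> forces \<open>g n < i\<close>.\<close>

lemma character_lcs_infinite_discrete:
  assumes "X = discrete_topology (topspace X)" and "infinite (topspace X)"
  shows "character_eq lcs.base_topology dfrak"
  unfolding character_eq_def
proof (intro conjI allI impI)
  fix C :: "('a \<Rightarrow> real) set set set" assume C: "char_le lcs.base_topology C"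
  obtain p :: "nat \<Rightarrow> 'a" where p: "inj p" "range p \<subseteq> topspace X"
    using infinite_countable_subset[OF assms(2)] by blast
  let ?u = "\<lambda>n i y. 1 / (real i + 1) * fl_ins (p n) y"
  show "|dfrak| \<le>o |C|"
  proof (rule dfrak_le_character[OF _ C])
    show "(\<lambda>_. 0) \<in> topspace lcs.base_topology"
      by (simp add: fl_carrier_zero)
    fix W n assume "nbhd lcs.base_topology (\<lambda>_. 0) W"
    then obtain \<alpha> where \<alpha>: "\<forall>u\<in>lcs_nbhd \<alpha>. (\<lambda>_. 0) \<otimes>\<^bsub>fl_group X\<^esub> u \<in> W"
      unfolding lcs.nbhd_base_topology by blast
    have "fl_ins (p n) \<in> fl_carrier X"
      using p(2) by (intro fl_ins_carrier) blast
    then obtain \<epsilon> where \<epsilon>: "\<epsilon> > 0" "\<And>r. \<bar>r\<bar> \<le> \<epsilon> \<Longrightarrow> (\<lambda>y. r * fl_ins (p n) y) \<in> lcs_nbhd \<alpha>"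
      using lcs_nbhd_absorbing by blast
    obtain i where "1 / (real i + 1) < \<epsilon>"
      using reals_Archimedean[OF \<epsilon>(1)] by (auto simp: inverse_eq_divide add.commute)
    then have "?u n i \<in> lcs_nbhd \<alpha>" by (intro \<epsilon>(2)) simp
    from bspec[OF \<alpha> this] have "?u n i \<in> W" by simp
    then show "\<exists>i. ?u n i \<in> W" by (rule exI)
  next
    fix g :: "nat \<Rightarrow> nat"
    define h where "h x = real (g (inv_into UNIV p x)) + 1" for x
    have h: "continuous_map X euclideanreal h"
      by (subst assms(1)) simp
    have hp: "h (p n) = real (g n) + 1" for n
      unfolding h_def using p(1) by simp
    let ?W = "{f \<in> fl_carrier X. \<bar>\<Sum>x | f x \<noteq> 0. f x * h x\<bar> < 1}"
    have "nbhd lcs.base_topology (\<lambda>_. 0) ?W"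
      unfolding nbhd_def using lcs_functional_open[OF h, of 1] fl_carrier_zero
      by (intro exI[of _ ?W]) auto
    moreover have "g n \<le> i" if "?u n i \<in> ?W" for n i
    proof -
      have "(\<Sum>x | ?u n i x \<noteq> 0. ?u n i x * h x) = (real (g n) + 1) / (real i + 1)"
        using hp by (simp add: fl_ins_def)
      then have "\<bar>(real (g n) + 1) / (real i + 1)\<bar> < 1" using that by simp
      then show ?thesis by (simp add: divide_simps)
    qed
    ultimately show "\<exists>W. nbhd lcs.base_topology (\<lambda>_. 0) W \<and> (\<forall>n i. ?u n i \<in> W \<longrightarrow> g n \<le> i)"
      by blast
  qed
qed (rule lcs.char_le_dfrak)

text \<open>Close pairs can be made trivial at every level, so up to cofinality
  \<open>lcs_nbhd \<alpha>\<close> depends on the single number \<open>\<alpha> m\<close>, where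
  \<open>K m\<close> is the whole space. A finite base would leave some
  \<open>lcs_nbhd \<alpha>\<close> inside all its members; by absorption it contains a nonzero
  vector, contrary to separation.\<close>

lemma character_lcs_finite_discrete:
  assumes discrete: "X = discrete_topology (topspace X)" and fin: "finite (topspace X)"
    and ne: "topspace X \<noteq> {}"
  shows "character_eq lcs.base_topology (UNIV :: nat set)"
  unfolding character_eq_def
proof (intro conjI allI impI)
  have "\<exists>k. \<forall>(x, y)\<in>E n k. id x = id y" for n
  proof (rule E_uniform)
    show "continuous_map X X id" by simp
    show "\<exists>V. openin X V \<and> id x \<in> V \<and> (\<forall>p\<in>V. \<forall>q\<in>V. p = q)" if "x \<in> topspace X" for x
    proof -
      have "openin X {x}" using that by (subst discrete) simp
      then show ?thesis by (intro exI[of _ "{x}"]) auto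
    qed
  qed
  then have "\<exists>e. \<forall>n. \<forall>(x, y)\<in>E n (e n). id x = id y"
    by (intro choice allI)
  then obtain e where "\<forall>n. \<forall>(x, y)\<in>E n (e n). id x = id y" by (rule exE)
  then have e: "x = y" if "(x, y) \<in> E n (e n)" for n x y
    using that by auto
  obtain m where m: "topspace X \<subseteq> K m"
    by (rule finite_subset_piece[OF fin subset_refl]) (rule that)
  \<comment> \<open>The entry \<open>e n\<close> reduces the differences at level \<open>n\<close>
    to 0, and \<open>c\<close> controls the scalars at all levels.\<close>
  define j where "j c n = max c (e n)" for c n
  have cofinal: "lcs_nbhd (j (\<alpha> m)) \<subseteq> lcs_nbhd \<alpha>" for \<alpha>
  proof (rule lcs_nbhd_least[OF _ abs_convex_lcs_nbhd], rule subsetI)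
    fix n u assume "u \<in> lcs_gen n (j (\<alpha> m) n)"
    then show "u \<in> lcs_nbhd \<alpha>"
    proof (cases rule: lcs_gen_cases)
      case (1 a b)
      then have "a = b"
        using E_antimono[of "e n" "j (\<alpha> m) n" n] e by (auto simp: j_def)
      then show ?thesis
        using 1(2) abs_convex_zero[OF abs_convex_lcs_nbhd] by simp
    next
      case (2 t z)
      have "1 / (real (j (\<alpha> m) n) + 1) \<le> 1 / (real (\<alpha> m) + 1)"
        by (intro divide_left_mono) (auto simp: j_def)
      with 2(2) have t: "\<bar>t\<bar> \<le> 1 / (real (\<alpha> m) + 1)" by (rule order_trans)
      have "z \<in> K m" using 2(1) K_topspace m by blast
      from lcs_gen_scale[OF this t] show ?thesis
        unfolding 2(3) by (rule subsetD[OF lcs_gen_nbhd])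
    qed
  qed
  show "char_le lcs.base_topology (UNIV :: nat set)"
    unfolding char_le_def
  proof
    fix x assume "x \<in> topspace lcs.base_topology"
    then have x: "x \<in> carrier (fl_group X)" by simp
    have "\<exists>i\<in>range j. lcs_nbhd i \<subseteq> lcs_nbhd \<alpha>" for \<alpha>
      using cofinal[of \<alpha>] by blast
    from lcs.nbhd_base_translates[OF x this]
    show "\<exists>B. nbhd_base lcs.base_topology x B \<and> |B| \<le>o |UNIV :: nat set|"
      unfolding image_image using card_of_image by blast
  qed
  fix C :: "('a \<Rightarrow> real) set set set" assume "char_le lcs.base_topology C"
  then obtain B where B: "nbhd_base lcs.base_topology (\<lambda>_. 0) B" "|B| \<le>o |C|"
    unfolding char_le_def using fl_carrier_zero by (metis fl_group_simps(1) lcs.topspace_base_topology)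
  have "infinite B"
  proof
    assume "finite B"
    moreover have "\<forall>N\<in>B. \<exists>\<alpha>. lcs_nbhd \<alpha> \<subseteq> N"
    proof
      fix N assume "N \<in> B"
      then have "nbhd lcs.base_topology (\<lambda>_. 0) N"
        using B(1) unfolding nbhd_base_def by blast
      then obtain \<alpha> where "\<forall>u\<in>lcs_nbhd \<alpha>. (\<lambda>_. 0) \<otimes>\<^bsub>fl_group X\<^esub> u \<in> N"
        unfolding lcs.nbhd_base_topology by blast
      then show "\<exists>\<alpha>. lcs_nbhd \<alpha> \<subseteq> N" by (intro exI[of _ \<alpha>]) auto
    qed
    ultimately have "\<exists>\<alpha>. \<forall>N\<in>B. lcs_nbhd \<alpha> \<subseteq> N"
    proof (induction B rule: finite_induct)
      case (insert N B)
      then obtain \<alpha> \<beta> where "\<forall>N\<in>B. lcs_nbhd \<alpha> \<subseteq> N" "lcs_nbhd \<beta> \<subseteq> N" by auto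
      moreover obtain \<gamma> where "lcs_nbhd \<gamma> \<subseteq> lcs_nbhd \<alpha> \<inter> lcs_nbhd \<beta>"
        using lcs.U_inter ..
      ultimately show ?case by (intro exI[of _ \<gamma>]) auto
    qed simp
    then obtain \<alpha> where \<alpha>: "\<forall>N\<in>B. lcs_nbhd \<alpha> \<subseteq> N" ..
    obtain x where x: "x \<in> topspace X" using ne by blast
    obtain \<epsilon> where \<epsilon>: "\<epsilon> > 0" "\<And>r. \<bar>r\<bar> \<le> \<epsilon> \<Longrightarrow> (\<lambda>y. r * fl_ins x y) \<in> lcs_nbhd \<alpha>"
      using lcs_nbhd_absorbing[OF fl_ins_carrier[OF x]] by blast
    let ?v = "\<lambda>y. \<epsilon> * fl_ins x y"
    have v: "?v \<in> lcs_nbhd \<alpha>" using \<epsilon>(1) by (intro \<epsilon>(2)) simp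
    have "?v x \<noteq> 0" using \<epsilon>(1) by (simp add: fl_ins_def)
    then have "?v \<noteq> (\<lambda>_. 0)" by metis
    then obtain \<beta> where \<beta>: "?v \<notin> lcs_nbhd \<beta>"
      using lcs_separated[of ?v] v lcs_nbhd_carrier by blast
    have "nbhd lcs.base_topology (\<lambda>_. 0) (lcs_nbhd \<beta>)"
      using lcs.U_nbhd by simp
    then obtain N where "N \<in> B" "N \<subseteq> lcs_nbhd \<beta>"
      using B(1) unfolding nbhd_base_def by blast
    then show False using \<alpha> v \<beta> by blast
  qed
  then have "|UNIV :: nat set| \<le>o |B|"
    by (simp add: infinite_iff_card_of_nat)
  then show "|UNIV :: nat set| \<le>o |C|"
    using B(2) by (rule ordLeq_transitive)
qed

end

text \<open>Over the empty space L(X) is the zero space, of character 1; nonemptiness is what makes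
  the finite discrete case infinite in character.\<close>

theorem mainTheorem5:
  fixes X :: "'a topology"
  assumes "MK_omega_space X"
    and "topspace X \<noteq> {}"
  shows "has_G_base_D (free_abelian_top_group X) (\<lambda>_. 0)
       \<and> has_G_base_D (free_top_group X) []
       \<and> has_G_base_D (free_lcs X) (\<lambda>_. 0)
       \<and> P0_space (free_abelian_top_group X)
       \<and> P0_space (free_top_group X)
       \<and> P0_space (free_lcs X)
       \<and> (X \<noteq> discrete_topology (topspace X) \<longrightarrow>
            character_eq (free_abelian_top_group X) dfrak
          \<and> character_eq (free_top_group X) dfrak
          \<and> character_eq (free_lcs X) dfrak)
       \<and> (X = discrete_topology (topspace X) \<longrightarrow>
            character_eq (free_abelian_top_group X) {()}
          \<and> character_eq (free_top_group X) {()}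
          \<and> (finite (topspace X) \<longrightarrow> character_eq (free_lcs X) (UNIV :: nat set))
          \<and> (infinite (topspace X) \<longrightarrow> character_eq (free_lcs X) dfrak))"
proof -
  obtain K d where mk: "mk_space X K d"
    by (rule MK_omega_space_imp_mk_space[OF assms(1)]) (rule that)
  interpret mk_space X K d by (rule mk)
  have "has_G_base_D (free_lcs X) (\<lambda>_. 0)"
    unfolding free_lcs_eq has_G_base_D_def using lcs.G_base_D_base_topology by auto
  then show ?thesis
    using free_abelian_top_group_properties[OF mk] free_top_group_properties[OF mk]
      P0_space_lcs[folded free_lcs_eq] character_lcs_nondiscrete[folded free_lcs_eq]
      character_lcs_infinite_discrete[folded free_lcs_eq]
      character_lcs_finite_discrete[folded free_lcs_eq] assms(2)
    by (intro conjI impI)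
qed

end
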